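(* Let $X$ be a metrizable space which is an algebraic absolute neighborhood retract over $\mathbb{Q}$ (a $\mathbb{Q}$-RAV algébrique), and let $F$ be a compact upper semicontinuous multivalued map from $X$ to $X$ which is approximable by compact chain morphisms. If $\Lambda(F)\neq 0$, then $F$ has a fixed point, i.e. there is $x\in X$ with $x\in F(x)$. In particular, $F$ has a fixed point if the reduced singular homology $\widetilde H(X,\mathbb{Q})$ is $0$.
   Context: **Chains.** For a topological space $X$, $S(X,\mathbb{Q})$ is the singular chain complex of $X$ with rational coefficients, $H(X,\mathbb{Q})$ its graded homology, and $\widetilde H(X,\mathbb{Q})$ its reduced homology (the homology of the augmented complex). For $A\subset X$, $S(A,\mathbb{Q})$ is regarded as a subcomplex of $S(X,\mathbb{Q})$. The support $\|c\|$ of a singular chain $c$ is the union of the images of the singular simplices occurring in $c$ with nonzero coefficient. For an open cover $\mathcal{V}$ of $X$, $S(X,\mathcal{V},\mathbb{Q})$ is the subcomplex of $S(X,\mathbb{Q})$ generated by the singular simplices whose image is contained in an element of $\mathcal{V}$. The inclusion $S(X,\mathcal{V},\mathbb{Q})\subset S(X,\mathbb{Q})$ induces an isomorphism on homology, by which the homology of $S(X,\mathcal{V},\mathbb{Q})$ is identified with $H(X,\mathbb{Q})$; thus a chain morphism $\varphi:S(X,\mathcal{V},\mathbb{Q})\to S(X,\mathbb{Q})$ induces an endomorphism $\varphi_*$ of $H(X,\mathbb{Q})$. For a simplicial complex $K$, $C(K,\mathbb{Q})$ is its oriented chain complex with rational coefficients; each simplex $\sigma$ of $K$ is identified with a fixed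 generator of $C_{\dim\sigma}(\sigma,\mathbb{Q})$. All these complexes are naturally augmented, and all chain morphisms between them are assumed to preserve the augmentation. **Algebraic absolute neighborhood retracts.** Let $\mathcal{U}$ be an open cover of $X$ and $K$ a simplicial complex. A partial algebraic realization of $K$ relative to $\mathcal{U}$ consists of a subcomplex $L$ of $K$ containing all vertices of $K$ and a chain morphism $\mu:C(L,\mathbb{Q})\to S(X,\mathbb{Q})$ such that for every simplex $\sigma$ of $K$ there is an element of $\mathcal{U}$ containing $\|\mu(\tau)\|$ for every face $\tau$ of $\sigma$ belonging to $L$. It is called complete if $L=K$. A metrizable space $X$ is a $\mathbb{Q}$-RAV algébrique if for every open cover $\mathcal{U}$ of $X$ there is an open cover $\mathcal{V}$ of $X$ finer than $\mathcal{U}$ such that, for every simplicial complex $K$, every partial algebraic realization of $K$ relative to $\mathcal{V}$ extends to a complete algebraic realization of $K$ relative to $\mathcal{U}$. **Multivalued maps.** A multivalued map $F$ from $X$ to $Y$ assigns to every $x\in X$ a nonempty closed subset $F(x)$ of $Y$; for $A\subset X$, $F(A)=\bigcup_{x\in A}F(x)$. $F$ is upper semicontinuous if $\{x\in X: F(x)\subset U\}$ is open in $X$ for every open $U\subset Y$, and compact if $F(X)$ is contained in a compact subset of $Y$. **Approximability.** A chain morphism $\varphi:S(X,\mathcal{V},\mathbb{Q})\to S(Y,\mathbb{Q})$ is compact if there is a compact $C\subset Y$ such that the image of $\varphi$ is contained in $S(C,\mathbb{Q})$. Metrizable spaces are equipped with an arbitrary fixed compatible metric $d$, and $B(A,\epsilon)=\{y: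 d(y,A)<\epsilon\}$. Let $X,Y$ be metrizable and let $F$ be a compact upper semicontinuous multivalued map from $X$ to $Y$. Given an open cover $\mathcal{U}$ of $X$ and $\epsilon>0$, say that a pair $(\mathcal{V},\varphi)$, where $\mathcal{V}$ is an open cover of $X$ and $\varphi:S(X,\mathcal{V},\mathbb{Q})\to S(Y,\mathbb{Q})$ is a compact chain morphism, is a $(\mathcal{U},\epsilon)$-approximation of $F$ if for every $V\in\mathcal{V}$ there is $U\in\mathcal{U}$ with $V\subset U$ and $\varphi(S(V,\mathbb{Q}))\subset S(B(F(U),\epsilon),\mathbb{Q})$. $F$ is approximable by compact chain morphisms if it has a $(\mathcal{U},\epsilon)$-approximation for every open cover $\mathcal{U}$ of $X$ and every $\epsilon>0$. (By compactness of $F$, this does not depend on the metric on $Y$.) **Lefschetz number.** If $X$ is a $\mathbb{Q}$-RAV algébrique and $\varphi:S(X,\mathcal{V},\mathbb{Q})\to S(X,\mathbb{Q})$ is a compact chain morphism, then $\varphi_*$ has finite-dimensional image in $H(X,\mathbb{Q})$ (a known fact), and its Lefschetz number is $\Lambda(\varphi_* )=\sum_q(-1)^q\operatorname{tr}(\varphi_{*q})$, where the trace of a finite-rank endomorphism of a vector space is the trace of its restriction to its image. For $F$ from $X$ to $X$ compact, upper semicontinuous and approximable by compact chain morphisms, exactly one of the following two cases occurs, and $\Lambda(F)$ is defined accordingly: (1) There are an open cover $\mathcal{U}_0$ of $X$, $\epsilon_0>0$ and $q_0\in\mathbb{Q}$ such that for every open cover $\mathcal{U}$ finer than $\mathcal{U}_0$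 and every $0<\epsilon<\epsilon_0$, every $(\mathcal{U},\epsilon)$-approximation $(\mathcal{V},\varphi)$ of $F$ satisfies $\Lambda(\varphi_* )=q_0$. Then $\Lambda(F)=q_0$. (2) For every open cover $\mathcal{U}$ of $X$, every $\epsilon>0$ and every $q\in\mathbb{Q}$, there is a $(\mathcal{U},\epsilon)$-approximation $(\mathcal{V},\varphi)$ of $F$ with $\Lambda(\varphi_* )=q$. Then $\Lambda(F)=\mathbb{Q}$ (the whole set). Thus $\Lambda(F)\neq0$ means that either case (1) holds with $q_0\ne0$, or case (2) holds. *)

theory Defs
  imports
    "HOL-Analysis.Analysis"
    "HOL-Homology.Homology"
    "HOL-Combinatorics.Combinatorics"
    "Jordan_Normal_Form.VS_Connect"
begin

section \<open>Rational chain complexes and their homology\<close>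

type_synonym 'k qchain = "'k \<Rightarrow>\<^sub>0 rat"

definition qscale :: "rat \<Rightarrow> 'k qchain \<Rightarrow> 'k qchain" where
  "qscale r c = Poly_Mapping.map ((*) r) c"

definition augmentation :: "'k qchain \<Rightarrow> rat" where
  "augmentation c = (\<Sum>x\<in>Poly_Mapping.keys c. Poly_Mapping.lookup c x)"

text \<open>The chains of each degree form a subspace of an ambient space of formal rational
  combinations, so subcomplexes are literally subsets. Boundary operators are zero in degree 0;
  the augmentation of every complex below is the sum of the coefficients in degree 0.\<close>

record 'k qcomplex =
  chains :: "nat \<Rightarrow> 'k qchain set"
  bdry :: "nat \<Rightarrow> 'k qchain \<Rightarrow> 'k qchain"

definition chain_morphism ::
  "'k qcomplex \<Rightarrow> 'l qcomplex \<Rightarrow> (nat \<Rightarrow> 'k qchain \<Rightarrow> 'l qchain) \<Rightarrow> bool" where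
  "chain_morphism C D \<phi> \<longleftrightarrow>
     (\<forall>p. \<forall>c\<in>chains C p. \<phi> p c \<in> chains D p) \<and>
     (\<forall>p. \<forall>c\<in>chains C p. \<forall>c'\<in>chains C p. \<phi> p (c + c') = \<phi> p c + \<phi> p c') \<and>
     (\<forall>p r. \<forall>c\<in>chains C p. \<phi> p (qscale r c) = qscale r (\<phi> p c)) \<and>
     (\<forall>p. \<forall>c\<in>chains C (Suc p). \<phi> p (bdry C (Suc p) c) = bdry D (Suc p) (\<phi> (Suc p) c)) \<and>
     (\<forall>c\<in>chains C 0. augmentation (\<phi> 0 c) = augmentation c)"

definition coset :: "'c::ab_group_add set \<Rightarrow> 'c \<Rightarrow> 'c set" where
  "coset B z = (\<lambda>b. z + b) ` B"

text \<open>The quotient space \<open>Z / B\<close> over the rationals, where \<open>s\<close> is the scalar multiplication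
  of the ambient space. The fields \<open>mult\<close> and \<open>one\<close> play no role in a module.\<close>

definition quotient_space ::
  "(rat \<Rightarrow> 'c \<Rightarrow> 'c) \<Rightarrow> 'c::ab_group_add set \<Rightarrow> 'c set \<Rightarrow> (rat, 'c set) module" where
  "quotient_space s Z B =
     \<lparr>carrier = coset B ` Z,
      monoid.mult = (\<lambda>_ _. undefined), one = undefined,
      zero = B,
      add = (\<lambda>A A'. {a + a' | a a'. a \<in> A \<and> a' \<in> A'}),
      smult = (\<lambda>r A. \<Union>a\<in>A. coset B (s r a))\<rparr>"

definition cycles :: "'k qcomplex \<Rightarrow> nat \<Rightarrow> 'k qchain set" where
  "cycles C q = {c \<in> chains C q. bdry C q c = 0}"

definition boundaries :: "'k qcomplex \<Rightarrow> nat \<Rightarrow> 'k qchain set" where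
  "boundaries C q = bdry C (Suc q) ` chains C (Suc q)"

definition homology :: "'k qcomplex \<Rightarrow> nat \<Rightarrow> (rat, 'k qchain set) module" where
  "homology C q = quotient_space qscale (cycles C q) (boundaries C q)"

definition homology_map ::
  "'k qcomplex \<Rightarrow> 'l qcomplex \<Rightarrow> (nat \<Rightarrow> 'k qchain \<Rightarrow> 'l qchain) \<Rightarrow> nat \<Rightarrow>
     'k qchain set \<Rightarrow> 'l qchain set" where
  "homology_map C D \<phi> q A = (\<Union>z\<in>A. coset (boundaries D q) (\<phi> q z))"

text \<open>Homology of the augmented complex. It has a term in degree \<open>-1\<close>, the cokernel of the
  augmentation, which vanishes exactly when there is a chain of nonzero augmentation; hence
  trivial reduced homology of a space entails that the space is nonempty.\<close>

definition reduced_homology :: "'k qcomplex \<Rightarrow> nat \<Rightarrow> (rat, 'k qchain set) module" where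
  "reduced_homology C q =
     quotient_space qscale
       (if q = 0 then {c \<in> chains C 0. augmentation c = 0} else cycles C q) (boundaries C q)"

definition reduced_homology_minus_one :: "'k qcomplex \<Rightarrow> (rat, rat set) module" where
  "reduced_homology_minus_one C = quotient_space (*) UNIV (augmentation ` chains C 0)"

definition reduced_homology_zero :: "'k qcomplex \<Rightarrow> bool" where
  "reduced_homology_zero C \<longleftrightarrow>
     carrier (reduced_homology_minus_one C) = {\<zero>\<^bsub>reduced_homology_minus_one C\<^esub>} \<and>
     (\<forall>q. carrier (reduced_homology C q) = {\<zero>\<^bsub>reduced_homology C q\<^esub>})"


section \<open>Singular chains with rational coefficients\<close>

type_synonym 'a singular = "(nat \<Rightarrow> real) \<Rightarrow> 'a"

definition singular_bdry :: "nat \<Rightarrow> 'a singular qchain \<Rightarrow> 'a singular qchain" where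
  "singular_bdry p c =
     (if p = 0 then 0
      else \<Sum>f\<in>Poly_Mapping.keys c. \<Sum>k\<le>p.
             Poly_Mapping.single (singular_face p k f) ((-1) ^ k * Poly_Mapping.lookup c f))"

definition singular_complex :: "'a topology \<Rightarrow> 'a singular qcomplex" where
  "singular_complex X =
     \<lparr>chains = (\<lambda>p. {c. Poly_Mapping.keys c \<subseteq> singular_simplex_set p X}), bdry = singular_bdry\<rparr>"

definition small_singular_complex :: "'a topology \<Rightarrow> 'a set set \<Rightarrow> 'a singular qcomplex" where
  "small_singular_complex X \<V> =
     \<lparr>chains = (\<lambda>p. {c. Poly_Mapping.keys c \<subseteq>
                 {f. singular_simplex p X f \<and> (\<exists>V\<in>\<V>. f ` standard_simplex p \<subseteq> V)}}),
      bdry = singular_bdry\<rparr>"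

definition chain_support :: "nat \<Rightarrow> 'a singular qchain \<Rightarrow> 'a set" where
  "chain_support p c = (\<Union>f\<in>Poly_Mapping.keys c. f ` standard_simplex p)"

definition open_cover :: "'a topology \<Rightarrow> 'a set set \<Rightarrow> bool" where
  "open_cover X \<U> \<longleftrightarrow> (\<forall>U\<in>\<U>. openin X U) \<and> \<Union>\<U> = topspace X"

definition finer :: "'a set set \<Rightarrow> 'a set set \<Rightarrow> bool" where
  "finer \<V> \<U> \<longleftrightarrow> (\<forall>V\<in>\<V>. \<exists>U\<in>\<U>. V \<subseteq> U)"

text \<open>For an open cover \<open>\<V>\<close> the inclusion of the complex of \<open>\<V>\<close>-small chains induces an
  isomorphism on homology; it is inverted here to make a morphism defined on small chains act
  on the homology of \<open>X\<close>.\<close>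

definition induced_endo ::
  "'a topology \<Rightarrow> 'a set set \<Rightarrow> (nat \<Rightarrow> 'a singular qchain \<Rightarrow> 'a singular qchain) \<Rightarrow> nat \<Rightarrow>
     'a singular qchain set \<Rightarrow> 'a singular qchain set" where
  "induced_endo X \<V> \<phi> q =
     homology_map (small_singular_complex X \<V>) (singular_complex X) \<phi> q \<circ>
     inv_into (carrier (homology (small_singular_complex X \<V>) q))
       (homology_map (small_singular_complex X \<V>) (singular_complex X) (\<lambda>_ c. c) q)"


section \<open>Traces and the Lefschetz number of a chain morphism\<close>

definition trace_fin_dim :: "(rat, 'v) module \<Rightarrow> ('v \<Rightarrow> 'v) \<Rightarrow> rat" where
  "trace_fin_dim V T =
     (THE t. \<exists>B m. finite B \<and> vectorspace.basis class_ring V B \<and>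
        (\<forall>b\<in>B. T b = (\<Oplus>\<^bsub>V\<^esub>b'\<in>B. m b' b \<odot>\<^bsub>V\<^esub> b')) \<and> t = (\<Sum>b\<in>B. m b b))"

definition trace_fin_rank :: "(rat, 'v) module \<Rightarrow> ('v \<Rightarrow> 'v) \<Rightarrow> rat" where
  "trace_fin_rank V T = trace_fin_dim (V\<lparr>carrier := T ` carrier V\<rparr>) T"

text \<open>When the induced endomorphism of the graded homology has finite-dimensional image, only
  finitely many degrees have nonzero trace.\<close>

definition Lefschetz ::
  "'a topology \<Rightarrow> 'a set set \<Rightarrow> (nat \<Rightarrow> 'a singular qchain \<Rightarrow> 'a singular qchain) \<Rightarrow> rat" where
  "Lefschetz X \<V> \<phi> =
     (let tr = (\<lambda>q. trace_fin_rank (homology (singular_complex X) q) (induced_endo X \<V> \<phi> q))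
      in \<Sum>q\<in>{q. tr q \<noteq> 0}. (-1) ^ q * tr q)"


section \<open>Oriented simplicial chains\<close>

definition simplicial_complex :: "'v set set \<Rightarrow> bool" where
  "simplicial_complex K \<longleftrightarrow>
     (\<forall>\<sigma>\<in>K. finite \<sigma> \<and> \<sigma> \<noteq> {}) \<and> (\<forall>\<sigma>\<in>K. \<forall>\<tau>. \<tau> \<subseteq> \<sigma> \<and> \<tau> \<noteq> {} \<longrightarrow> \<tau> \<in> K)"

text \<open>An oriented \<open>p\<close>-chain is a finitely supported function on the orderings of the
  \<open>p\<close>-simplices of \<open>K\<close> that changes sign under odd permutations. The oriented simplex
  \<open>[v\<^sub>0, \<dots>, v\<^sub>p]\<close> is the function taking the value \<open>sign \<pi>\<close> on the rearrangement
  of \<open>v\<^sub>0, \<dots>, v\<^sub>p\<close> by \<open>\<pi>\<close> and \<open>0\<close> elsewhere; it is one of the two generators belonging to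
  the simplex \<open>{v\<^sub>0, \<dots>, v\<^sub>p}\<close>.\<close>

definition oriented_gen :: "'v list \<Rightarrow> 'v list qchain" where
  "oriented_gen vs =
     (\<Sum>\<pi> | \<pi> permutes {..<length vs}.
        Poly_Mapping.single (permute_list \<pi> vs) (of_int (sign \<pi>)))"

definition oriented_chains :: "'v set set \<Rightarrow> nat \<Rightarrow> 'v list qchain set" where
  "oriented_chains K p =
     {c. Poly_Mapping.keys c \<subseteq> {vs. length vs = Suc p \<and> distinct vs \<and> set vs \<in> K} \<and>
         (\<forall>\<pi> vs. \<pi> permutes {..<Suc p} \<and> length vs = Suc p \<longrightarrow>
            Poly_Mapping.lookup c (permute_list \<pi> vs) =
              of_int (sign \<pi>) * Poly_Mapping.lookup c vs)}"

text \<open>On alternating functions the usual boundary is summation over the first vertex,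
  \<open>(\<partial>c) ws = (\<Sum>v. c (v # ws))\<close>: moving \<open>v\<^sub>i\<close> to the front of \<open>v\<^sub>0, \<dots>, v\<^sub>p\<close> is a
  permutation of sign \<open>(-1)^i\<close>, so \<open>[v\<^sub>0, \<dots>, v\<^sub>p]\<close> is mapped to the alternating sum of the
  oriented faces omitting \<open>v\<^sub>i\<close>.\<close>

definition oriented_bdry :: "nat \<Rightarrow> 'v list qchain \<Rightarrow> 'v list qchain" where
  "oriented_bdry p c =
     (if p = 0 then 0
      else \<Sum>vs\<in>Poly_Mapping.keys c. Poly_Mapping.single (tl vs) (Poly_Mapping.lookup c vs))"

definition oriented_complex :: "'v set set \<Rightarrow> 'v list qcomplex" where
  "oriented_complex K = \<lparr>chains = oriented_chains K, bdry = oriented_bdry\<rparr>"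


section \<open>Algebraic absolute neighborhood retracts\<close>

text \<open>The support of \<open>\<mu> \<tau>\<close> does not depend on the ordering \<open>vs\<close> of \<open>\<tau>\<close>, since the two
  generators of \<open>\<tau>\<close> differ by a sign.\<close>

definition partial_realization ::
  "'a topology \<Rightarrow> 'a set set \<Rightarrow> 'v set set \<Rightarrow> 'v set set \<Rightarrow>
     (nat \<Rightarrow> 'v list qchain \<Rightarrow> 'a singular qchain) \<Rightarrow> bool" where
  "partial_realization X \<U> K L \<mu> \<longleftrightarrow>
     simplicial_complex L \<and> L \<subseteq> K \<and> (\<forall>v. {v} \<in> K \<longrightarrow> {v} \<in> L) \<and>
     chain_morphism (oriented_complex L) (singular_complex X) \<mu> \<and>
     (\<forall>\<sigma>\<in>K. \<exists>U\<in>\<U>. \<forall>\<tau>\<in>L. \<tau> \<subseteq> \<sigma> \<longrightarrow>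
        (\<forall>vs. distinct vs \<and> set vs = \<tau> \<longrightarrow>
           chain_support (length vs - 1) (\<mu> (length vs - 1) (oriented_gen vs)) \<subseteq> U))"

definition complete_realization ::
  "'a topology \<Rightarrow> 'a set set \<Rightarrow> 'v set set \<Rightarrow>
     (nat \<Rightarrow> 'v list qchain \<Rightarrow> 'a singular qchain) \<Rightarrow> bool" where
  "complete_realization X \<U> K \<mu> \<longleftrightarrow> partial_realization X \<U> K K \<mu>"

text \<open>A definition cannot quantify over all types, so the type \<open>'v\<close> from which the vertices of
  the simplicial complexes are drawn is a parameter.\<close>

definition algebraic_ANR :: "'v itself \<Rightarrow> 'a topology \<Rightarrow> bool" where
  "algebraic_ANR (_ :: 'v itself) X \<longleftrightarrow>
     metrizable_space X \<and>
     (\<forall>\<U>. open_cover X \<U> \<longrightarrow>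
        (\<exists>\<V>. open_cover X \<V> \<and> finer \<V> \<U> \<and>
           (\<forall>K :: 'v set set. simplicial_complex K \<longrightarrow>
              (\<forall>L \<mu>. partial_realization X \<V> K L \<mu> \<longrightarrow>
                 (\<exists>\<mu>'. complete_realization X \<U> K \<mu>' \<and>
                    (\<forall>p. \<forall>c\<in>chains (oriented_complex L) p. \<mu>' p c = \<mu> p c))))))"

text \<open>A vertex type that is infinite and large compared with \<open>X\<close>: it has room for the points
  and the subsets of \<open>X\<close>, for the singular simplices of \<open>X\<close> in all degrees and for sets of
  these, and for copies of all of them indexed by natural numbers. Since complexes over a
  smaller vertex type embed in complexes over a larger one, the property for this type follows
  from the property for all simplicial complexes.\<close>

type_synonym 'a vertex = "(nat \<times> 'a singular) set"


section \<open>Multivalued maps and their approximations\<close>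

definition multivalued_map :: "'a topology \<Rightarrow> 'b topology \<Rightarrow> ('a \<Rightarrow> 'b set) \<Rightarrow> bool" where
  "multivalued_map X Y F \<longleftrightarrow> (\<forall>x\<in>topspace X. F x \<noteq> {} \<and> closedin Y (F x))"

definition upper_semicontinuous :: "'a topology \<Rightarrow> 'b topology \<Rightarrow> ('a \<Rightarrow> 'b set) \<Rightarrow> bool" where
  "upper_semicontinuous X Y F \<longleftrightarrow>
     (\<forall>U. openin Y U \<longrightarrow> openin X {x \<in> topspace X. F x \<subseteq> U})"

definition compact_multivalued :: "'a topology \<Rightarrow> 'b topology \<Rightarrow> ('a \<Rightarrow> 'b set) \<Rightarrow> bool" where
  "compact_multivalued X Y F \<longleftrightarrow> (\<exists>C. compactin Y C \<and> (\<Union>x\<in>topspace X. F x) \<subseteq> C)"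

definition compact_chain_morphism ::
  "'a topology \<Rightarrow> 'a set set \<Rightarrow> 'b topology \<Rightarrow>
     (nat \<Rightarrow> 'a singular qchain \<Rightarrow> 'b singular qchain) \<Rightarrow> bool" where
  "compact_chain_morphism X \<V> Y \<phi> \<longleftrightarrow>
     chain_morphism (small_singular_complex X \<V>) (singular_complex Y) \<phi> \<and>
     (\<exists>C. compactin Y C \<and>
        (\<forall>p. \<phi> p ` chains (small_singular_complex X \<V>) p
               \<subseteq> chains (singular_complex (subtopology Y C)) p))"

definition nbhd :: "'b topology \<Rightarrow> ('b \<Rightarrow> 'b \<Rightarrow> real) \<Rightarrow> 'b set \<Rightarrow> real \<Rightarrow> 'b set" where
  "nbhd Y d A \<epsilon> = {y \<in> topspace Y. \<exists>a\<in>A. d y a < \<epsilon>}"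

definition compatible_metric :: "'b topology \<Rightarrow> ('b \<Rightarrow> 'b \<Rightarrow> real) \<Rightarrow> bool" where
  "compatible_metric Y d \<longleftrightarrow>
     Metric_space (topspace Y) d \<and> Metric_space.mtopology (topspace Y) d = Y"

definition approximation ::
  "'a topology \<Rightarrow> 'b topology \<Rightarrow> ('b \<Rightarrow> 'b \<Rightarrow> real) \<Rightarrow> ('a \<Rightarrow> 'b set) \<Rightarrow>
     'a set set \<Rightarrow> real \<Rightarrow> 'a set set \<Rightarrow>
     (nat \<Rightarrow> 'a singular qchain \<Rightarrow> 'b singular qchain) \<Rightarrow> bool" where
  "approximation X Y d F \<U> \<epsilon> \<V> \<phi> \<longleftrightarrow>
     open_cover X \<V> \<and> compact_chain_morphism X \<V> Y \<phi> \<and>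
     (\<forall>V\<in>\<V>. \<exists>U\<in>\<U>. V \<subseteq> U \<and>
        (\<forall>p. \<phi> p ` chains (singular_complex (subtopology X V)) p
               \<subseteq> chains (singular_complex (subtopology Y (nbhd Y d (\<Union>x\<in>U. F x) \<epsilon>))) p))"

definition approximable ::
  "'a topology \<Rightarrow> 'b topology \<Rightarrow> ('b \<Rightarrow> 'b \<Rightarrow> real) \<Rightarrow> ('a \<Rightarrow> 'b set) \<Rightarrow> bool" where
  "approximable X Y d F \<longleftrightarrow>
     (\<forall>\<U> \<epsilon>. open_cover X \<U> \<and> \<epsilon> > 0 \<longrightarrow> (\<exists>\<V> \<phi>. approximation X Y d F \<U> \<epsilon> \<V> \<phi>))"

definition Lefschetz_constant ::
  "'a topology \<Rightarrow> ('a \<Rightarrow> 'a \<Rightarrow> real) \<Rightarrow> ('a \<Rightarrow> 'a set) \<Rightarrow> rat \<Rightarrow> bool" where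
  "Lefschetz_constant X d F q\<^sub>0 \<longleftrightarrow>
     (\<exists>\<U>\<^sub>0 \<epsilon>\<^sub>0. open_cover X \<U>\<^sub>0 \<and> \<epsilon>\<^sub>0 > 0 \<and>
        (\<forall>\<U> \<epsilon> \<V> \<phi>. open_cover X \<U> \<and> finer \<U> \<U>\<^sub>0 \<and> 0 < \<epsilon> \<and> \<epsilon> < \<epsilon>\<^sub>0 \<and>
           approximation X X d F \<U> \<epsilon> \<V> \<phi> \<longrightarrow> Lefschetz X \<V> \<phi> = q\<^sub>0))"

definition Lefschetz_all ::
  "'a topology \<Rightarrow> ('a \<Rightarrow> 'a \<Rightarrow> real) \<Rightarrow> ('a \<Rightarrow> 'a set) \<Rightarrow> bool" where
  "Lefschetz_all X d F \<longleftrightarrow>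
     (\<forall>\<U> \<epsilon> q. open_cover X \<U> \<and> \<epsilon> > 0 \<longrightarrow>
        (\<exists>\<V> \<phi>. approximation X X d F \<U> \<epsilon> \<V> \<phi> \<and> Lefschetz X \<V> \<phi> = q))"

text \<open>\<open>has_Lefschetz_number X d F \<Lambda>\<close> says that \<open>\<Lambda>\<close> is the Lefschetz number of \<open>F\<close>, a value
  \<open>q\<^sub>0\<close> being represented by the singleton \<open>{q\<^sub>0}\<close> and the exceptional value by the set of all
  rationals. Thus the Lefschetz number is nonzero if it is not \<open>{0}\<close>.\<close>

definition has_Lefschetz_number ::
  "'a topology \<Rightarrow> ('a \<Rightarrow> 'a \<Rightarrow> real) \<Rightarrow> ('a \<Rightarrow> 'a set) \<Rightarrow> rat set \<Rightarrow> bool" where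
  "has_Lefschetz_number X d F \<Lambda> \<longleftrightarrow>
     (\<exists>q\<^sub>0. Lefschetz_constant X d F q\<^sub>0 \<and> \<Lambda> = {q\<^sub>0}) \<or> (Lefschetz_all X d F \<and> \<Lambda> = UNIV)"

end

theory Submission imports Defs "HOL-Library.Sublist" begin

text \<open>Without fixed points, \<open>x\<close> and \<open>F x\<close> are at a uniform distance \<open>\<rho> > 0\<close>, and it suffices that
  every sufficiently fine approximation \<open>\<phi>\<close> has Lefschetz number \<open>0\<close>; on a space with vanishing
  reduced homology every approximation has Lefschetz number \<open>1\<close>. Let \<open>C\<close> be a compact set
  containing the supports of the values of \<open>\<phi>\<close>. The complex \<open>K\<close> whose vertices are the singular
  simplices of \<open>X\<close> has a partial realization on the subcomplex of flags of faces: a flag goes to the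
  affine simplex on the barycentres. It contains the second barycentric subdivision of every small
  singular simplex, so the extension \<open>\<mu>\<close> to all of \<open>K\<close>, given by the retract property, turns
  small cycles of \<open>X\<close> into homologous ones. Replacing all vertices of a cycle of \<open>C\<close> by nearest
  points of a finite net in \<open>C\<close>, regarded as \<open>0\<close>-simplices, gives a homologous cycle of a finite
  subcomplex \<open>K0\<close> of \<open>K\<close>. Hence \<open>\<phi>\<close> factors on homology through \<open>K0\<close>, where its Lefschetz number
  is that of the chain map \<open>net \<circ> \<phi> \<circ> \<mu>\<close>. As \<open>\<phi>\<close> moves points by at least about \<open>\<rho>\<close>, no simplex of
  \<open>K0\<close> occurs in its image under this map, and the Hopf trace formula gives \<open>0\<close>.\<close>

text \<open>The retract property only prolongs what is prescribed, and a realization prescribed on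
  points alone would leave its effect on homology unknown. With singular simplices as vertices and
  flags as the prescribed part, the realization is known on the subdivision of every small simplex
  and can be compared with the identity. Two subdivisions enter because the labels inside a vertex
  must survive the passage to a face: numbers of corners are shifted by face maps, dimensions of
  barycentres are not. The first subdivision supplies such labels, the second makes the simplices of
  the first into vertices. The homology of \<open>X\<close> may have infinite dimension; the
  identity tr(PR) = tr(RP) moves the trace to the finite complex. There it can be read off chains
  only if the map on homology comes from a chain map, hence the fixed numbers of subdivisions in
  \<open>net_map\<close>. The constant \<open>\<rho> / 8\<close> comes from a path of four steps, of
  lengths below \<open>\<rho> / 4\<close>, \<open>\<rho> / 4\<close>, \<open>\<rho> / 8\<close> and
  \<open>\<rho> / 8\<close>, that would join a point to one of its values.\<close>

lemma lookup_qscale [simp]: "Poly_Mapping.lookup (qscale r c) x = r * Poly_Mapping.lookup c x"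
  unfolding qscale_def by (transfer) (simp add: when_def)

interpretation qvs: vector_space "qscale :: rat \<Rightarrow> 'k qchain \<Rightarrow> 'k qchain"
  by unfold_locales (auto intro!: poly_mapping_eqI simp: lookup_add algebra_simps)

section \<open>Formal rational combinations, linear extension and augmentation\<close>

definition gen :: "'k \<Rightarrow> 'k qchain" where
  "gen x = Poly_Mapping.single x 1"

lemma lookup_gen: "Poly_Mapping.lookup (gen x) y = (if x = y then 1 else 0)"
  by (simp add: gen_def lookup_single when_def)

lemma keys_gen [simp]: "Poly_Mapping.keys (gen x) = {x}"
  by (simp add: gen_def)

lemma single_eq_qscale_gen: "Poly_Mapping.single x r = qscale r (gen x)"
  by (intro poly_mapping_eqI) (simp add: lookup_gen lookup_single when_def)

lemma keys_qscale: "Poly_Mapping.keys (qscale r c) \<subseteq> Poly_Mapping.keys c"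
  by (auto simp: in_keys_iff)

lemma keys_sub_diff: "Poly_Mapping.keys a \<subseteq> S \<Longrightarrow> Poly_Mapping.keys b \<subseteq> S \<Longrightarrow>
    Poly_Mapping.keys (a - b :: 'k qchain) \<subseteq> S"
  using keys_diff[of a b] by blast

lemma keys_sub_scale: "Poly_Mapping.keys a \<subseteq> S \<Longrightarrow> Poly_Mapping.keys (qscale r a) \<subseteq> S"
  using keys_qscale[of r a] by blast

lemma keys_sub_sum:
  "(\<And>i. i \<in> I \<Longrightarrow> Poly_Mapping.keys (f i) \<subseteq> S) \<Longrightarrow>
    Poly_Mapping.keys (sum f I :: 'k qchain) \<subseteq> S"
  using keys_sum[of f I] by blast

lemma qchain_expand: "c = (\<Sum>x\<in>Poly_Mapping.keys c. qscale (Poly_Mapping.lookup c x) (gen x))"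
proof (rule poly_mapping_eqI)
  fix y
  have "(\<Sum>x\<in>Poly_Mapping.keys c. Poly_Mapping.lookup c x * Poly_Mapping.lookup (gen x) y)
      = (\<Sum>x\<in>Poly_Mapping.keys c. if x = y then Poly_Mapping.lookup c x else 0)"
    by (intro sum.cong) (auto simp: lookup_gen)
  also have "\<dots> = Poly_Mapping.lookup c y"
    by (simp add: in_keys_iff)
  finally show "Poly_Mapping.lookup c y =
      Poly_Mapping.lookup (\<Sum>x\<in>Poly_Mapping.keys c. qscale (Poly_Mapping.lookup c x) (gen x)) y"
    by (simp add: lookup_sum)
qed

text \<open>Identities between linear operations on chains are reduced to generators with this rule.
  The support condition is carried through the cases, so that facts valid only for chains of a given
  space remain available.\<close>

lemma qchain_induct [consumes 1, case_names zero gen add scale]: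
  assumes "Poly_Mapping.keys c \<subseteq> S"
    and "P 0"
    and g: "\<And>x. x \<in> S \<Longrightarrow> P (gen x)"
    and a: "\<And>a b. P a \<Longrightarrow> P b \<Longrightarrow> Poly_Mapping.keys a \<subseteq> S \<Longrightarrow> Poly_Mapping.keys b \<subseteq> S
        \<Longrightarrow> P (a + b)"
    and s: "\<And>r a. P a \<Longrightarrow> Poly_Mapping.keys a \<subseteq> S \<Longrightarrow> P (qscale r a)"
  shows "P c"
proof -
  have "P (\<Sum>x\<in>A. qscale (Poly_Mapping.lookup c x) (gen x)) \<and>
      Poly_Mapping.keys (\<Sum>x\<in>A. qscale (Poly_Mapping.lookup c x) (gen x)) \<subseteq> S"
    if "finite A" "A \<subseteq> S" for A
    using that
  proof (induction A)
    case empty then show ?case by (simp add: assms)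
  next
    case (insert x A)
    have *: "P (qscale (Poly_Mapping.lookup c x) (gen x))"
        "Poly_Mapping.keys (qscale (Poly_Mapping.lookup c x) (gen x)) \<subseteq> S"
      using insert by (auto intro!: s g keys_sub_scale)
    show ?case
      using insert * by (auto intro!: a dest: subsetD[OF keys_add] simp: subset_iff) 
  qed
  then show ?thesis
    using qchain_expand[of c] assms(1) finite_keys by metis
qed


text \<open>Linearity is relative to a set of chains because a \<open>chain_morphism\<close> is
  constrained only on the chains of its source; its values elsewhere are arbitrary.\<close>

definition qlinear_on :: "'k qchain set \<Rightarrow> ('k qchain \<Rightarrow> 'l qchain) \<Rightarrow> bool" where
  "qlinear_on S f \<longleftrightarrow> (\<forall>a\<in>S. \<forall>b\<in>S. f (a + b) = f a + f b) \<and> (\<forall>r. \<forall>a\<in>S. f (qscale r a) = qscale r (f a))"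

lemma qlinear_onD:
  assumes "qlinear_on S f"
  shows "a \<in> S \<Longrightarrow> b \<in> S \<Longrightarrow> f (a + b) = f a + f b"
    and "a \<in> S \<Longrightarrow> f (qscale r a) = qscale r (f a)"
  using assms by (auto simp: qlinear_on_def)

lemma qlinear_on_0: "qlinear_on S f \<Longrightarrow> a \<in> S \<Longrightarrow> f 0 = 0"
  using qlinear_onD(2)[of S f a 0] by simp

lemma qlinear_on_sub: "qlinear_on S f \<Longrightarrow> T \<subseteq> S \<Longrightarrow> qlinear_on T f"
  unfolding qlinear_on_def by blast

lemma qlinear_on_diff:
  assumes "qlinear_on S f" "a \<in> S" "b \<in> S" "qvs.subspace S"
  shows "f (a - b) = f a - f b"
proof -
  have "f (a + qscale (-1) b) = f a + qscale (-1) (f b)"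
    using assms by (metis qlinear_onD qvs.subspace_scale)
  then show ?thesis by simp
qed

lemma qlinear_on_sum:
  assumes "qlinear_on S f" "\<And>i. i \<in> I \<Longrightarrow> g i \<in> S" "qvs.subspace S"
  shows "f (\<Sum>i\<in>I. qscale (r i) (g i)) = (\<Sum>i\<in>I. qscale (r i) (f (g i)))"
  using assms(2)
proof (induction I rule: infinite_finite_induct)
  case (insert x F)
  then have "(\<Sum>i\<in>F. qscale (r i) (g i)) \<in> S"
    by (auto intro!: qvs.subspace_sum assms(3) qvs.subspace_scale)
  with insert show ?case
    using assms by (simp add: qlinear_onD qvs.subspace_scale)
qed (use qlinear_on_0[OF assms(1) qvs.subspace_0[OF assms(3)]] in auto)

definition qlift :: "('k \<Rightarrow> 'l qchain) \<Rightarrow> 'k qchain \<Rightarrow> 'l qchain" where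
  "qlift h c = (\<Sum>x\<in>Poly_Mapping.keys c. qscale (Poly_Mapping.lookup c x) (h x))"

lemma qlift_superset:
  assumes "finite A" "Poly_Mapping.keys c \<subseteq> A"
  shows "qlift h c = (\<Sum>x\<in>A. qscale (Poly_Mapping.lookup c x) (h x))"
  unfolding qlift_def using assms
  by (intro sum.mono_neutral_left) (auto simp: in_keys_iff)

lemma qlift_0 [simp]: "qlift h 0 = 0"
  by (simp add: qlift_def)

lemma qlift_gen [simp]: "qlift h (gen x) = h x"
  by (simp add: qlift_def lookup_gen)

lemma qlift_add: "qlift h (a + b) = qlift h a + qlift h b"
proof -
  let ?A = "Poly_Mapping.keys a \<union> Poly_Mapping.keys b"
  have "qlift h (a + b) = (\<Sum>x\<in>?A. qscale (Poly_Mapping.lookup (a + b) x) (h x))"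
    using keys_add[of a b] by (intro qlift_superset) auto
  also have "\<dots> = (\<Sum>x\<in>?A. qscale (Poly_Mapping.lookup a x) (h x))
      + (\<Sum>x\<in>?A. qscale (Poly_Mapping.lookup b x) (h x))"
    by (simp add: lookup_add qvs.scale_left_distrib sum.distrib)
  also have "\<dots> = qlift h a + qlift h b"
    by (simp add: qlift_superset[of ?A])
  finally show ?thesis .
qed

lemma qlift_scale: "qlift h (qscale r a) = qscale r (qlift h a)"
  by (subst qlift_superset[of "Poly_Mapping.keys a"])
    (auto simp: keys_qscale qvs.scale_sum_right qlift_def)

lemma qlift_uminus: "qlift h (- a) = - qlift h a"
  using qlift_scale[of h "-1" a] by simp

lemma qlift_diff: "qlift h (a - b) = qlift h a - qlift h b"
  using qlift_add[of h a "-b"] by (simp add: qlift_uminus)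

lemma qlift_sum: "qlift h (\<Sum>i\<in>I. f i) = (\<Sum>i\<in>I. qlift h (f i))"
  by (induction I rule: infinite_finite_induct) (auto simp: qlift_add)

lemmas qlift_simps = qlift_add qlift_scale qlift_uminus qlift_diff qlift_sum

lemma qlift_linear: "qlinear_on S (qlift h)"
  by (simp add: qlinear_on_def qlift_simps)

lemma qlift_cong:
  "(\<And>x. x \<in> Poly_Mapping.keys c \<Longrightarrow> h x = h' x) \<Longrightarrow> qlift h c = qlift h' c"
  by (simp add: qlift_def)

lemma qlift_qlift: "qlift h (qlift k c) = qlift (\<lambda>x. qlift h (k x)) c"
proof (induction c rule: qchain_induct[OF subset_UNIV])
qed (auto simp: qlift_simps)

lemma qlift_of_gen: "qlift gen c = c"
  using qchain_expand[of c] by (simp add: qlift_def)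

lemma qlift_fun_diff: "qlift (\<lambda>x. h x - k x) c = qlift h c - qlift k c"
  by (simp add: qlift_def qvs.scale_right_diff_distrib sum_subtractf)

lemma keys_qlift: "Poly_Mapping.keys (qlift h c) \<subseteq> (\<Union>x\<in>Poly_Mapping.keys c. Poly_Mapping.keys (h x))"
  unfolding qlift_def by (rule keys_sub_sum, rule order_trans[OF keys_qscale]) auto

lemma keys_sub_qlift:
  "(\<And>x. x \<in> Poly_Mapping.keys c \<Longrightarrow> Poly_Mapping.keys (h x) \<subseteq> S) \<Longrightarrow>
    Poly_Mapping.keys (qlift h c) \<subseteq> S"
  using keys_qlift[of h c] by blast

lemma qlift_in_subspace:
  assumes "qvs.subspace V" "\<And>x. x \<in> Poly_Mapping.keys c \<Longrightarrow> h x \<in> V"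
  shows "qlift h c \<in> V"
  unfolding qlift_def using assms by (intro qvs.subspace_sum qvs.subspace_scale)

lemma subspace_keys: "qvs.subspace {c. Poly_Mapping.keys c \<subseteq> S}"
  by (auto simp: qvs.subspace_def dest: subsetD[OF keys_add] subsetD[OF keys_qscale])

text \<open>A map that is linear only on the chains supported in \<open>S\<close> becomes a
  \<open>qlift\<close> there. This is how a morphism such as \<open>\<phi>\<close> is traced back to
  single simplices.\<close>

lemma qlinear_on_eq_qlift:
  assumes "qlinear_on {c. Poly_Mapping.keys c \<subseteq> S} f" "Poly_Mapping.keys c \<subseteq> S"
  shows "f c = qlift (\<lambda>x. f (gen x)) c"
proof -
  have "f (\<Sum>x\<in>Poly_Mapping.keys c. qscale (Poly_Mapping.lookup c x) (gen x)) =
    (\<Sum>x\<in>Poly_Mapping.keys c. qscale (Poly_Mapping.lookup c x) (f (gen x)))"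
    using assms by (intro qlinear_on_sum[OF assms(1) _ subspace_keys]) auto
  then show ?thesis
    by (simp flip: qchain_expand add: qlift_def)
qed

lemma augmentation_superset:
  assumes "finite A" "Poly_Mapping.keys c \<subseteq> A"
  shows "augmentation c = (\<Sum>x\<in>A. Poly_Mapping.lookup c x)"
  unfolding augmentation_def using assms
  by (intro sum.mono_neutral_left) (auto simp: in_keys_iff)

lemma augmentation_gen [simp]: "augmentation (gen x) = 1"
  by (simp add: augmentation_def lookup_gen)

lemma augmentation_0 [simp]: "augmentation 0 = 0"
  by (simp add: augmentation_def)

lemma augmentation_add: "augmentation (a + b) = augmentation a + augmentation b"
  using augmentation_superset[of "Poly_Mapping.keys a \<union> Poly_Mapping.keys b"] keys_add[of a b]
  by (simp add: lookup_add sum.distrib)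

lemma augmentation_scale: "augmentation (qscale r a) = r * augmentation a"
  by (subst augmentation_superset[of "Poly_Mapping.keys a"])
    (auto simp: keys_qscale augmentation_def sum_distrib_left)

lemma augmentation_uminus: "augmentation (- a) = - augmentation a"
  using augmentation_scale[of "-1" a] by simp

lemma augmentation_diff: "augmentation (a - b) = augmentation a - augmentation b"
  using augmentation_add[of a "-b"] by (simp add: augmentation_uminus)

lemma augmentation_sum: "augmentation (\<Sum>i\<in>I. f i) = (\<Sum>i\<in>I. augmentation (f i))"
  by (induction I rule: infinite_finite_induct) (auto simp: augmentation_add)

lemmas augmentation_simps = augmentation_add augmentation_scale augmentation_uminus
  augmentation_diff augmentation_sum

lemma augmentation_qlift:
  "augmentation (qlift h c) = (\<Sum>x\<in>Poly_Mapping.keys c. Poly_Mapping.lookup c x * augmentation (h x))"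
  by (simp add: qlift_def augmentation_simps)

lemma augmentation_qlift_1:
  "(\<And>x. x \<in> Poly_Mapping.keys c \<Longrightarrow> augmentation (h x) = 1) \<Longrightarrow>
    augmentation (qlift h c) = augmentation c"
  by (simp add: augmentation_qlift) (simp add: augmentation_def)

section \<open>Ordered chains\<close>

definition ocone :: "'v \<Rightarrow> 'v list qchain \<Rightarrow> 'v list qchain" where
  "ocone v = qlift (\<lambda>xs. gen (v # xs))"

lemma ocone_gen [simp]: "ocone v (gen xs) = gen (v # xs)"
  by (simp add: ocone_def)

lemma ocone_0 [simp]: "ocone v 0 = 0"
  by (simp add: ocone_def)

lemmas ocone_simps = qlift_simps[where h = "\<lambda>xs. gen (v # xs)" for v, folded ocone_def]

lemma keys_ocone: "Poly_Mapping.keys (ocone v c) \<subseteq> (#) v ` Poly_Mapping.keys c"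
  using keys_qlift[of "\<lambda>xs. gen (v # xs)" c] by (auto simp: ocone_def)

text \<open>The augmented ordered complex: degree is length, and the boundary of a vertex is the
  empty list.\<close>

fun obd_gen :: "'v list \<Rightarrow> 'v list qchain" where
  "obd_gen [] = 0"
| "obd_gen (v # xs) = gen xs - ocone v (obd_gen xs)"

definition obd :: "'v list qchain \<Rightarrow> 'v list qchain" where
  "obd = qlift obd_gen"

lemma obd_gen_eq [simp]: "obd (gen xs) = obd_gen xs"
  by (simp add: obd_def)

lemma obd_0 [simp]: "obd 0 = 0" by (simp add: obd_def)

lemmas obd_simps = qlift_simps[where h = "obd_gen", folded obd_def]

text \<open>Since the boundary of a vertex is the empty list, the cone formula has no exception in
  low degree. A chain with vanishing \<open>obd\<close> is therefore the boundary of any cone over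
  it, the fact behind the homotopies constructed below on ordered chains.\<close>

lemma obd_ocone: "obd (ocone v c) = c - ocone v (obd c)"
proof (induction c rule: qchain_induct[OF subset_UNIV])
qed (auto simp: ocone_simps obd_simps qvs.scale_right_diff_distrib)

lemma obd_obd_gen: "obd (obd_gen xs) = 0"
  by (induction xs) (auto simp: obd_simps obd_ocone)

lemma keys_obd_gen: "Poly_Mapping.keys (obd_gen xs) \<subseteq> {ys. Suc (length ys) = length xs \<and> set ys \<subseteq> set xs}"
proof (induction xs)
  case (Cons v xs)
  show ?case
  proof -
    have "Poly_Mapping.keys (ocone v (obd_gen xs)) \<subseteq>
        (#) v ` {ys. Suc (length ys) = length xs \<and> set ys \<subseteq> set xs}"
      using keys_ocone[of v "obd_gen xs"] Cons by blast
    then show ?thesis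
      unfolding obd_gen.simps by (intro keys_sub_diff) force+
  qed
qed auto

definition omit :: "nat \<Rightarrow> 'v list \<Rightarrow> 'v list" where
  "omit i xs = take i xs @ drop (Suc i) xs"

lemma obd_gen_expand: "obd_gen xs = (\<Sum>i<length xs. qscale ((-1) ^ i) (gen (omit i xs)))"
proof (induction xs)
  case (Cons v xs)
  show ?case
    unfolding obd_gen.simps length_Cons sum.lessThan_Suc_shift Cons
    by (simp add: ocone_simps omit_def sum_negf)
qed auto

definition omap :: "('v \<Rightarrow> 'w) \<Rightarrow> 'v list qchain \<Rightarrow> 'w list qchain" where
  "omap f = qlift (\<lambda>xs. gen (map f xs))"

lemma omap_gen [simp]: "omap f (gen xs) = gen (map f xs)"
  by (simp add: omap_def)

lemma omap_0 [simp]: "omap f 0 = 0" by (simp add: omap_def)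

lemmas omap_simps = qlift_simps[where h = "\<lambda>xs. gen (map f xs)" for f, folded omap_def]

lemma omap_ocone: "omap f (ocone v c) = ocone (f v) (omap f c)"
  by (simp add: omap_def ocone_def qlift_qlift)

lemma omap_omap: "omap f (omap g c) = omap (f \<circ> g) c"
  by (simp add: omap_def qlift_qlift)

lemma omap_cong: "(\<And>xs v. xs \<in> Poly_Mapping.keys c \<Longrightarrow> v \<in> set xs \<Longrightarrow> f v = g v) \<Longrightarrow> omap f c = omap g c"
  unfolding omap_def by (intro qlift_cong arg_cong[where f = gen]) auto

lemma obd_omap_gen: "obd_gen (map f xs) = omap f (obd_gen xs)"
  by (induction xs) (auto simp: omap_simps omap_ocone)

lemma obd_omap: "obd (omap f c) = omap f (obd c)"
  by (induction c rule: qchain_induct[OF subset_UNIV]) (auto simp: obd_simps omap_simps obd_omap_gen)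

lemma keys_omap: "Poly_Mapping.keys (omap f c) \<subseteq> map f ` Poly_Mapping.keys c"
  using keys_qlift[of "\<lambda>xs. gen (map f xs)" c] by (auto simp: omap_def)

section \<open>Oriented chains\<close>

text \<open>The cycle sending \<open>j\<close> to 0 and each \<open>i < j\<close> to
  \<open>i + 1\<close>. Since \<open>permute_list\<close> reads entry \<open>i\<close> from position
  \<open>\<pi> i\<close>, it moves the head of a list to position \<open>j\<close>; being a product
  of \<open>j\<close> adjacent transpositions, it has sign \<open>(-1)^j\<close>.\<close>

fun rotate_to :: "nat \<Rightarrow> nat \<Rightarrow> nat" where
  "rotate_to 0 = id"
| "rotate_to (Suc j) = rotate_to j \<circ> Transposition.transpose j (Suc j)"

lemma rotate_to_permutes: "j \<le> n \<Longrightarrow> rotate_to j permutes {..n}"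
proof (induction j)
  case (Suc j)
  have "Transposition.transpose j (Suc j) permutes {..n}"
    using Suc by (intro permutes_swap_id) auto
  then show ?case
    unfolding rotate_to.simps using Suc by (intro permutes_compose) auto
qed (simp add: permutes_id)

lemma permutation_rotate_to: "permutation (rotate_to j)"
  using rotate_to_permutes[of j j] permutation_permutes by blast

lemma sign_rotate_to: "sign (rotate_to j) = (-1) ^ j"
proof (induction j)
  case (Suc j)
  then show ?case
    unfolding rotate_to.simps sign_compose[OF permutation_rotate_to permutation_swap_id]
    by (simp add: sign_swap_id)
qed simp

lemma rotate_to_same: "rotate_to j j = 0"
  by (induction j) auto

lemma permute_list_transpose_Suc:
  assumes "j < length ws"
  shows "permute_list (Transposition.transpose j (Suc j)) (take j ws @ v # drop j ws)
    = take (Suc j) ws @ v # drop (Suc j) ws"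
proof (rule nth_equalityI)
  let ?l = "take j ws @ v # drop j ws"
  have len: "length ?l = Suc (length ws)" using assms by simp
  have p: "Transposition.transpose j (Suc j) permutes {..<length ?l}"
    unfolding len using assms by (intro permutes_swap_id) auto
  show "length (permute_list (Transposition.transpose j (Suc j)) ?l)
      = length (take (Suc j) ws @ v # drop (Suc j) ws)" using assms by simp
  fix i assume "i < length (permute_list (Transposition.transpose j (Suc j)) ?l)"
  then have i: "i < length ?l" by simp
  have "permute_list (Transposition.transpose j (Suc j)) ?l ! i = ?l ! Transposition.transpose j (Suc j) i"
    using permute_list_nth[OF p i] .
  also have "\<dots> = (take (Suc j) ws @ v # drop (Suc j) ws) ! i"
  proof -
    consider "i < j" | "i = j" | "i = Suc j" | "i > Suc j" by linarith
    then show ?thesis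
    proof cases
      case 1 then show ?thesis using assms i by (simp add: nth_append)
    next
      case 2 then show ?thesis using assms i by (simp add: nth_append)
    next
      case 3 then show ?thesis using assms i by (simp add: nth_append)
    next
      case 4
      then have "Transposition.transpose j (Suc j) i = i" by (simp add: Transposition.transpose_def)
      moreover obtain k where "i = Suc (Suc (j + k))" using 4 by (metis add_Suc less_natE)
      ultimately show ?thesis using assms i by (simp add: nth_append nth_Cons')
    qed
  qed
  finally show "permute_list (Transposition.transpose j (Suc j)) ?l ! i
      = (take (Suc j) ws @ v # drop (Suc j) ws) ! i" .
qed

lemma permute_list_rotate_to:
  "j \<le> length ws \<Longrightarrow> permute_list (rotate_to j) (v # ws) = take j ws @ v # drop j ws"
proof (induction j)
  case (Suc j)
  have "Transposition.transpose j (Suc j) permutes {..<length (v # ws)}"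
    using Suc.prems by (intro permutes_swap_id) auto
  then have "permute_list (rotate_to j \<circ> Transposition.transpose j (Suc j)) (v # ws)
      = permute_list (Transposition.transpose j (Suc j)) (permute_list (rotate_to j) (v # ws))"
    by (rule permute_list_compose)
  then show ?case
    unfolding rotate_to.simps using Suc by (simp only: permute_list_transpose_Suc)
qed simp

text \<open>A permutation of the \<open>n\<close> positions of a tail, transported to a list with
  one more entry so that the head stays in place.\<close>

definition shift_perm :: "nat \<Rightarrow> (nat \<Rightarrow> nat) \<Rightarrow> nat \<Rightarrow> nat" where
  "shift_perm n q = map_permutation {..<n} Suc q"

lemma shift_perm_permutes:
  assumes "q permutes {..<n}"
  shows "shift_perm n q permutes {..n}"
proof -
  have "shift_perm n q permutes (Suc ` {..<n})"
    unfolding shift_perm_def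
    by (rule map_permutation_permutes[OF _ assms]) (auto simp: bij_betw_def)
  then show ?thesis by (rule permutes_subset) auto
qed

lemma shift_perm_0: "shift_perm n q 0 = 0"
  by (auto simp: shift_perm_def map_permutation_def)

lemma shift_perm_Suc: "i < n \<Longrightarrow> shift_perm n q (Suc i) = Suc (q i)"
  by (auto simp: shift_perm_def map_permutation_def inv_into_f_f)

lemma sign_shift_perm: "q permutes {..<n} \<Longrightarrow> sign (shift_perm n q) = sign q"
  unfolding shift_perm_def by (intro sign_map_permutation) auto

lemma permute_list_shift_perm:
  assumes "q permutes {..<length ws}"
  shows "permute_list (shift_perm (length ws) q) (v # ws) = v # permute_list q ws"
proof (rule nth_equalityI)
  have p: "shift_perm (length ws) q permutes {..<length (v # ws)}"
    using shift_perm_permutes[OF assms] by (simp add: lessThan_Suc_atMost)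
  fix i assume "i < length (permute_list (shift_perm (length ws) q) (v # ws))"
  then have i: "i < length (v # ws)" by simp
  show "permute_list (shift_perm (length ws) q) (v # ws) ! i = (v # permute_list q ws) ! i"
    unfolding permute_list_nth[OF p i]
    using i assms by (cases i) (auto simp: shift_perm_0 shift_perm_Suc permute_list_nth)
qed simp

text \<open>The signed sum over all ways to insert \<open>v\<close> into a list: on antisymmetrized
  chains it acts as the cone with apex \<open>v\<close>.\<close>

definition insert_chain :: "'v \<Rightarrow> 'v list qchain \<Rightarrow> 'v list qchain" where
  "insert_chain v = qlift (\<lambda>ws. \<Sum>j\<le>length ws. qscale ((-1) ^ j) (gen (take j ws @ v # drop j ws)))"

lemma oriented_gen_gen:
  "oriented_gen vs = (\<Sum>\<pi> | \<pi> permutes {..<length vs}. qscale (of_int (sign \<pi>)) (gen (permute_list \<pi> vs)))"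
  unfolding oriented_gen_def single_eq_qscale_gen ..

lemma oriented_gen_Nil [simp]: "oriented_gen [] = gen []"
  by (simp add: oriented_gen_gen)

text \<open>Every permutation of \<open>n + 1\<close> positions arises exactly once by permuting the
  tail and then moving the head to a position \<open>j\<close>. The signed sum over permutations
  thus obeys a recursion along the list, on which inductive proofs about oriented generators can
  rest.\<close>

lemma oriented_gen_Cons: "oriented_gen (v # vs) = insert_chain v (oriented_gen vs)"
proof -
  define n where "n = length vs"
  define \<Phi> where "\<Phi> = (\<lambda>(j, q). shift_perm n q \<circ> rotate_to j)"
  let ?D = "{..n} \<times> {q. q permutes {..<n}}"
  have into: "\<Phi> ` ?D \<subseteq> {\<pi>. \<pi> permutes {..n}}"
    by (auto simp: \<Phi>_def intro!: permutes_compose shift_perm_permutes rotate_to_permutes)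
  have inj: "inj_on \<Phi> ?D"
  proof (rule inj_onI)
    fix x y assume x: "x \<in> ?D" and y: "y \<in> ?D" and eq: "\<Phi> x = \<Phi> y"
    obtain j q k r where xy: "x = (j, q)" "y = (k, r)" by (metis surj_pair)
    have q: "q permutes {..<n}" "r permutes {..<n}" "j \<le> n" "k \<le> n" using x y xy by auto
    \<comment> \<open>The position \<open>j\<close> can be read off the composite:
      \<open>rotate_to j\<close> sends \<open>j\<close> to 0, \<open>shift_perm\<close> fixes 0, and
      a permutation has only one position sent to 0.\<close>
    have *: "\<Phi> x j = 0" "\<Phi> y k = 0"
      by (auto simp: \<Phi>_def xy rotate_to_same shift_perm_0)
    have "\<Phi> y permutes {..n}" using subsetD[OF into imageI[OF y]] by (rule CollectD)
    then have inj: "inj (\<Phi> y)" by (rule permutes_inj)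
    have "\<Phi> y j = \<Phi> y k" using *(1) *(2) eq by simp
    then have jk: "j = k" by (rule injD[OF inj])
    have "shift_perm n q = shift_perm n r"
    proof -
      have eq': "shift_perm n q \<circ> rotate_to k = shift_perm n r \<circ> rotate_to k"
        using eq jk by (simp add: \<Phi>_def xy)
      show ?thesis
      proof
        fix x
        have "surj (rotate_to k)" using rotate_to_permutes[of k k] permutes_surj by auto
        then obtain y where "x = rotate_to k y" by (rule surjE)
        then show "shift_perm n q x = shift_perm n r x" using fun_cong[OF eq', of y] by simp
      qed
    qed
    then have "q i = r i" if "i < n" for i
      using that by (metis nat.inject shift_perm_Suc)
    moreover have "q i = r i" if "\<not> i < n" for i
      using that q by (simp add: permutes_def)
    ultimately have "q = r" by (intro ext) metis
    then show "x = y" using jk xy by simp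
  qed
  \<comment> \<open>Injectivity is enough, because both sides have \<open>(n + 1)!\<close>
    elements.\<close>
  have bij: "bij_betw \<Phi> ?D {\<pi>. \<pi> permutes {..n}}"
    unfolding bij_betw_def
  proof (intro conjI inj card_subset_eq into)
    show "finite {\<pi>. \<pi> permutes {..n}}" by (simp add: finite_permutations)
    show "card (\<Phi> ` ?D) = card {\<pi>. \<pi> permutes {..n}}"
      by (simp add: card_image[OF inj] card_permutations[of "{..n}" "Suc n"]
          card_permutations[of "{..<n}" n] card_cartesian_product)
  qed
  have "oriented_gen (v # vs)
      = (\<Sum>\<pi> | \<pi> permutes {..n}. qscale (of_int (sign \<pi>)) (gen (permute_list \<pi> (v # vs))))"
    by (simp add: oriented_gen_gen n_def lessThan_Suc_atMost)
  also have "\<dots> = (\<Sum>x\<in>?D. qscale (of_int (sign (\<Phi> x))) (gen (permute_list (\<Phi> x) (v # vs))))"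
    by (rule sum.reindex_bij_betw[OF bij, symmetric])
  also have "\<dots> = (\<Sum>(j, q)\<in>?D. qscale (of_int (sign q) * (-1) ^ j)
      (gen (take j (permute_list q vs) @ v # drop j (permute_list q vs))))"
  proof (rule sum.cong[OF refl], clarify)
    fix j q assume j: "j \<le> n" and q: "q permutes {..<n}"
    have r: "rotate_to j permutes {..<length (v # vs)}"
      using rotate_to_permutes[OF j] by (simp add: n_def lessThan_Suc_atMost)
    have "permutation (shift_perm n q)"
      using shift_perm_permutes[OF q] permutation_permutes by blast
    then have s: "sign (\<Phi> (j, q)) = sign q * (-1) ^ j"
      by (simp add: \<Phi>_def sign_compose permutation_rotate_to sign_shift_perm[OF q] sign_rotate_to)
    have "permute_list (\<Phi> (j, q)) (v # vs) = permute_list (rotate_to j) (v # permute_list q vs)"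
      using permute_list_compose[OF r, of "shift_perm n q"] permute_list_shift_perm[of q vs v] q
      by (simp add: \<Phi>_def n_def)
    also have "\<dots> = take j (permute_list q vs) @ v # drop j (permute_list q vs)"
      using j by (intro permute_list_rotate_to) (simp add: n_def)
    finally show "qscale (of_int (sign (\<Phi> (j, q)))) (gen (permute_list (\<Phi> (j, q)) (v # vs)))
      = qscale (of_int (sign q) * (-1) ^ j)
      (gen (take j (permute_list q vs) @ v # drop j (permute_list q vs)))"
      by (simp add: s)
  qed
  also have "\<dots> = (\<Sum>q | q permutes {..<n}. \<Sum>j\<le>n. qscale (of_int (sign q) * (-1) ^ j)
      (gen (take j (permute_list q vs) @ v # drop j (permute_list q vs))))"
    by (subst sum.swap) (simp add: sum.cartesian_product)
  also have "\<dots> = insert_chain v (oriented_gen vs)"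
    by (simp add: insert_chain_def oriented_gen_gen qlift_sum qlift_scale n_def
        qvs.scale_sum_right)
  finally show ?thesis .
qed

definition tail_bdry :: "'v list qchain \<Rightarrow> 'v list qchain" where
  "tail_bdry = qlift (\<lambda>vs. gen (tl vs))"

lemma oriented_bdry_eq: "oriented_bdry p c = (if p = 0 then 0 else tail_bdry c)"
  by (simp add: oriented_bdry_def tail_bdry_def qlift_def single_eq_qscale_gen)

text \<open>Removing the head from an insertion at position 0 returns the list; from a later
  insertion it leaves an insertion into the tail with opposite sign. The empty list is excluded
  because \<open>tl [] = []\<close>.\<close>

lemma tail_bdry_insert_chain:
  assumes "Poly_Mapping.keys c \<subseteq> {ws. ws \<noteq> []}"
  shows "tail_bdry (insert_chain v c) = c - insert_chain v (tail_bdry c)"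
  using assms
proof (induction rule: qchain_induct)
  case (gen ws)
  then obtain w us where ws: "ws = w # us" by (cases ws) auto
  have "tail_bdry (insert_chain v (gen ws))
     = (\<Sum>j\<le>Suc (length us). qscale ((-1) ^ j) (gen (tl (take j ws @ v # drop j ws))))"
    by (simp add: insert_chain_def tail_bdry_def qlift_simps ws)
  also have "\<dots> = gen ws - (\<Sum>j\<le>length us. qscale ((-1) ^ j) (gen (take j us @ v # drop j us)))"
    unfolding sum.atMost_Suc_shift by (simp add: ws sum_negf)
  finally show ?case by (simp add: insert_chain_def tail_bdry_def ws)
qed (auto simp: insert_chain_def tail_bdry_def qlift_simps qvs.scale_right_diff_distrib)

lemma permutes_length_keys:
  "Poly_Mapping.keys (oriented_gen vs) \<subseteq> {ws. mset ws = mset vs}"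
  unfolding oriented_gen_gen
  by (intro keys_sub_sum keys_sub_scale) (auto simp: mset_permute_list)

text \<open>\<open>tail_bdry\<close> and \<open>obd\<close> satisfy the same cone recursion, one
  with \<open>insert_chain\<close>, the other with \<open>ocone\<close>, so antisymmetrization
  commutes with boundaries by induction on the list.\<close>

lemma tail_bdry_oriented_gen: "vs \<noteq> [] \<Longrightarrow> tail_bdry (oriented_gen vs) = qlift oriented_gen (obd_gen vs)"
proof (induction vs)
  case (Cons v vs)
  show ?case
  proof (cases "vs = []")
    case True
    then show ?thesis by (simp add: oriented_gen_Cons insert_chain_def tail_bdry_def qlift_simps)
  next
    case False
    have k: "Poly_Mapping.keys (oriented_gen vs) \<subseteq> {ws. ws \<noteq> []}"
      using permutes_length_keys[of vs] False by auto
    have "tail_bdry (oriented_gen (v # vs)) = oriented_gen vs - insert_chain v (tail_bdry (oriented_gen vs))"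
      by (simp add: oriented_gen_Cons tail_bdry_insert_chain[OF k])
    also have "\<dots> = oriented_gen vs - insert_chain v (qlift oriented_gen (obd_gen vs))"
      using Cons False by simp
    also have "insert_chain v (qlift oriented_gen (obd_gen vs)) = qlift oriented_gen (ocone v (obd_gen vs))"
      by (simp add: insert_chain_def ocone_def qlift_qlift)
         (simp add: oriented_gen_Cons insert_chain_def)
    finally show ?thesis by (simp add: qlift_simps)
  qed
qed simp

text \<open>Antisymmetrization, a sum over orderings without division by a factorial, so that a list
  goes to its oriented generator and not to a multiple of it.\<close>

definition orient :: "'v list qchain \<Rightarrow> 'v list qchain" where
  "orient = qlift oriented_gen"

lemma orient_gen [simp]: "orient (gen vs) = oriented_gen vs"
  by (simp add: orient_def)

lemma orient_0 [simp]: "orient 0 = 0" by (simp add: orient_def)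

lemmas orient_simps = qlift_simps[where h = oriented_gen, folded orient_def]

lemma tail_bdry_orient:
  assumes "Poly_Mapping.keys c \<subseteq> {vs. vs \<noteq> []}"
  shows "tail_bdry (orient c) = orient (obd c)"
  using assms
  by (induction rule: qchain_induct)
    (auto simp: orient_simps obd_simps tail_bdry_oriented_gen tail_bdry_def qlift_simps
      simp flip: orient_def, simp flip: tail_bdry_def add: tail_bdry_oriented_gen orient_def)

lemma oriented_gen_permute:
  assumes s: "\<sigma> permutes {..<length vs}"
  shows "oriented_gen (permute_list \<sigma> vs) = qscale (of_int (sign \<sigma>)) (oriented_gen vs)"
proof -
  let ?P = "{\<pi>. \<pi> permutes {..<length vs}}"
  have perm: "permutation \<pi>" if "\<pi> \<in> ?P" for \<pi>
    using that permutation_permutes by blast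
  have "oriented_gen vs = (\<Sum>\<pi>\<in>?P. qscale (of_int (sign (\<sigma> \<circ> \<pi>))) (gen (permute_list (\<sigma> \<circ> \<pi>) vs)))"
    unfolding oriented_gen_gen by (rule setum_permutations_compose_left[OF s])
  also have "qscale (of_int (sign \<sigma>)) \<dots>
      = (\<Sum>\<pi>\<in>?P. qscale (of_int (sign \<pi>)) (gen (permute_list \<pi> (permute_list \<sigma> vs))))"
    unfolding qvs.scale_sum_right
  proof (rule sum.cong[OF refl])
    fix \<pi> assume p: "\<pi> \<in> ?P"
    have "sign \<sigma> * sign (\<sigma> \<circ> \<pi>) = sign \<pi>"
      using sign_compose[OF perm perm[OF p], of \<sigma>] s by simp
    then have "(of_int (sign \<sigma>) :: rat) * of_int (sign (\<sigma> \<circ> \<pi>)) = of_int (sign \<pi>)"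
      by (simp flip: of_int_mult)
    then show "qscale (of_int (sign \<sigma>)) (qscale (of_int (sign (\<sigma> \<circ> \<pi>))) (gen (permute_list (\<sigma> \<circ> \<pi>) vs)))
      = qscale (of_int (sign \<pi>)) (gen (permute_list \<pi> (permute_list \<sigma> vs)))"
      using permute_list_compose[of \<pi> vs \<sigma>] p by simp
  qed
  finally show ?thesis by (simp add: oriented_gen_gen)
qed

lemma lookup_oriented_gen_permute:
  assumes p: "\<pi> permutes {..<length ws}"
  shows "Poly_Mapping.lookup (oriented_gen vs) (permute_list \<pi> ws)
    = of_int (sign \<pi>) * Poly_Mapping.lookup (oriented_gen vs) ws"
proof (cases "length ws = length vs")
  case False
  then have "length us \<noteq> length vs \<Longrightarrow> Poly_Mapping.lookup (oriented_gen vs) us = 0" for us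
    using permutes_length_keys[of vs] by (auto simp: in_keys_iff dest: mset_eq_length)
  with False show ?thesis by simp
next
  case True
  let ?P = "{\<rho>. \<rho> permutes {..<length vs}}"
  have p': "\<pi> \<in> ?P" using p True by simp
  have perm: "permutation \<rho>" if "\<rho> \<in> ?P" for \<rho>
    using that permutation_permutes by blast
  have inj: "permute_list \<pi> us = permute_list \<pi> ws \<longleftrightarrow> us = ws" if "length us = length ws" for us
  proof
    assume eq: "permute_list \<pi> us = permute_list \<pi> ws"
    have "inv_into UNIV \<pi> permutes {..<length ws}" using p by (rule permutes_inv)
    then have "permute_list (\<pi> \<circ> inv_into UNIV \<pi>) us = permute_list (\<pi> \<circ> inv_into UNIV \<pi>) ws"
      using permute_list_compose[of "inv_into UNIV \<pi>" us \<pi>] permute_list_compose[of "inv_into UNIV \<pi>" ws \<pi>] eq that by simp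
    then show "us = ws" using permutes_inv_o(1)[OF p] by simp
  qed simp
  have L: "Poly_Mapping.lookup (oriented_gen vs) us
    = (\<Sum>\<rho>\<in>?P. of_int (sign \<rho>) * (if permute_list \<rho> vs = us then 1 else 0))" for us
    by (simp add: oriented_gen_gen lookup_sum lookup_gen)
  have "Poly_Mapping.lookup (oriented_gen vs) (permute_list \<pi> ws)
    = (\<Sum>\<rho>\<in>?P. of_int (sign (\<rho> \<circ> \<pi>)) * (if permute_list (\<rho> \<circ> \<pi>) vs = permute_list \<pi> ws then 1 else 0))"
    unfolding L using p' by (intro sum_permutations_compose_right) auto
  also have "\<dots> = (\<Sum>\<rho>\<in>?P. of_int (sign \<pi>) * (of_int (sign \<rho>) * (if permute_list \<rho> vs = ws then 1 else 0)))"
  proof (rule sum.cong[OF refl])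
    fix \<rho> assume r: "\<rho> \<in> ?P"
    have "permute_list (\<rho> \<circ> \<pi>) vs = permute_list \<pi> (permute_list \<rho> vs)"
      using p' by (intro permute_list_compose) auto
    then show "of_int (sign (\<rho> \<circ> \<pi>)) * (if permute_list (\<rho> \<circ> \<pi>) vs = permute_list \<pi> ws then 1 else (0::rat))
      = of_int (sign \<pi>) * (of_int (sign \<rho>) * (if permute_list \<rho> vs = ws then 1 else 0))"
      using inj[of "permute_list \<rho> vs"] True sign_compose[OF perm[OF r] perm[OF p']] by simp
  qed
  finally show ?thesis by (simp add: L sum_distrib_left)
qed

text \<open>Swapping two equal entries fixes the list and changes the sign. Degenerate lists thus
  vanish under \<open>orient\<close>, and vertex maps may collapse simplices.\<close>

lemma oriented_gen_not_distinct:
  assumes "\<not> distinct vs" shows "oriented_gen vs = 0"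
proof -
  obtain i j where ij: "i < length vs" "j < length vs" "i \<noteq> j" "vs ! i = vs ! j"
    using assms by (auto simp: distinct_conv_nth)
  have p: "Transposition.transpose i j permutes {..<length vs}"
    using ij by (intro permutes_swap_id) auto
  have "permute_list (Transposition.transpose i j) vs = vs"
    using p ij by (intro nth_equalityI) (auto simp: permute_list_nth Transposition.transpose_def)
  then have "oriented_gen vs = - oriented_gen vs"
    using oriented_gen_permute[OF p] ij by (simp add: sign_swap_id)
  then have "Poly_Mapping.lookup (oriented_gen vs) us = - Poly_Mapping.lookup (oriented_gen vs) us" for us
    by (metis lookup_uminus)
  then show ?thesis by (intro poly_mapping_eqI) simp
qed

lemma oriented_gen_in_chains:
  assumes "length vs = Suc p" "distinct vs \<Longrightarrow> set vs \<in> K"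
  shows "oriented_gen vs \<in> oriented_chains K p"
proof (cases "distinct vs")
  case True
  have "length ws = Suc p \<and> distinct ws \<and> set ws \<in> K" if "ws \<in> Poly_Mapping.keys (oriented_gen vs)" for ws
  proof -
    have "mset ws = mset vs" using that permutes_length_keys[of vs] by auto
    then show ?thesis
      using assms True mset_eq_length mset_eq_setD mset_eq_imp_distinct_iff by metis
  qed
  then show ?thesis
    unfolding oriented_chains_def using lookup_oriented_gen_permute[of _ _ vs] by auto
next
  case False
  then show ?thesis
    by (simp add: oriented_chains_def oriented_gen_not_distinct)
qed

lemma subspace_oriented_chains: "qvs.subspace (oriented_chains K p)"
  unfolding qvs.subspace_def oriented_chains_def
  by (auto simp: lookup_add algebra_simps dest: subsetD[OF keys_add] subsetD[OF keys_qscale])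

text \<open>On a chain that is already alternating, all \<open>(p + 1)!\<close> orderings contribute
  the same coefficient. Over the rationals this factor is invertible, hence oriented chains are
  spanned by oriented generators.\<close>

lemma orient_alternating:
  assumes "c \<in> oriented_chains K p"
  shows "orient c = qscale (fact (Suc p)) c"
proof (rule poly_mapping_eqI)
  fix ws
  let ?P = "{\<rho>. \<rho> permutes {..<Suc p}}"
  have k: "length vs = Suc p" if "vs \<in> Poly_Mapping.keys c" for vs
    using assms that by (auto simp: oriented_chains_def)
  have "Poly_Mapping.lookup (orient c) ws
      = (\<Sum>vs\<in>Poly_Mapping.keys c. Poly_Mapping.lookup c vs *
          (\<Sum>\<rho>\<in>?P. of_int (sign \<rho>) * (if permute_list \<rho> vs = ws then 1 else 0)))"
    using k by (simp add: orient_def qlift_def lookup_sum oriented_gen_gen lookup_gen)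
  also have "\<dots> = (\<Sum>\<rho>\<in>?P. \<Sum>vs\<in>Poly_Mapping.keys c. 
      (if permute_list \<rho> vs = ws then of_int (sign \<rho>) * Poly_Mapping.lookup c vs else 0))"
    by (subst sum.swap) (simp add: sum_distrib_left if_distrib mult.commute cong: if_cong)
  also have "\<dots> = (\<Sum>\<rho>\<in>?P. Poly_Mapping.lookup c ws)"
  proof (rule sum.cong[OF refl])
    fix \<rho> assume r: "\<rho> \<in> ?P"
    have alt: "length vs = Suc p \<Longrightarrow>
        Poly_Mapping.lookup c (permute_list \<rho> vs) = of_int (sign \<rho>) * Poly_Mapping.lookup c vs" for vs
      using assms r by (auto simp: oriented_chains_def)
    have "(\<Sum>vs\<in>Poly_Mapping.keys c.
          (if permute_list \<rho> vs = ws then of_int (sign \<rho>) * Poly_Mapping.lookup c vs else 0))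
        = (\<Sum>vs\<in>Poly_Mapping.keys c.
          (if vs = permute_list (inv_into UNIV \<rho>) ws then Poly_Mapping.lookup c ws else 0))"
    proof (rule sum.cong[OF refl])
      fix vs assume vs: "vs \<in> Poly_Mapping.keys c"
      have i: "inv_into UNIV \<rho> permutes {..<Suc p}" using r permutes_inv by auto
      have a: "permute_list (inv_into UNIV \<rho>) (permute_list \<rho> vs) = vs"
        using permute_list_compose[of "inv_into UNIV \<rho>" vs \<rho>] i k[OF vs] permutes_inv_o(1)[of \<rho>] r by auto
      have b: "permute_list \<rho> vs = ws" if "vs = permute_list (inv_into UNIV \<rho>) ws"
        using permute_list_compose[of \<rho> ws "inv_into UNIV \<rho>"] that k[OF vs] permutes_inv_o(2)[of \<rho>] r by auto
      show "(if permute_list \<rho> vs = ws then of_int (sign \<rho>) * Poly_Mapping.lookup c vs else 0) =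
          (if vs = permute_list (inv_into UNIV \<rho>) ws then Poly_Mapping.lookup c ws else 0)"
        using a b alt[OF k[OF vs]] by auto
    qed
    also have "\<dots> = Poly_Mapping.lookup c ws"
    proof (cases "permute_list (inv_into UNIV \<rho>) ws \<in> Poly_Mapping.keys c")
      case False
      have "Poly_Mapping.lookup c ws = 0"
      proof (rule ccontr)
        assume n: "Poly_Mapping.lookup c ws \<noteq> 0"
        then have l: "length ws = Suc p" using k by (simp add: in_keys_iff)
        have i: "inv_into UNIV \<rho> permutes {..<Suc p}" using r permutes_inv by auto
        then have "Poly_Mapping.lookup c (permute_list (inv_into UNIV \<rho>) ws)
            = of_int (sign (inv_into UNIV \<rho>)) * Poly_Mapping.lookup c ws"
          using assms l by (auto simp: oriented_chains_def)
        then show False using False n by (simp add: in_keys_iff)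
      qed
      then show ?thesis using False by simp
    qed simp
    finally show "(\<Sum>vs\<in>Poly_Mapping.keys c.
          (if permute_list \<rho> vs = ws then of_int (sign \<rho>) * Poly_Mapping.lookup c vs else 0))
        = Poly_Mapping.lookup c ws" .
  qed
  also have "\<dots> = fact (Suc p) * Poly_Mapping.lookup c ws"
    by (simp add: card_permutations[of "{..<Suc p}" "Suc p"] del: fact_Suc)
  finally show "Poly_Mapping.lookup (orient c) ws = Poly_Mapping.lookup (qscale (fact (Suc p)) c) ws"
    by simp
qed

lemma oriented_chain_eq:
  assumes "c \<in> oriented_chains K p"
  shows "c = qscale (1 / fact (Suc p)) (orient c)"
  by (simp add: orient_alternating[OF assms] del: fact_Suc)

lemma oriented_linear_eqI:
  assumes f: "qlinear_on (oriented_chains K p) f" and g: "qlinear_on (oriented_chains K p) g"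
    and eq: "\<And>vs. length vs = Suc p \<Longrightarrow> distinct vs \<Longrightarrow> set vs \<in> K \<Longrightarrow> f (oriented_gen vs) = g (oriented_gen vs)"
    and c: "c \<in> oriented_chains K p"
  shows "f c = g c"
proof -
  note sub = subspace_oriented_chains[of K p]
  have k: "length vs = Suc p \<and> distinct vs \<and> set vs \<in> K" if "vs \<in> Poly_Mapping.keys c" for vs
    using c that by (auto simp: oriented_chains_def)
  have in_ch: "oriented_gen vs \<in> oriented_chains K p" if "vs \<in> Poly_Mapping.keys c" for vs
    using k[OF that] by (intro oriented_gen_in_chains) auto
  have oc: "orient c \<in> oriented_chains K p"
    unfolding orient_def by (rule qlift_in_subspace[OF sub in_ch])
  have e: "h (orient c) = (\<Sum>vs\<in>Poly_Mapping.keys c. qscale (Poly_Mapping.lookup c vs) (h (oriented_gen vs)))"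
    if "qlinear_on (oriented_chains K p) h" for h :: "'a list qchain \<Rightarrow> 'b qchain"
    unfolding orient_def qlift_def by (rule qlinear_on_sum[OF that in_ch sub])
  have "f (orient c) = g (orient c)"
    unfolding e[OF f] e[OF g] using k eq by (intro sum.cong) auto
  then have "f (qscale (1 / fact (Suc p)) (orient c)) = g (qscale (1 / fact (Suc p)) (orient c))"
    by (simp only: qlinear_onD(2)[OF f oc] qlinear_onD(2)[OF g oc])
  then show ?thesis using oriented_chain_eq[OF c] by simp
qed

lemma keys_orient:
  "Poly_Mapping.keys (orient c) \<subseteq> {ws. \<exists>vs\<in>Poly_Mapping.keys c. mset ws = mset vs}"
  unfolding orient_def
  by (rule keys_sub_qlift) (use permutes_length_keys in fastforce)

lemma orient_in_chains:
  assumes "\<And>vs. vs \<in> Poly_Mapping.keys c \<Longrightarrow> length vs = Suc p \<and> (distinct vs \<longrightarrow> set vs \<in> K)"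
  shows "orient c \<in> oriented_chains K p"
  unfolding orient_def
  using assms by (intro qlift_in_subspace[OF subspace_oriented_chains] oriented_gen_in_chains) auto

lemma oriented_gen_single: "oriented_gen [v] = gen [v]"
  by (simp add: oriented_gen_Cons insert_chain_def)

section \<open>Traces on quotients of rational vector spaces\<close>

definition lincomb :: "'k qchain set \<Rightarrow> ('k qchain \<Rightarrow> rat) \<Rightarrow> 'k qchain" where
  "lincomb E a = (\<Sum>e\<in>E. qscale (a e) e)"

text \<open>\<open>qbasis Z B E\<close>: the classes of the elements of \<open>E\<close> form a basis of \<open>Z / B\<close>.\<close>

definition qbasis :: "'k qchain set \<Rightarrow> 'k qchain set \<Rightarrow> 'k qchain set \<Rightarrow> bool" where
  "qbasis Z B E \<longleftrightarrow> finite E \<and> E \<subseteq> Z \<and> (\<forall>z\<in>Z. \<exists>a. z - lincomb E a \<in> B) \<and>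
     (\<forall>a. lincomb E a \<in> B \<longrightarrow> (\<forall>e\<in>E. a e = 0))"

text \<open>\<open>m\<close> is the matrix of the map induced on \<open>Z / B\<close>, in a basis
  given by representatives. A relation is used instead of a value so that each argument may pick a
  convenient basis; \<open>has_qtrace_unique\<close> shows that the choice does not matter.\<close>

definition has_qtrace :: "'k qchain set \<Rightarrow> 'k qchain set \<Rightarrow> ('k qchain \<Rightarrow> 'k qchain) \<Rightarrow> rat \<Rightarrow> bool" where
  "has_qtrace Z B T t \<longleftrightarrow> (\<exists>E m. qbasis Z B E \<and>
     (\<forall>e\<in>E. T e - lincomb E (\<lambda>e'. m e' e) \<in> B) \<and> t = (\<Sum>e\<in>E. m e e))"

text \<open>\<open>qmorph Z B Z' B' R\<close>: the map \<open>R\<close> of representatives induces a linear map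
  \<open>Z / B \<rightarrow> Z' / B'\<close>.\<close>

definition qmorph :: "'k qchain set \<Rightarrow> 'k qchain set \<Rightarrow> 'l qchain set \<Rightarrow> 'l qchain set \<Rightarrow>
    ('k qchain \<Rightarrow> 'l qchain) \<Rightarrow> bool" where
  "qmorph Z B Z' B' R \<longleftrightarrow> (\<forall>z\<in>Z. R z \<in> Z') \<and>
     (\<forall>x\<in>Z. \<forall>y\<in>Z. R (x + y) - (R x + R y) \<in> B') \<and>
     (\<forall>r. \<forall>x\<in>Z. R (qscale r x) - qscale r (R x) \<in> B') \<and>
     (\<forall>x\<in>B. R x \<in> B')"

definition qpair :: "'k qchain set \<Rightarrow> 'k qchain set \<Rightarrow> bool" where
  "qpair Z B \<longleftrightarrow> qvs.subspace Z \<and> qvs.subspace B \<and> B \<subseteq> Z"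

lemma cong_sym: "qvs.subspace B \<Longrightarrow> x - y \<in> B \<Longrightarrow> y - x \<in> B"
  using qvs.subspace_neg[of B "x - y"] by simp

lemma cong_trans: "qvs.subspace B \<Longrightarrow> x - y \<in> B \<Longrightarrow> y - z \<in> B \<Longrightarrow> x - z \<in> B"
  using qvs.subspace_add[of B "x - y" "y - z"] by simp

lemma cong_add: "qvs.subspace B \<Longrightarrow> x - x' \<in> B \<Longrightarrow> y - y' \<in> B \<Longrightarrow> (x + y) - (x' + y') \<in> B"
  using qvs.subspace_add[of B "x - x'" "y - y'"] by (simp add: algebra_simps)

lemma cong_scale: "qvs.subspace B \<Longrightarrow> x - y \<in> B \<Longrightarrow> qscale r x - qscale r y \<in> B"
  using qvs.subspace_scale[of B "x - y" r] by (simp add: qvs.scale_right_diff_distrib)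

lemma cong_sum:
  "qvs.subspace B \<Longrightarrow> (\<And>i. i \<in> I \<Longrightarrow> f i - g i \<in> B) \<Longrightarrow> sum f I - sum g I \<in> B"
  by (simp flip: sum_subtractf add: qvs.subspace_sum)

lemma lincomb_in: "qvs.subspace Z \<Longrightarrow> E \<subseteq> Z \<Longrightarrow> lincomb E a \<in> Z"
  unfolding lincomb_def by (intro qvs.subspace_sum qvs.subspace_scale) auto

lemma lincomb_diff: "lincomb E a - lincomb E b = lincomb E (\<lambda>e. a e - b e)"
  by (simp add: lincomb_def qvs.scale_left_diff_distrib sum_subtractf)

lemma qbasis_unique:
  assumes "qbasis Z B E" "qvs.subspace B" "x - lincomb E a \<in> B" "x - lincomb E b \<in> B" "e \<in> E"
  shows "a e = b e"
proof -
  have "lincomb E a - lincomb E b \<in> B"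
    using assms cong_sym cong_trans by metis
  then have "a e - b e = 0"
    using assms unfolding qbasis_def lincomb_diff by blast
  then show ?thesis by simp
qed

lemma qmorphD:
  assumes "qmorph Z B Z' B' R"
  shows "z \<in> Z \<Longrightarrow> R z \<in> Z'" "x \<in> Z \<Longrightarrow> y \<in> Z \<Longrightarrow> R (x + y) - (R x + R y) \<in> B'"
    "x \<in> Z \<Longrightarrow> R (qscale r x) - qscale r (R x) \<in> B'" "x \<in> B \<Longrightarrow> R x \<in> B'"
  using assms by (auto simp: qmorph_def)

lemma qmorph_cong:
  assumes "qmorph Z B Z' B' R" "qpair Z B" "qvs.subspace B'" "x \<in> Z" "y \<in> Z" "x - y \<in> B"
  shows "R x - R y \<in> B'"
proof -
  have xy: "x - y \<in> Z" using assms by (auto simp: qpair_def)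
  have "R (y + (x - y)) - (R y + R (x - y)) \<in> B'"
    using qmorphD(2)[OF assms(1) assms(5) xy] .
  moreover have "R (x - y) \<in> B'" using qmorphD(4)[OF assms(1) assms(6)] .
  ultimately have "(R x - (R y + R (x - y))) + R (x - y) \<in> B'"
    using assms(3) by (metis add.commute diff_add_cancel qvs.subspace_add)
  then show ?thesis by simp
qed

lemma qmorph_sum:
  assumes R: "qmorph Z B Z' B' R" and Z: "qpair Z B" and B': "qvs.subspace B'"
    and g: "\<And>i. i \<in> I \<Longrightarrow> g i \<in> Z"
  shows "R (\<Sum>i\<in>I. qscale (a i) (g i)) - (\<Sum>i\<in>I. qscale (a i) (R (g i))) \<in> B'"
  using g
proof (induction I rule: infinite_finite_induct)
  case (infinite A)
  then show ?case using qmorphD(4)[OF R] Z by (simp add: qpair_def qvs.subspace_0)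
next
  case empty
  then show ?case using qmorphD(4)[OF R] Z by (simp add: qpair_def qvs.subspace_0)
next
  case (insert i I)
  have in_Z: "qscale (a i) (g i) \<in> Z" "(\<Sum>i\<in>I. qscale (a i) (g i)) \<in> Z"
    using insert Z by (auto intro!: qvs.subspace_sum qvs.subspace_scale simp: qpair_def)
  have "R (qscale (a i) (g i) + (\<Sum>i\<in>I. qscale (a i) (g i))) -
      (qscale (a i) (R (g i)) + (\<Sum>i\<in>I. qscale (a i) (R (g i)))) \<in> B'"
    using insert
    by (intro cong_trans[OF B' qmorphD(2)[OF R in_Z] cong_add[OF B' qmorphD(3)[OF R]]]) auto
  then show ?case using insert by simp
qed

lemma qmorph_lincomb:
  assumes "qmorph Z B Z' B' R" "qpair Z B" "qvs.subspace B'" "E \<subseteq> Z"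
  shows "R (lincomb E a) - (\<Sum>e\<in>E. qscale (a e) (R e)) \<in> B'"
  unfolding lincomb_def using assms by (intro qmorph_sum[OF assms(1-3)]) auto

text \<open>The identity tr(PR) = tr(RP): the coefficient matrices of \<open>R\<close> and
  \<open>P\<close> multiply in one order to the matrix of \<open>T\<close> and in the other to that
  of \<open>T'\<close>. The maps have to agree with the composites only modulo \<open>B\<close> and
  \<open>B'\<close>. Independence of bases, restriction to an image and the cancellation in the Hopf
  trace formula are all instances.\<close>

lemma qtrace_comm:
  assumes ZB: "qpair Z B" and ZB': "qpair Z' B'"
    and R: "qmorph Z B Z' B' R" and P: "qmorph Z' B' Z B P"
    and T: "has_qtrace Z B T t" and T': "has_qtrace Z' B' T' t'"
    and PR: "\<And>z. z \<in> Z \<Longrightarrow> T z - P (R z) \<in> B" and RP: "\<And>z. z \<in> Z' \<Longrightarrow> T' z - R (P z) \<in> B'"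
  shows "t = t'"
proof -
  have sB: "qvs.subspace B" "qvs.subspace B'" using ZB ZB' by (auto simp: qpair_def)
  obtain E m where E: "qbasis Z B E" "\<And>e. e \<in> E \<Longrightarrow> T e - lincomb E (\<lambda>e'. m e' e) \<in> B"
    and t: "t = (\<Sum>e\<in>E. m e e)" using T by (auto simp: has_qtrace_def)
  obtain F n where F: "qbasis Z' B' F" "\<And>e. e \<in> F \<Longrightarrow> T' e - lincomb F (\<lambda>e'. n e' e) \<in> B'"
    and t': "t' = (\<Sum>e\<in>F. n e e)" using T' by (auto simp: has_qtrace_def)
  have fin: "finite E" "finite F" and sub: "E \<subseteq> Z" "F \<subseteq> Z'"
    using E F by (auto simp: qbasis_def)
  have Fsp: "\<exists>a. z - lincomb F a \<in> B'" if "z \<in> Z'" for z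
    using F(1) that by (simp add: qbasis_def)
  have Esp: "\<exists>a. z - lincomb E a \<in> B" if "z \<in> Z" for z
    using E(1) that by (simp add: qbasis_def)
  have "\<forall>e\<in>E. \<exists>a. R e - lincomb F a \<in> B'"
    using sub(1) by (intro ballI Fsp qmorphD(1)[OF R]) auto
  then obtain r where r: "\<And>e. e \<in> E \<Longrightarrow> R e - lincomb F (r e) \<in> B'" by metis
  have "\<forall>f\<in>F. \<exists>a. P f - lincomb E a \<in> B"
    using sub(2) by (intro ballI Esp qmorphD(1)[OF P]) auto
  then obtain p where p: "\<And>f. f \<in> F \<Longrightarrow> P f - lincomb E (p f) \<in> B" by metis
  have m: "m e' e = (\<Sum>f\<in>F. r e f * p f e')" if e: "e \<in> E" and e': "e' \<in> E" for e e'
  proof -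
    have "T e - lincomb E (\<lambda>e'. \<Sum>f\<in>F. r e f * p f e') \<in> B"
    proof -
      have h1: "P (R e) - P (lincomb F (r e)) \<in> B"
        using e sub r qmorphD(1)[OF R] ZB' F
        by (intro qmorph_cong[OF P ZB' sB(1)] lincomb_in) (auto simp: qpair_def)
      have h2: "P (lincomb F (r e)) - (\<Sum>f\<in>F. qscale (r e f) (P f)) \<in> B"
        by (rule qmorph_lincomb[OF P ZB' sB(1) sub(2)])
      have h3: "(\<Sum>f\<in>F. qscale (r e f) (P f)) - (\<Sum>f\<in>F. qscale (r e f) (lincomb E (p f))) \<in> B"
        using p by (intro cong_sum cong_scale sB)
      have h4: "(\<Sum>f\<in>F. qscale (r e f) (lincomb E (p f)))
          = lincomb E (\<lambda>e'. \<Sum>f\<in>F. r e f * p f e')"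
        unfolding lincomb_def qvs.scale_sum_right qvs.scale_sum_left
        by (subst sum.swap) simp
      have "T e - P (R e) \<in> B" using PR e sub by blast
      then show ?thesis
        using cong_trans[OF sB(1) cong_trans[OF sB(1) _ h1] cong_trans[OF sB(1) h2 h3]]
        unfolding h4 by blast
    qed
    from qbasis_unique[OF E(1) sB(1) E(2)[OF e] this e'] show ?thesis .
  qed
  have n: "n f' f = (\<Sum>e\<in>E. p f e * r e f')" if f: "f \<in> F" and f': "f' \<in> F" for f f'
  proof -
    have "T' f - lincomb F (\<lambda>f'. \<Sum>e\<in>E. p f e * r e f') \<in> B'"
    proof -
      have h1: "R (P f) - R (lincomb E (p f)) \<in> B'"
        using f sub p qmorphD(1)[OF P] ZB E
        by (intro qmorph_cong[OF R ZB sB(2)] lincomb_in) (auto simp: qpair_def)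
      have h2: "R (lincomb E (p f)) - (\<Sum>e\<in>E. qscale (p f e) (R e)) \<in> B'"
        by (rule qmorph_lincomb[OF R ZB sB(2) sub(1)])
      have h3: "(\<Sum>e\<in>E. qscale (p f e) (R e)) - (\<Sum>e\<in>E. qscale (p f e) (lincomb F (r e))) \<in> B'"
        using r by (intro cong_sum cong_scale sB)
      have h4: "(\<Sum>e\<in>E. qscale (p f e) (lincomb F (r e)))
          = lincomb F (\<lambda>f'. \<Sum>e\<in>E. p f e * r e f')"
        unfolding lincomb_def qvs.scale_sum_right qvs.scale_sum_left
        by (subst sum.swap) simp
      have "T' f - R (P f) \<in> B'" using RP f sub by blast
      then show ?thesis
        using cong_trans[OF sB(2) cong_trans[OF sB(2) _ h1] cong_trans[OF sB(2) h2 h3]]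
        unfolding h4 by blast
    qed
    from qbasis_unique[OF F(1) sB(2) F(2)[OF f] this f'] show ?thesis .
  qed
  have "t = (\<Sum>e\<in>E. \<Sum>f\<in>F. r e f * p f e)" unfolding t using m by (intro sum.cong) auto
  also have "\<dots> = (\<Sum>f\<in>F. \<Sum>e\<in>E. p f e * r e f)" by (subst sum.swap) (simp add: mult.commute)
  also have "\<dots> = t'" unfolding t' using n by (intro sum.cong) auto
  finally show ?thesis .
qed

lemma qmorph_id: "qpair Z B \<Longrightarrow> qpair Z' B' \<Longrightarrow> Z \<subseteq> Z' \<Longrightarrow> B \<subseteq> B' \<Longrightarrow> qmorph Z B Z' B' (\<lambda>z. z)"
  by (auto simp: qmorph_def qpair_def qvs.subspace_0)

text \<open>The instance of tr(PR) = tr(RP) in which \<open>P\<close> is the identity, applied to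
  two bases of the same quotient.\<close>

lemma has_qtrace_unique:
  assumes ZB: "qpair Z B" and T: "qmorph Z B Z B T" and "has_qtrace Z B T t" "has_qtrace Z B T t'"
  shows "t = t'"
  by (rule qtrace_comm[OF ZB ZB T qmorph_id[OF ZB ZB] assms(3,4)])
    (use ZB in \<open>auto simp: qpair_def qvs.subspace_0\<close>)

lemma has_qtrace_exists:
  assumes "qbasis Z B E" "\<And>z. z \<in> Z \<Longrightarrow> T z \<in> Z"
  shows "\<exists>t. has_qtrace Z B T t"
proof -
  have "\<forall>e\<in>E. \<exists>a. T e - lincomb E a \<in> B"
    using assms unfolding qbasis_def by blast
  then obtain m where "\<And>e. e \<in> E \<Longrightarrow> T e - lincomb E (m e) \<in> B" by metis
  then show ?thesis
    using assms(1) unfolding has_qtrace_def by (intro exI[of _ _] exI[of _ E] exI[of _ "\<lambda>e' e. m e e'"]) auto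
qed

lemma lincomb_remove:
  assumes "finite E" "e \<in> E"
  shows "lincomb E a = qscale (a e) e + lincomb (E - {e}) a"
  unfolding lincomb_def using assms by (simp add: sum.remove)

text \<open>A spanning subset of least cardinality is independent modulo \<open>B\<close>: an
  element with nonzero coefficient in a relation could be eliminated from all expansions.\<close>

lemma qbasis_exists:
  assumes ZB: "qpair Z B" and "finite F" "F \<subseteq> Z" "\<And>z. z \<in> Z \<Longrightarrow> \<exists>a. z - lincomb F a \<in> B"
  shows "\<exists>E\<subseteq>F. qbasis Z B E"
proof -
  have sB: "qvs.subspace B" using ZB by (simp add: qpair_def)
  define S where "S = (\<lambda>E. E \<subseteq> F \<and> (\<forall>z\<in>Z. \<exists>a. z - lincomb E a \<in> B))"
  have "S F" using assms by (auto simp: S_def)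
  then obtain E where E: "S E" and min: "\<And>E'. S E' \<Longrightarrow> card E \<le> card E'"
    using arg_min_natI[of S F card] arg_min_nat_le[of S _ card] by metis
  have fin: "finite E" using E assms finite_subset by (auto simp: S_def)
  have ind: "\<forall>e\<in>E. a e = 0" if a: "lincomb E a \<in> B" for a
  proof (rule ccontr)
    assume "\<not> (\<forall>e\<in>E. a e = 0)"
    then obtain e where e: "e \<in> E" "a e \<noteq> 0" by auto
    have "S (E - {e})"
      unfolding S_def
    proof (intro conjI ballI)
      show "E - {e} \<subseteq> F" using E by (auto simp: S_def)
      fix z assume "z \<in> Z"
      then obtain b where b: "z - lincomb E b \<in> B" using E by (auto simp: S_def)
      have "(z - lincomb E b) + qscale (b e / a e) (lincomb E a) \<in> B"
        using a b sB by (intro qvs.subspace_add qvs.subspace_scale)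
      also have "(z - lincomb E b) + qscale (b e / a e) (lincomb E a)
          = z - lincomb (E - {e}) (\<lambda>x. b x - b e / a e * a x)"
        unfolding lincomb_remove[OF fin e(1)] lincomb_diff[symmetric]
        using e by (simp add: lincomb_def qvs.scale_right_distrib qvs.scale_sum_right)
      finally show "\<exists>a. z - lincomb (E - {e}) a \<in> B" by blast
    qed
    then have "card E \<le> card (E - {e})" by (rule min)
    then show False using e fin by (metis card_Diff1_less not_le)
  qed
  have sp: "E \<subseteq> F" "\<forall>z\<in>Z. \<exists>a. z - lincomb E a \<in> B" using E unfolding S_def by simp_all
  have "qbasis Z B E"
    unfolding qbasis_def
    by (intro conjI allI impI fin sp(2) ind order_trans[OF sp(1) assms(3)])
  then show ?thesis using \<open>E \<subseteq> F\<close> by blast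
qed

lemma subspace_finite_spanning:
  assumes Z: "qvs.subspace Z" and "Z \<subseteq> qvs.span F" "finite F"
  shows "\<exists>E. finite E \<and> E \<subseteq> Z \<and> (\<forall>z\<in>Z. \<exists>a. z - lincomb E a \<in> {0})"
proof -
  obtain E where E: "E \<subseteq> Z" "qvs.independent E" "Z \<subseteq> qvs.span E"
    using qvs.maximal_independent_subset by blast
  have fin: "finite E"
    using qvs.independent_span_bound[OF assms(3) E(2)] E(1) assms(2) by auto
  have "\<exists>a. z - lincomb E a \<in> {0}" if "z \<in> Z" for z
  proof -
    have "z \<in> range (\<lambda>u. \<Sum>v\<in>E. qscale (u v) v)"
      using E(3) that qvs.span_finite[OF fin] by auto
    then show ?thesis by (auto simp: lincomb_def)
  qed
  then show ?thesis using fin E(1) by blast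
qed

definition qfinite :: "'k qchain set \<Rightarrow> 'k qchain set \<Rightarrow> bool" where
  "qfinite Z B \<longleftrightarrow> (\<exists>E. qbasis Z B E)"

lemma qfinite_sub:
  assumes Z: "qpair Z B" and "Z \<subseteq> qvs.span F" "finite F"
  shows "qfinite Z B"
proof -
  obtain E where E: "finite E" "E \<subseteq> Z" "\<And>z. z \<in> Z \<Longrightarrow> \<exists>a. z - lincomb E a \<in> {0}"
    using subspace_finite_spanning[OF _ assms(2,3)] Z by (auto simp: qpair_def)
  have "\<exists>a. z - lincomb E a \<in> B" if "z \<in> Z" for z
  proof -
    obtain a where "z - lincomb E a = 0" using E(3)[OF \<open>z \<in> Z\<close>] by auto
    moreover have "0 \<in> B" using Z qvs.subspace_0[of B] by (simp add: qpair_def)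
    ultimately show ?thesis by metis
  qed
  then show ?thesis
    using qbasis_exists[OF Z E(1,2)] by (auto simp: qfinite_def)
qed

text \<open>Representatives \<open>E\<close> of a basis of \<open>Z / B\<close> together with a
  basis \<open>F\<close> of \<open>B\<close> form a basis of \<open>Z\<close>, in which the matrix
  of \<open>T\<close> is block triangular because \<open>T\<close> maps \<open>B\<close> into
  itself.\<close>

lemma has_qtrace_additive:
  assumes ZB: "qpair Z B" and T: "\<And>b. b \<in> B \<Longrightarrow> T b \<in> B"
    and B: "has_qtrace B {0} T tB" and Q: "has_qtrace Z B T tQ"
  shows "has_qtrace Z {0} T (tB + tQ)"
proof -
  have sB: "qvs.subspace B" "qvs.subspace Z" "B \<subseteq> Z" using ZB by (auto simp: qpair_def)
  obtain E m where E: "qbasis Z B E" "\<And>e. e \<in> E \<Longrightarrow> T e - lincomb E (\<lambda>e'. m e' e) \<in> B"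
    and t: "tQ = (\<Sum>e\<in>E. m e e)" using Q by (auto simp: has_qtrace_def)
  obtain F n where F: "qbasis B {0} F" "\<And>e. e \<in> F \<Longrightarrow> T e = lincomb F (\<lambda>e'. n e' e)"
    and t': "tB = (\<Sum>e\<in>F. n e e)" using B by (auto simp: has_qtrace_def)
  have fin: "finite E" "finite F" and sub: "E \<subseteq> Z" "F \<subseteq> B"
    using E F by (auto simp: qbasis_def)
  have Fspan: "\<exists>a. b = lincomb F a" if "b \<in> B" for b
    using F(1) that by (auto simp: qbasis_def)
  have disj: "E \<inter> F = {}"
  proof (rule ccontr)
    assume "E \<inter> F \<noteq> {}"
    then obtain e where e: "e \<in> E" "e \<in> B" using sub by auto
    have "lincomb E (\<lambda>x. if x = e then 1 else 0) = e"
      using e fin by (subst lincomb_remove[of _ e]) (auto simp: lincomb_def)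
    then show False using E(1) e unfolding qbasis_def
      by (metis (mono_tags, lifting) zero_neq_one)
  qed
  have un: "lincomb (E \<union> F) (\<lambda>x. if x \<in> E then a x else b x) = lincomb E a + lincomb F b" for a b
  proof -
    have "lincomb (E \<union> F) (\<lambda>x. if x \<in> E then a x else b x) =
      (\<Sum>x\<in>E. qscale (if x \<in> E then a x else b x) x) + (\<Sum>x\<in>F. qscale (if x \<in> E then a x else b x) x)"
      unfolding lincomb_def by (rule sum.union_disjoint[OF fin disj])
    also have "(\<Sum>x\<in>F. qscale (if x \<in> E then a x else b x) x) = lincomb F b"
      unfolding lincomb_def using disj by (intro sum.cong) auto
    finally show ?thesis by (simp add: lincomb_def)
  qed
  have un': "lincomb (E \<union> F) a = lincomb E a + lincomb F a" for a
    unfolding lincomb_def by (rule sum.union_disjoint[OF fin disj])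
  have basis: "qbasis Z {0} (E \<union> F)"
    unfolding qbasis_def
  proof (intro conjI ballI allI impI)
    fix z assume "z \<in> Z"
    then obtain a where "z - lincomb E a \<in> B" using E by (auto simp: qbasis_def)
    then obtain b where "z - lincomb E a = lincomb F b" using Fspan by blast
    then have "z - lincomb (E \<union> F) (\<lambda>x. if x \<in> E then a x else b x) = 0"
      unfolding un by (simp add: algebra_simps)
    then show "\<exists>a. z - lincomb (E \<union> F) a \<in> {0}" by blast
  next
    fix a e assume a: "lincomb (E \<union> F) a \<in> {0}" and e: "e \<in> E \<union> F"
    then have "lincomb E a = - lincomb F a" unfolding un' by (simp add: eq_neg_iff_add_eq_0)
    moreover have "- lincomb F a \<in> B" using lincomb_in[OF sB(1) sub(2)] sB(1) qvs.subspace_neg by blast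
    ultimately have "\<forall>e\<in>E. a e = 0" using E(1) by (simp add: qbasis_def)
    then have "lincomb E a = 0" by (simp add: lincomb_def)
    then have "lincomb F a \<in> {0}" using a un' by simp
    then show "a e = 0" using F(1) \<open>\<forall>e\<in>E. a e = 0\<close> e unfolding qbasis_def by blast
  qed (use fin sub sB in auto)
  have "\<forall>e\<in>E. \<exists>b. T e - lincomb E (\<lambda>e'. m e' e) = lincomb F b"
    using E(2) Fspan by blast
  then obtain k where k: "\<And>e. e \<in> E \<Longrightarrow> T e - lincomb E (\<lambda>e'. m e' e) = lincomb F (k e)" by metis
  \<comment> \<open>The blocks: \<open>m\<close> and \<open>n\<close> on the diagonal, zero from
    \<open>F\<close> to \<open>E\<close>, and \<open>k\<close> for the components in
    \<open>B\<close> that \<open>m\<close> neglects.\<close>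
  define M where "M = (\<lambda>e' e. if e' \<in> E then (if e \<in> E then m e' e else 0)
      else (if e \<in> E then k e e' else n e' e))"
  have "T e - lincomb (E \<union> F) (\<lambda>e'. M e' e) \<in> {0}" if "e \<in> E \<union> F" for e
  proof (cases "e \<in> E")
    case True
    then have "(\<lambda>e'. M e' e) = (\<lambda>e'. if e' \<in> E then m e' e else k e e')"
      by (auto simp: M_def)
    then show ?thesis
      using k[OF True] un[of "\<lambda>e'. m e' e" "k e"] by (simp add: algebra_simps)
  next
    case False
    then have "(\<lambda>e'. M e' e) = (\<lambda>e'. if e' \<in> E then 0 else n e' e)"
      by (auto simp: M_def)
    moreover have "lincomb E (\<lambda>e'. 0) = 0" by (simp add: lincomb_def)
    ultimately show ?thesis
      using F(2)[of e] that False un[of "\<lambda>e'. 0" "\<lambda>e'. n e' e"] by simp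
  qed
  moreover have "tB + tQ = (\<Sum>e\<in>E \<union> F. M e e)"
  proof -
    have "(\<Sum>e\<in>E \<union> F. M e e) = (\<Sum>e\<in>E. M e e) + (\<Sum>e\<in>F. M e e)"
      by (rule sum.union_disjoint[OF fin disj])
    moreover have "(\<Sum>e\<in>E. M e e) = tQ" unfolding t by (intro sum.cong) (auto simp: M_def)
    moreover have "(\<Sum>e\<in>F. M e e) = tB" unfolding t' using disj by (intro sum.cong) (auto simp: M_def)
    ultimately show ?thesis by simp
  qed
  ultimately show ?thesis using basis unfolding has_qtrace_def by blast
qed

lemma has_qtrace_zero: "has_qtrace {0} {0} T 0"
  unfolding has_qtrace_def
  by (intro exI[of _ "{}"] exI[of _ "\<lambda>_ _. 0"]) (auto simp: qbasis_def lincomb_def)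

section \<open>The Hopf trace formula\<close>

lemma qlinear_on_qmorph:
  assumes f: "qlinear_on Z f" and ZB: "qpair Z B" and "qvs.subspace B'"
    and "\<And>z. z \<in> Z \<Longrightarrow> f z \<in> Z'" "\<And>z. z \<in> B \<Longrightarrow> f z \<in> B'"
  shows "qmorph Z B Z' B' f"
  using assms qvs.subspace_0[of B'] by (auto simp: qmorph_def qlinear_onD[OF f])

text \<open>The trace on the chains in degree \<open>p\<close> is the sum of the traces on the boundaries, on the
  homology and on chains modulo cycles; the last of these is the trace on the boundaries in degree
  \<open>p - 1\<close>. The boundary terms cancel in the alternating sum.\<close>

lemma Hopf_trace:
  fixes C :: "nat \<Rightarrow> 'k qchain set" and d :: "nat \<Rightarrow> 'k qchain \<Rightarrow> 'k qchain"
  defines "Z \<equiv> \<lambda>p. {c \<in> C p. d p c = 0}" and "B \<equiv> \<lambda>p. d (Suc p) ` C (Suc p)"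
  assumes C: "\<And>p. qvs.subspace (C p)" and fin: "\<And>p. finite (F p)" "\<And>p. C p \<subseteq> qvs.span (F p)"
    and d: "\<And>p. qlinear_on (C p) (d p)" "\<And>p c. c \<in> C (Suc p) \<Longrightarrow> d (Suc p) c \<in> C p"
      "\<And>p c. c \<in> C (Suc p) \<Longrightarrow> d p (d (Suc p) c) = 0" "\<And>c. c \<in> C 0 \<Longrightarrow> d 0 c = 0"
    and \<psi>: "\<And>p. qlinear_on (C p) (\<psi> p)" "\<And>p c. c \<in> C p \<Longrightarrow> \<psi> p c \<in> C p"
      "\<And>p c. c \<in> C (Suc p) \<Longrightarrow> \<psi> p (d (Suc p) c) = d (Suc p) (\<psi> (Suc p) c)"
    and zero: "\<And>p. N < p \<Longrightarrow> C p = {0}"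
    and tr: "\<And>p. has_qtrace (C p) {0} (\<psi> p) 0"
  shows "\<exists>h. (\<forall>p. has_qtrace (Z p) (B p) (\<psi> p) (h p)) \<and> (\<forall>p>N. h p = 0) \<and>
    (\<Sum>p\<le>N. (-1) ^ p * h p) = 0"
proof -
  have s0: "qvs.subspace {0 :: 'k qchain}" by (rule qvs.subspace_single_0)
  have d0: "d p 0 = 0" for p using d(1) C qlinear_on_0 qvs.subspace_0 by blast
  have sZ: "qvs.subspace (Z p)" for p
    using C[of p] d(1)[of p] d0[of p] unfolding Z_def qvs.subspace_def by (auto simp: qlinear_onD)
  have sB: "qvs.subspace (B p)" for p
    unfolding qvs.subspace_def
  proof (intro conjI ballI allI)
    have "d (Suc p) 0 \<in> B p" unfolding B_def by (intro imageI qvs.subspace_0 C)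
    then show "0 \<in> B p" by (simp add: d0)
  next
    fix x y assume "x \<in> B p" "y \<in> B p"
    then obtain u v where "u \<in> C (Suc p)" "v \<in> C (Suc p)" "x = d (Suc p) u" "y = d (Suc p) v"
      unfolding B_def by blast
    then show "x + y \<in> B p"
      using imageI[OF qvs.subspace_add[OF C, of u "Suc p" v], of "d (Suc p)"] qlinear_onD(1)[OF d(1)]
      by (simp add: B_def)
  next
    fix r x assume "x \<in> B p"
    then obtain u where "u \<in> C (Suc p)" "x = d (Suc p) u"
      unfolding B_def by blast
    then show "qscale r x \<in> B p"
      using imageI[OF qvs.subspace_scale[OF C, of u "Suc p" r], of "d (Suc p)"] qlinear_onD(2)[OF d(1)]
      by (simp add: B_def)
  qed
  have BZ: "B p \<subseteq> Z p" for p unfolding B_def Z_def using d by auto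
  have ZC: "Z p \<subseteq> C p" for p unfolding Z_def by auto
  have pB0: "qpair (B p) {0}" for p using sB s0 qvs.subspace_0 by (auto simp: qpair_def)
  have pZ0: "qpair (Z p) {0}" for p using sZ s0 qvs.subspace_0 by (auto simp: qpair_def)
  have pC0: "qpair (C p) {0}" for p using C s0 qvs.subspace_0 by (auto simp: qpair_def)
  have pZB: "qpair (Z p) (B p)" for p using sB sZ BZ by (auto simp: qpair_def)
  have pCZ: "qpair (C p) (Z p)" for p using C sZ ZC by (auto simp: qpair_def)
  have \<psi>B: "\<psi> p b \<in> B p" if "b \<in> B p" for p b using that \<psi> unfolding B_def by auto
  have \<psi>Z: "\<psi> p z \<in> Z p" if "z \<in> Z p" for p z
  proof (cases p)
    case 0 then show ?thesis using that \<psi>(2)[of z 0] d(4) unfolding Z_def by auto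
  next
    case (Suc q)
    have z: "z \<in> C (Suc q)" "d (Suc q) z = 0" using that Suc by (auto simp: Z_def)
    have "\<psi> q 0 = 0" using \<psi>(1) C qlinear_on_0 qvs.subspace_0 by blast
    then have "d (Suc q) (\<psi> (Suc q) z) = 0" using \<psi>(3)[OF z(1)] unfolding z(2) by simp
    then show ?thesis using z(1) Suc \<psi>(2)[of z p] unfolding Z_def by auto
  qed
  have \<psi>0: "\<psi> p 0 = 0" for p using \<psi>(1) C qlinear_on_0 qvs.subspace_0 by blast
  have fB: "qfinite (B p) {0}" and fZ: "qfinite (Z p) (B p)" and fC: "qfinite (C p) (Z p)" for p
    using qfinite_sub[OF pB0 _ fin(1)[of p]] qfinite_sub[OF pZB _ fin(1)[of p]]
      qfinite_sub[OF pCZ _ fin(1)[of p]] fin(2)[of p] BZ[of p] ZC[of p] by auto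
  have "\<exists>t. has_qtrace (B p) {0} (\<psi> p) t" for p
    using fB[of p] has_qtrace_exists[of "B p" "{0}" _ "\<psi> p"] \<psi>B unfolding qfinite_def by blast
  then obtain b where b: "\<And>p. has_qtrace (B p) {0} (\<psi> p) (b p)" by metis
  have "\<exists>t. has_qtrace (Z p) (B p) (\<psi> p) t" for p
    using fZ[of p] has_qtrace_exists[of "Z p" "B p" _ "\<psi> p"] \<psi>Z unfolding qfinite_def by blast
  then obtain h where h: "\<And>p. has_qtrace (Z p) (B p) (\<psi> p) (h p)" by metis
  have "\<exists>t. has_qtrace (C p) (Z p) (\<psi> p) t" for p
    using fC[of p] has_qtrace_exists[of "C p" "Z p" _ "\<psi> p"] \<psi>(2) unfolding qfinite_def by blast
  then obtain q where q: "\<And>p. has_qtrace (C p) (Z p) (\<psi> p) (q p)" by metis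
  have lB: "qlinear_on (B p) (\<psi> p)" and lZ: "qlinear_on (Z p) (\<psi> p)" for p
    using qlinear_on_sub[OF \<psi>(1)] BZ[of p] ZC[of p] by blast+
  \<comment> \<open>The filtration of the chains by boundaries and cycles splits the zero trace on
    chains into three summands.\<close>
  have sum0: "b p + h p + q p = 0" for p
  proof (rule has_qtrace_unique[OF pC0])
    show "qmorph (C p) {0} (C p) {0} (\<psi> p)"
      using \<psi>0 \<psi>(2) by (intro qlinear_on_qmorph[OF \<psi>(1) pC0 s0]) auto
    show "has_qtrace (C p) {0} (\<psi> p) (b p + h p + q p)"
      by (intro has_qtrace_additive[OF pCZ _ _ q] has_qtrace_additive[OF pZB _ b h] \<psi>B \<psi>Z)
  qed (rule tr)
  \<comment> \<open>The boundary map identifies chains modulo cycles with boundaries one degree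
    lower. With \<open>R\<close> the boundary and \<open>P\<close> a choice \<open>s\<close> of
    preimages after \<open>\<psi> p\<close>, both composites are induced by \<open>\<psi>\<close>.
    The choice is linear only modulo cycles, which is all that \<open>qmorph\<close> asks.\<close>
  have q_Suc: "q (Suc p) = b p" for p
  proof -
    define s where "s = (\<lambda>x. SOME c. c \<in> C (Suc p) \<and> d (Suc p) c = x)"
    have s: "s x \<in> C (Suc p)" "d (Suc p) (s x) = x" if "x \<in> B p" for x
      using someI_ex[of "\<lambda>c. c \<in> C (Suc p) \<and> d (Suc p) c = x"] that unfolding s_def B_def by auto
    have dd: "d (Suc p) x - d (Suc p) y = d (Suc p) (x - y)" if "x \<in> C (Suc p)" "y \<in> C (Suc p)" for x y
      using qlinear_on_diff[OF d(1) that C] by simp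
    have sub: "x - y \<in> Z (Suc p)" if "x \<in> C (Suc p)" "y \<in> C (Suc p)" "d (Suc p) x = d (Suc p) y" for x y
      using dd[OF that(1,2)] that qvs.subspace_diff[OF C] unfolding Z_def by auto
    have "qmorph (C (Suc p)) (Z (Suc p)) (B p) {0} (d (Suc p))"
      by (intro qlinear_on_qmorph[OF d(1) pCZ s0]) (auto simp: B_def Z_def)
    moreover have "qmorph (B p) {0} (C (Suc p)) (Z (Suc p)) (\<lambda>x. s (\<psi> p x))"
      unfolding qmorph_def
    proof (intro conjI ballI allI)
      fix x assume x: "x \<in> B p"
      then show "s (\<psi> p x) \<in> C (Suc p)" using s \<psi>B by auto
      fix r
      have "qscale r x \<in> B p" "qscale r (\<psi> p x) \<in> B p"
        using x \<psi>B sB qvs.subspace_scale by blast+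
      then show "s (\<psi> p (qscale r x)) - qscale r (s (\<psi> p x)) \<in> Z (Suc p)"
        using x by (intro sub) (auto simp: s \<psi>B qvs.subspace_scale[OF C] qlinear_onD[OF d(1)] qlinear_onD[OF lB])
      fix y assume y: "y \<in> B p"
      have "x + y \<in> B p" "\<psi> p x + \<psi> p y \<in> B p"
        using x y \<psi>B sB qvs.subspace_add by blast+
      then show "s (\<psi> p (x + y)) - (s (\<psi> p x) + s (\<psi> p y)) \<in> Z (Suc p)"
        using x y by (intro sub) (auto simp: s \<psi>B qvs.subspace_add[OF C] qlinear_onD[OF d(1)] qlinear_onD[OF lB])
    next
      fix x :: "'k qchain" assume "x \<in> {0}"
      then show "s (\<psi> p x) \<in> Z (Suc p)"
        using s[of 0] sB[of p] qvs.subspace_0 by (auto simp: Z_def \<psi>0)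
    qed
    ultimately show ?thesis
    proof (rule qtrace_comm[OF pCZ pB0 _ _ q b])
      fix z assume z: "z \<in> C (Suc p)"
      then have "d (Suc p) z \<in> B p" "d (Suc p) (\<psi> (Suc p) z) \<in> B p"
        using \<psi>(2) by (auto simp: B_def)
      then show "\<psi> (Suc p) z - s (\<psi> p (d (Suc p) z)) \<in> Z (Suc p)"
        using z by (intro sub) (auto simp: s \<psi>B \<psi>)
    next
      fix z assume "z \<in> B p"
      then show "\<psi> p z - d (Suc p) (s (\<psi> p z)) \<in> {0}" by (simp add: s \<psi>B)
    qed
  qed
  \<comment> \<open>In degree 0 every chain is a cycle, so the quotient is zero and the empty basis
    serves.\<close>
  have q0: "q 0 = 0"
  proof -
    have eq: "Z 0 = C 0" using d(4) by (auto simp: Z_def)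
    have "has_qtrace (C 0) (Z 0) (\<psi> 0) 0"
      unfolding has_qtrace_def eq
      by (intro exI[of _ "{}"] exI[of _ "\<lambda>_ _. 0"]) (auto simp: qbasis_def lincomb_def)
    then show ?thesis
      using has_qtrace_unique[OF pCZ _ q] qlinear_on_qmorph[OF \<psi>(1) pCZ sZ \<psi>(2) \<psi>Z] by blast
  qed
  have b0: "b p = 0" if "N \<le> p" for p
  proof -
    have "B p = {0}" using zero[of "Suc p"] that d0 by (simp add: B_def)
    then have z: "has_qtrace (B p) {0} (\<psi> p) 0" by (simp add: has_qtrace_zero)
    have "qmorph (B p) {0} (B p) {0} (\<psi> p)"
      by (rule qlinear_on_qmorph[OF lB pB0 s0 \<psi>B]) (simp_all add: \<psi>0)
    from has_qtrace_unique[OF pB0 this b z] show ?thesis .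
  qed
  \<comment> \<open>The sum telescopes: after degree \<open>n\<close> only the trace on the
    boundaries in degree \<open>n\<close> is left, and it vanishes for \<open>n = N\<close>.\<close>
  have "(\<Sum>p\<le>n. (-1) ^ p * h p) = - ((-1) ^ n * b n)" for n
  proof (induction n)
    case 0 then show ?case using sum0[of 0] q0 by (simp add: algebra_simps eq_neg_iff_add_eq_0)
  next
    case (Suc n)
    have h_Suc: "h (Suc n) = - b (Suc n) - b n" using sum0[of "Suc n"] q_Suc[of n] by (simp add: algebra_simps)
    show ?case unfolding sum.atMost_Suc Suc h_Suc by (simp add: algebra_simps)
  qed
  moreover have "h p = 0" if p: "N < p" for p
  proof -
    obtain r where "p = Suc r" "N \<le> r" using p by (cases p) auto
    then show ?thesis using sum0[of p] q_Suc[of r] b0 p by simp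
  qed
  ultimately show ?thesis using h b0[of N] by (intro exI[of _ h]) auto
qed

section \<open>Traces on homology\<close>

lemma in_coset: "x \<in> coset B z \<longleftrightarrow> x - z \<in> B"
  unfolding coset_def by (metis (no_types, lifting) add_diff_cancel_left' diff_add_cancel imageE image_eqI add.commute)

lemma coset_eq: "qvs.subspace B \<Longrightarrow> coset B x = coset B y \<longleftrightarrow> x - y \<in> B"
  unfolding set_eq_iff in_coset
  by (metis cong_sym cong_trans diff_self qvs.subspace_0)

lemma coset_0 [simp]: "coset B 0 = B"
  by (auto simp: coset_def)

abbreviation "quot Z B \<equiv> quotient_space (qscale :: rat \<Rightarrow> 'k qchain \<Rightarrow> 'k qchain) Z B"

lemma carrier_quot [simp]: "carrier (quot Z B) = coset B ` Z"
  by (simp add: quotient_space_def)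

lemma zero_quot [simp]: "zero (quot Z B) = B"
  by (simp add: quotient_space_def)

lemma add_quot:
  assumes B: "qvs.subspace B"
  shows "add (quot Z B) (coset B x) (coset B y) = coset B (x + y)"
proof -
  have "{a + a' |a a'. a \<in> coset B x \<and> a' \<in> coset B y} = coset B (x + y)"
  proof (rule equalityI; rule subsetI)
    fix w assume "w \<in> {a + a' |a a'. a \<in> coset B x \<and> a' \<in> coset B y}"
    then show "w \<in> coset B (x + y)" using cong_add[OF B] by (auto simp: in_coset)
  next
    fix w assume "w \<in> coset B (x + y)"
    then have "w - y \<in> coset B x" "y \<in> coset B y" "w = (w - y) + y"
      using qvs.subspace_0[OF B] by (auto simp: in_coset algebra_simps)
    then show "w \<in> {a + a' |a a'. a \<in> coset B x \<and> a' \<in> coset B y}" by blast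
  qed
  then show ?thesis by (simp add: quotient_space_def)
qed

lemma smult_quot:
  assumes B: "qvs.subspace B"
  shows "smult (quot Z B) r (coset B x) = coset B (qscale r x)"
proof -
  have "coset B (qscale r a) = coset B (qscale r x)" if "a \<in> coset B x" for a
    using that coset_eq[OF B] cong_scale[OF B] by (simp add: in_coset)
  moreover have "x \<in> coset B x" using qvs.subspace_0[OF B] by (simp add: in_coset)
  ultimately have "(\<Union>a\<in>coset B x. coset B (qscale r a)) = coset B (qscale r x)" by blast
  then show ?thesis by (simp add: quotient_space_def)
qed

lemma module_quot:
  assumes ZB: "qpair Z B"
  shows "Module.module (class_ring :: rat ring) (quot Z B)"
proof (rule moduleI)
  have Z: "qvs.subspace Z" and B: "qvs.subspace B" and sub: "B \<subseteq> Z" using ZB by (auto simp: qpair_def)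
  note s = add_quot[OF B] smult_quot[OF B]
  show "cring (class_ring :: rat ring)" by (rule class_cring.cring_axioms)
  show "abelian_group (quot Z B)"
  proof (rule abelian_groupI)
    fix x assume "x \<in> carrier (quot Z B)"
    then obtain z where z: "z \<in> Z" "x = coset B z" by auto
    show "add (quot Z B) (zero (quot Z B)) x = x"
      using s(1)[of Z 0 z] z by simp
    show "\<exists>y\<in>carrier (quot Z B). add (quot Z B) y x = zero (quot Z B)"
      using s(1)[of Z "- z" z] z qvs.subspace_neg[OF Z] by auto
  next
    show "zero (quot Z B) \<in> carrier (quot Z B)"
      using imageI[OF qvs.subspace_0[OF Z], of "coset B"] by simp
  qed (use Z in \<open>auto simp: s qvs.subspace_add algebra_simps\<close>)
qed (use assms in \<open>auto simp: add_quot smult_quot qpair_def qvs.subspace_scale qvs.scale_left_distrib qvs.scale_right_distrib\<close>)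

lemma vectorspace_quot: "qpair Z B \<Longrightarrow> vectorspace (class_ring :: rat ring) (quot Z B)"
  by (intro vectorspace.intro module_quot class_field.field_axioms)

lemma finsum_quot:
  assumes ZB: "qpair Z B" and "finite E" "E \<subseteq> Z" "inj_on (coset B) E"
  shows "finsum (quot Z B) (\<lambda>b. smult (quot Z B) (f b) b) (coset B ` E)
    = coset B (lincomb E (\<lambda>e. f (coset B e)))"
proof -
  have Z: "qvs.subspace Z" and B: "qvs.subspace B" using ZB by (auto simp: qpair_def)
  interpret M: Module.module "class_ring :: rat ring" "quot Z B" by (rule module_quot[OF ZB])
  show ?thesis
    using assms(2-)
  proof (induction E)
    case empty then show ?case by (simp add: lincomb_def M.finsum_empty)
  next
    case (insert e E)
    have "finsum (quot Z B) (\<lambda>b. smult (quot Z B) (f b) b) (insert (coset B e) (coset B ` E))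
      = add (quot Z B) (smult (quot Z B) (f (coset B e)) (coset B e))
          (finsum (quot Z B) (\<lambda>b. smult (quot Z B) (f b) b) (coset B ` E))"
      using insert Z by (intro M.finsum_insert) (auto simp: smult_quot[OF B] qvs.subspace_scale inj_on_def)
    then show ?case
      using insert by (simp add: smult_quot[OF B] add_quot[OF B] lincomb_def)
  qed
qed

lemma qbasis_inj:
  assumes "qbasis Z B E" "qvs.subspace B" shows "inj_on (coset B) E"
proof (rule inj_onI, rule ccontr)
  fix x y assume xy: "x \<in> E" "y \<in> E" "coset B x = coset B y" "x \<noteq> y"
  have fin: "finite E" using assms by (simp add: qbasis_def)
  have d: "lincomb E (\<lambda>e. if e = z then 1 else 0) = z" if "z \<in> E" for z
    using that fin by (subst lincomb_remove[of _ z]) (auto simp: lincomb_def)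
  define g where "g = (\<lambda>e. (if e = x then 1 else 0) - (if e = y then 1 else (0::rat)))"
  have "lincomb E g = x - y"
    unfolding g_def lincomb_diff[symmetric] using d xy by simp
  then have "lincomb E g \<in> B" using xy(3) coset_eq[OF assms(2)] by simp
  then have "g x = 0" using xy(1) assms(1) by (simp add: qbasis_def)
  then show False using xy by (simp add: g_def)
qed

text \<open>Translates bases of the abstract quotient module into statements on representatives.
  Injectivity on \<open>E\<close> lets coefficient functions on classes and on representatives be
  exchanged by \<open>inv_into\<close>.\<close>

lemma basis_quot_iff:
  assumes ZB: "qpair Z B" and E: "finite E" "E \<subseteq> Z" "inj_on (coset B) E"
  shows "vectorspace.basis (class_ring :: rat ring) (quot Z B) (coset B ` E) \<longleftrightarrow> qbasis Z B E"
proof -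
  have Z: "qvs.subspace Z" and B: "qvs.subspace B" and BZ: "B \<subseteq> Z" using ZB by (auto simp: qpair_def)
  interpret V: vectorspace "class_ring :: rat ring" "quot Z B" by (rule vectorspace_quot[OF ZB])
  let ?inv = "inv_into E (coset B)"
  have lc: "V.lincomb f (coset B ` E) = coset B (lincomb E (\<lambda>e. f (coset B e)))" for f
    unfolding V.lincomb_def by (rule finsum_quot[OF ZB E])
  have lc': "coset B (lincomb E a) = V.lincomb (\<lambda>b. a (?inv b)) (coset B ` E)" for a
    unfolding lc lincomb_def using E by (intro arg_cong[where f = "coset B"] sum.cong) auto
  have sub: "coset B ` E \<subseteq> carrier (quot Z B)" using E by auto
  have inB: "x \<in> B \<longleftrightarrow> coset B x = B" for x using coset_eq[OF B, of x 0] by simp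
  have span: "V.span (coset B ` E) = carrier (quot Z B) \<longleftrightarrow> (\<forall>z\<in>Z. \<exists>a. z - lincomb E a \<in> B)"
  proof
    assume sp: "V.span (coset B ` E) = carrier (quot Z B)"
    show "\<forall>z\<in>Z. \<exists>a. z - lincomb E a \<in> B"
    proof
      fix z assume "z \<in> Z"
      then have "coset B z \<in> V.span (coset B ` E)" using sp by auto
      then obtain f where "coset B z = V.lincomb f (coset B ` E)"
        using V.finite_span[OF _ sub] E by auto
      then show "\<exists>a. z - lincomb E a \<in> B" unfolding lc coset_eq[OF B] by blast
    qed
  next
    assume r: "\<forall>z\<in>Z. \<exists>a. z - lincomb E a \<in> B"
    show "V.span (coset B ` E) = carrier (quot Z B)"
    proof
      show "V.span (coset B ` E) \<subseteq> carrier (quot Z B)"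
        using V.finite_span[OF _ sub] E lincomb_in[OF Z E(2)] by (auto simp: lc)
      show "carrier (quot Z B) \<subseteq> V.span (coset B ` E)"
      proof
        fix x assume "x \<in> carrier (quot Z B)"
        then obtain z where z: "z \<in> Z" "x = coset B z" by auto
        then obtain a where "z - lincomb E a \<in> B" using r by blast
        then have "x = V.lincomb (\<lambda>b. a (?inv b)) (coset B ` E)"
          using z coset_eq[OF B] by (simp flip: lc')
        then show "x \<in> V.span (coset B ` E)"
          using V.finite_span[OF _ sub] E by auto
      qed
    qed
  qed
  have li: "\<not> V.lin_dep (coset B ` E) \<longleftrightarrow> (\<forall>a. lincomb E a \<in> B \<longrightarrow> (\<forall>e\<in>E. a e = 0))"
  proof
    assume L: "\<not> V.lin_dep (coset B ` E)"
    show "\<forall>a. lincomb E a \<in> B \<longrightarrow> (\<forall>e\<in>E. a e = 0)"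
    proof (intro allI impI ballI, rule ccontr)
      fix a e assume a: "lincomb E a \<in> B" and e: "e \<in> E" "a e \<noteq> 0"
      have "V.lincomb (\<lambda>b. a (?inv b)) (coset B ` E) = zero (quot Z B)"
        using a inB lc' by simp
      then have "V.lin_dep (coset B ` E)"
        using E e by (intro V.lin_dep_crit[of "coset B ` E" _ "\<lambda>b. a (?inv b)" "coset B e"]) auto
      then show False using L by simp
    qed
  next
    assume r: "\<forall>a. lincomb E a \<in> B \<longrightarrow> (\<forall>e\<in>E. a e = 0)"
    show "\<not> V.lin_dep (coset B ` E)"
    proof
      assume "V.lin_dep (coset B ` E)"
      then obtain f v where f: "V.lincomb f (coset B ` E) = zero (quot Z B)" "v \<in> coset B ` E" "f v \<noteq> 0"
        using V.finite_lin_dep[OF _ _ sub] E by auto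
      have "lincomb E (\<lambda>e. f (coset B e)) \<in> B" using f(1) inB by (simp add: lc)
      then show False using r f by auto
    qed
  qed
  show ?thesis
    unfolding V.basis_def using li span sub E by (auto simp: qbasis_def)
qed

text \<open>The definite description in \<open>trace_fin_dim\<close> ranges over all finite bases of
  the quotient. Each of them lifts to representatives, so every admissible value is a
  \<open>has_qtrace\<close> value, and these coincide.\<close>

lemma trace_fin_dim_quot:
  assumes ZB: "qpair Z B" and f: "qmorph Z B Z B f" and T: "\<And>z. z \<in> Z \<Longrightarrow> T (coset B z) = coset B (f z)"
    and t: "has_qtrace Z B f t"
  shows "trace_fin_dim (quot Z B) T = t"
  unfolding trace_fin_dim_def
proof (rule the_equality)
  have B: "qvs.subspace B" using ZB by (auto simp: qpair_def)
  obtain E m where E: "qbasis Z B E" "\<And>e. e \<in> E \<Longrightarrow> f e - lincomb E (\<lambda>e'. m e' e) \<in> B"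
    and t_eq: "t = (\<Sum>e\<in>E. m e e)" using t by (auto simp: has_qtrace_def)
  have E': "finite E" "E \<subseteq> Z" "inj_on (coset B) E" using E(1) qbasis_inj[OF E(1) B] by (auto simp: qbasis_def)
  let ?inv = "inv_into E (coset B)"
  show "\<exists>Ba m. finite Ba \<and> vectorspace.basis (class_ring :: rat ring) (quot Z B) Ba \<and>
      (\<forall>b\<in>Ba. T b = finsum (quot Z B) (\<lambda>b'. smult (quot Z B) (m b' b) b') Ba) \<and> t = (\<Sum>b\<in>Ba. m b b)"
  proof (intro exI[of _ "coset B ` E"] exI[of _ "\<lambda>b' b. m (?inv b') (?inv b)"] conjI ballI)
    show "vectorspace.basis (class_ring :: rat ring) (quot Z B) (coset B ` E)"
      using basis_quot_iff[OF ZB E'] E by simp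
    fix b assume "b \<in> coset B ` E"
    then obtain e where e: "e \<in> E" "b = coset B e" by auto
    have "lincomb E (\<lambda>x. m (?inv (coset B x)) (?inv (coset B e))) = lincomb E (\<lambda>x. m x e)"
      unfolding lincomb_def using E' e by (intro sum.cong) auto
    then show "T b = finsum (quot Z B) (\<lambda>b'. smult (quot Z B) (m (?inv b') (?inv b)) b') (coset B ` E)"
      unfolding finsum_quot[OF ZB E'] e(2) using T[of e] E' e(1) E(2)[OF e(1)] coset_eq[OF B] by (simp add: subset_iff)
  qed (use E' in \<open>auto simp: t_eq sum.reindex\<close>)
  fix s
  assume "\<exists>Ba m. finite Ba \<and> vectorspace.basis (class_ring :: rat ring) (quot Z B) Ba \<and>
      (\<forall>b\<in>Ba. T b = finsum (quot Z B) (\<lambda>b'. smult (quot Z B) (m b' b) b') Ba) \<and> s = (\<Sum>b\<in>Ba. m b b)"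
  then obtain Ba n where Ba: "finite Ba" "vectorspace.basis (class_ring :: rat ring) (quot Z B) Ba"
     "\<And>b. b \<in> Ba \<Longrightarrow> T b = finsum (quot Z B) (\<lambda>b'. smult (quot Z B) (n b' b) b') Ba"
     "s = (\<Sum>b\<in>Ba. n b b)" by auto
  have "Ba \<subseteq> coset B ` Z"
    using Ba(2) vectorspace.basis_def[OF vectorspace_quot[OF ZB]] by auto
  then obtain F where F: "F \<subseteq> Z" "inj_on (coset B) F" "Ba = coset B ` F"
    using subset_image_inj by metis
  have finF: "finite F" using Ba(1) F by (metis finite_imageD)
  have "qbasis Z B F" using basis_quot_iff[OF ZB finF F(1,2)] Ba(2) F by simp
  moreover have "f e - lincomb F (\<lambda>x. n (coset B x) (coset B e)) \<in> B" if "e \<in> F" for e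
  proof -
    have "coset B (f e) = coset B (lincomb F (\<lambda>x. n (coset B x) (coset B e)))"
      using Ba(3)[of "coset B e"] T[of e] that F finsum_quot[OF ZB finF F(1,2), of "\<lambda>b'. n b' (coset B e)"]
      by auto
    then show ?thesis using coset_eq[OF B] by simp
  qed
  moreover have "s = (\<Sum>e\<in>F. n (coset B e) (coset B e))" using Ba(4) F by (simp add: sum.reindex)
  ultimately have "has_qtrace Z B f s"
    unfolding has_qtrace_def by (intro exI[of _ F] exI[of _ "\<lambda>x e. n (coset B x) (coset B e)"]) auto
  then show "s = t" using has_qtrace_unique[OF ZB f _ t] by simp
qed

section \<open>Traces of maps that factor through a finite-dimensional space\<close>

lemma qmorph_restrict:
  assumes "qmorph Z B Z' B' g" "A \<subseteq> Z" "\<And>z. z \<in> A \<Longrightarrow> g z \<in> A'"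
  shows "qmorph A B A' B' g"
  using assms unfolding qmorph_def by (meson subsetD)

lemma qpair_image:
  assumes g: "qmorph Z1 B1 Z2 B2 g" and 1: "qpair Z1 B1" and 2: "qpair Z2 B2"
  shows "qpair {w \<in> Z2. \<exists>z\<in>Z1. w - g z \<in> B2} B2"
proof -
  have s: "qvs.subspace Z1" "qvs.subspace B1" "B1 \<subseteq> Z1" "qvs.subspace Z2" "qvs.subspace B2" "B2 \<subseteq> Z2"
    using 1 2 by (auto simp: qpair_def)
  have "qvs.subspace {w \<in> Z2. \<exists>z\<in>Z1. w - g z \<in> B2}"
    unfolding qvs.subspace_def
  proof (intro conjI ballI allI)
    have "g 0 \<in> B2" using qmorphD(4)[OF g] qvs.subspace_0[OF s(2)] by blast
    then have "0 - g 0 \<in> B2" using qvs.subspace_neg[OF s(5)] by simp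
    then show "0 \<in> {w \<in> Z2. \<exists>z\<in>Z1. w - g z \<in> B2}"
      using qvs.subspace_0[OF s(1)] qvs.subspace_0[OF s(4)] by blast
  next
    fix x y assume "x \<in> {w \<in> Z2. \<exists>z\<in>Z1. w - g z \<in> B2}" "y \<in> {w \<in> Z2. \<exists>z\<in>Z1. w - g z \<in> B2}"
    then obtain u v where "x \<in> Z2" "y \<in> Z2" "u \<in> Z1" "v \<in> Z1" "x - g u \<in> B2" "y - g v \<in> B2" by auto
    moreover from this have "(x + y) - g (u + v) \<in> B2"
      using cong_trans[OF s(5) cong_add[OF s(5)] cong_sym[OF s(5) qmorphD(2)[OF g]]] by blast
    ultimately show "x + y \<in> {w \<in> Z2. \<exists>z\<in>Z1. w - g z \<in> B2}"
      using qvs.subspace_add[OF s(1)] qvs.subspace_add[OF s(4)] by blast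
  next
    fix r x assume "x \<in> {w \<in> Z2. \<exists>z\<in>Z1. w - g z \<in> B2}"
    then obtain u where "x \<in> Z2" "u \<in> Z1" "x - g u \<in> B2" by auto
    moreover from this have "qscale r x - g (qscale r u) \<in> B2"
      using cong_trans[OF s(5) cong_scale[OF s(5)] cong_sym[OF s(5) qmorphD(3)[OF g]]] by blast
    ultimately show "qscale r x \<in> {w \<in> Z2. \<exists>z\<in>Z1. w - g z \<in> B2}"
      using qvs.subspace_scale[OF s(1)] qvs.subspace_scale[OF s(4)] by blast
  qed
  moreover have "B2 \<subseteq> {w \<in> Z2. \<exists>z\<in>Z1. w - g z \<in> B2}"
  proof
    fix b assume b: "b \<in> B2"
    have "g 0 \<in> B2" using qmorphD(4)[OF g] qvs.subspace_0[OF s(2)] by blast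
    then have "b - g 0 \<in> B2" using b qvs.subspace_diff[OF s(5)] by blast
    then show "b \<in> {w \<in> Z2. \<exists>z\<in>Z1. w - g z \<in> B2}"
      using b s qvs.subspace_0[OF s(1)] by blast
  qed
  ultimately show ?thesis using s by (simp add: qpair_def)
qed

text \<open>\<open>Z / B\<close> may have infinite dimension, but the induced map factors through
  the finite-dimensional \<open>Z' / B'\<close>. The trace on the image of
  \<open>P \<circ> R\<close> equals that of \<open>f\<close> on the image of \<open>R\<close>, and
  this is the full trace of \<open>f\<close>, whose values lie in that image. Both equalities are
  cases of tr(PR) = tr(RP).\<close>

lemma trace_fin_rank_factor:
  assumes ZB: "qpair Z B" and ZB': "qpair Z' B'"
    and R: "qmorph Z B Z' B' R" and P: "qmorph Z' B' Z B P"
    and T: "\<And>z. z \<in> Z \<Longrightarrow> T (coset B z) = coset B (P (R z))"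
    and f: "qmorph Z' B' Z' B' f" "\<And>z. z \<in> Z' \<Longrightarrow> f z - R (P z) \<in> B'"
    and t: "has_qtrace Z' B' f t" and span: "Z' \<subseteq> qvs.span F" and "finite F"
  shows "trace_fin_rank (quot Z B) T = t"
proof -
  have sub: "qvs.subspace Z" "qvs.subspace B" "B \<subseteq> Z" "qvs.subspace Z'" "qvs.subspace B'" "B' \<subseteq> Z'"
    using ZB ZB' by (auto simp: qpair_def)
  \<comment> \<open>Representatives of the images of \<open>R\<close> and of
    \<open>P \<circ> R\<close>; the latter give the space on which \<open>trace_fin_rank\<close>
    takes the trace.\<close>
  define W where "W = {w \<in> Z'. \<exists>z\<in>Z. w - R z \<in> B'}"
  define Y where "Y = {y \<in> Z. \<exists>z\<in>Z. y - P (R z) \<in> B}"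
  have PR: "qmorph Z B Z B (\<lambda>z. P (R z))"
    unfolding qmorph_def
  proof (intro conjI ballI allI)
    fix x assume x: "x \<in> Z"
    then show "P (R x) \<in> Z" using qmorphD(1)[OF R] qmorphD(1)[OF P] by blast
    fix y assume y: "y \<in> Z"
    have "P (R (x + y)) - P (R x + R y) \<in> B"
      using qmorphD[OF R] x y sub by (intro qmorph_cong[OF P ZB']) (auto intro: qvs.subspace_add)
    then show "P (R (x + y)) - (P (R x) + P (R y)) \<in> B"
      using qmorphD(2)[OF P, of "R x" "R y"] qmorphD(1)[OF R] x y cong_trans[OF sub(2)] by blast
  next
    fix r x assume x: "x \<in> Z"
    have "P (R (qscale r x)) - P (qscale r (R x)) \<in> B"
      using qmorphD[OF R] x sub by (intro qmorph_cong[OF P ZB']) (auto intro: qvs.subspace_scale)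
    then show "P (R (qscale r x)) - qscale r (P (R x)) \<in> B"
      using qmorphD(3)[OF P, of "R x"] qmorphD(1)[OF R] x cong_trans[OF sub(2)] by blast
  qed (use qmorphD(4)[OF R] qmorphD(4)[OF P] in auto)
  have pW: "qpair W B'" unfolding W_def by (rule qpair_image[OF R ZB ZB'])
  have pY: "qpair Y B" unfolding Y_def by (rule qpair_image[OF PR ZB ZB])
  have WZ: "W \<subseteq> Z'" and YZ: "Y \<subseteq> Z" by (auto simp: W_def Y_def)
  have R_W: "R z \<in> W" if "z \<in> Z" for z
    using that qmorphD(1)[OF R that] qvs.subspace_0[OF sub(5)]
    unfolding W_def by (auto intro!: bexI[of _ z])
  have P_Y: "P w \<in> Y" if w: "w \<in> W" for w
  proof -
    obtain z where "z \<in> Z" "w \<in> Z'" "w - R z \<in> B'" using w by (auto simp: W_def)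
    then show ?thesis
      using qmorph_cong[OF P ZB' sub(2), of w "R z"] qmorphD(1)[OF R] qmorphD(1)[OF P]
      by (auto simp: Y_def)
  qed
  have f_W: "f z \<in> W" if z: "z \<in> Z'" for z
    using z f qmorphD(1)[OF P] qmorphD(1)[OF f(1)] by (auto simp: W_def)
  have fin_W: "qfinite W B'"
    using qfinite_sub[OF pW _ \<open>finite F\<close>] WZ span by blast
  then obtain E where E: "qbasis W B' E" by (auto simp: qfinite_def)
  have PE: "P ` E \<subseteq> Y" using E P_Y by (auto simp: qbasis_def)
  have finE: "finite E" and EW: "E \<subseteq> W" using E by (auto simp: qbasis_def)
  have EZ: "E \<subseteq> Z'" using EW WZ by blast
  \<comment> \<open>A basis of the image of \<open>R\<close> is carried by \<open>P\<close> to a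
    spanning set of the image of \<open>P \<circ> R\<close>, which therefore has a finite
    basis.\<close>
  have "\<exists>a. y - lincomb (P ` E) a \<in> B" if y: "y \<in> Y" for y
  proof -
    obtain z where z: "z \<in> Z" "y - P (R z) \<in> B" using y by (auto simp: Y_def)
    obtain a where a: "R z - lincomb E a \<in> B'" using E R_W[OF z(1)] by (auto simp: qbasis_def)
    have "P (R z) - P (lincomb E a) \<in> B"
      by (intro qmorph_cong[OF P ZB' sub(2)] a lincomb_in sub EZ qmorphD(1)[OF R] z)
    then have "y - (\<Sum>e\<in>E. qscale (a e) (P e)) \<in> B"
      using qmorph_lincomb[OF P ZB' sub(2) EZ, of a] z cong_trans[OF sub(2)] by blast
    also have "(\<Sum>e\<in>E. qscale (a e) (P e))
        = (\<Sum>x\<in>P ` E. \<Sum>e | e \<in> E \<and> P e = x. qscale (a e) (P e))"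
      by (rule sum.image_gen[OF finE])
    also have "\<dots> = lincomb (P ` E) (\<lambda>x. \<Sum>e | e \<in> E \<and> P e = x. a e)"
      unfolding lincomb_def qvs.scale_sum_left by (intro sum.cong) auto
    finally show ?thesis by blast
  qed
  then obtain G where G: "qbasis Y B G"
    using qbasis_exists[OF pY _ PE] finE by blast
  have RY: "qmorph Y B W B' R" using R_W YZ by (intro qmorph_restrict[OF R]) auto
  have PW: "qmorph W B' Y B P" using P_Y WZ by (intro qmorph_restrict[OF P]) auto
  have PRY: "qmorph Y B Y B (\<lambda>z. P (R z))"
    using P_Y R_W YZ by (intro qmorph_restrict[OF PR]) auto
  have fW: "qmorph W B' W B' f" and fZW: "qmorph Z' B' W B' f"
    using f_W WZ by (auto intro!: qmorph_restrict[OF f(1)])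
  obtain tY where tY: "has_qtrace Y B (\<lambda>z. P (R z)) tY"
    using has_qtrace_exists[OF G qmorphD(1)[OF PRY]] ..
  obtain tW where tW: "has_qtrace W B' f tW"
    using has_qtrace_exists[OF E qmorphD(1)[OF fW]] ..
  have 1: "tY = tW"
    by (rule qtrace_comm[OF pY pW RY PW tY tW])
      (use f(2) WZ qvs.subspace_0[OF sub(2)] in auto)
  have 2: "tW = t"
    by (rule qtrace_comm[OF pW ZB' qmorph_id[OF pW ZB' WZ] fZW tW t])
      (use qvs.subspace_0[OF sub(5)] in auto)
  have "T ` carrier (quot Z B) = coset B ` Y"
  proof
    have "P (R z) \<in> Y" if "z \<in> Z" for z using P_Y R_W that by blast
    then show "T ` carrier (quot Z B) \<subseteq> coset B ` Y"
      using T by auto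
    show "coset B ` Y \<subseteq> T ` carrier (quot Z B)"
    proof
      fix x assume "x \<in> coset B ` Y"
      then obtain y z where "x = coset B y" "z \<in> Z" "y - P (R z) \<in> B" by (auto simp: Y_def)
      then have "x = T (coset B z)" using T coset_eq[OF sub(2)] by simp
      then show "x \<in> T ` carrier (quot Z B)" using \<open>z \<in> Z\<close> by auto
    qed
  qed
  then have "quot Z B\<lparr>carrier := T ` carrier (quot Z B)\<rparr> = quot Y B"
    by (simp add: quotient_space_def)
  then have "trace_fin_rank (quot Z B) T = trace_fin_dim (quot Y B) T"
    by (simp add: trace_fin_rank_def)
  also have "\<dots> = tY"
    by (rule trace_fin_dim_quot[OF pY PRY _ tY]) (rule T, use YZ in blast)
  finally show ?thesis using 1 2 by simp
qed

section \<open>Rational singular chains and subdivision\<close>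

text \<open>Subdivision and its chain homotopies are available for integral chains; this embedding
  transports them to rational coefficients.\<close>

definition to_rat :: "('a \<Rightarrow>\<^sub>0 int) \<Rightarrow> 'a qchain" where
  "to_rat c = Poly_Mapping.map of_int c"

lemma lookup_to_rat [simp]: "Poly_Mapping.lookup (to_rat c) x = of_int (Poly_Mapping.lookup c x)"
  unfolding to_rat_def by transfer (simp add: when_def)

lemma keys_to_rat [simp]: "Poly_Mapping.keys (to_rat c) = Poly_Mapping.keys c"
  by (auto simp: in_keys_iff)

lemma to_rat_0 [simp]: "to_rat 0 = 0" by (rule poly_mapping_eqI) simp
lemma to_rat_diff: "to_rat (a - b) = to_rat a - to_rat b" by (rule poly_mapping_eqI) (simp add: lookup_minus)
lemma to_rat_add: "to_rat (a + b) = to_rat a + to_rat b" by (rule poly_mapping_eqI) (simp add: lookup_add)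
lemma to_rat_cmul: "to_rat (frag_cmul k a) = qscale (of_int k) (to_rat a)" by (rule poly_mapping_eqI) simp
lemma to_rat_of [simp]: "to_rat (frag_of f) = gen f"
  by (rule poly_mapping_eqI) (simp add: lookup_gen lookup_single when_def)
lemma to_rat_sum: "to_rat (sum g I) = (\<Sum>i\<in>I. to_rat (g i))"
  by (induction I rule: infinite_finite_induct) (auto simp: to_rat_add)

lemma to_rat_frag_extend: "to_rat (frag_extend h c) = qlift (\<lambda>x. to_rat (h x)) (to_rat c)"
  by (simp add: frag_extend_def to_rat_sum to_rat_cmul qlift_def)

lemma singular_bdry_qlift:
  "singular_bdry p c = (if p = 0 then 0 else
     qlift (\<lambda>f. \<Sum>k\<le>p. qscale ((-1) ^ k) (gen (singular_face p k f))) c)"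
  by (simp add: singular_bdry_def qlift_def single_eq_qscale_gen qvs.scale_sum_right mult.commute)

lemma singular_bdry_0 [simp]: "singular_bdry 0 c = 0" "singular_bdry p 0 = 0"
  by (simp_all add: singular_bdry_qlift)

lemma singular_bdry_add: "singular_bdry p (a + b) = singular_bdry p a + singular_bdry p b"
  and singular_bdry_diff: "singular_bdry p (a - b) = singular_bdry p a - singular_bdry p b"
  and singular_bdry_scale: "singular_bdry p (qscale r a) = qscale r (singular_bdry p a)"
  by (simp_all add: singular_bdry_qlift qlift_simps)

lemma singular_bdry_qlift_comp: "singular_bdry p (qlift h c) = qlift (\<lambda>x. singular_bdry p (h x)) c"
proof (induction c rule: qchain_induct[OF subset_UNIV])
qed (auto simp: qlift_simps singular_bdry_add singular_bdry_scale)

lemma singular_bdry_linear: "qlinear_on S (singular_bdry p)"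
  by (simp add: qlinear_on_def singular_bdry_add singular_bdry_scale)

lemma singular_bdry_gen:
  "singular_bdry (Suc p) (gen f) = (\<Sum>k\<le>Suc p. qscale ((-1) ^ k) (gen (singular_face (Suc p) k f)))"
  by (simp add: singular_bdry_qlift del: sum.atMost_Suc)

lemma to_rat_boundary: "to_rat (chain_boundary p c) = singular_bdry p (to_rat c)"
  by (simp add: singular_bdry_qlift chain_boundary_def to_rat_frag_extend to_rat_sum to_rat_cmul)

abbreviation ss_chains :: "nat \<Rightarrow> 'a topology \<Rightarrow> 'a singular qchain set" where
  "ss_chains p X \<equiv> {c. Poly_Mapping.keys c \<subseteq> singular_simplex_set p X}"

lemma ss_chains_to_rat: "to_rat c \<in> ss_chains p X \<longleftrightarrow> singular_chain p X c"
  by (simp add: singular_chain_def)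

lemma subspace_ss_chains: "qvs.subspace (ss_chains p X)"
  by (rule subspace_keys)

lemma singular_bdry_in: "c \<in> ss_chains (Suc p) X \<Longrightarrow> singular_bdry (Suc p) c \<in> ss_chains p X"
proof -
  assume c: "c \<in> ss_chains (Suc p) X"
  have "Poly_Mapping.keys (singular_bdry (Suc p) c) \<subseteq> singular_simplex_set p X"
    unfolding singular_bdry_qlift
    using c singular_simplex_singular_face[of "Suc p" X]
    by (auto intro!: keys_sub_qlift keys_sub_sum keys_sub_scale simp del: sum.atMost_Suc)
  then show ?thesis by simp
qed

lemma singular_bdry_bdry:
  assumes "c \<in> ss_chains (Suc p) X" shows "singular_bdry p (singular_bdry (Suc p) c) = 0"
proof -
  have "Poly_Mapping.keys c \<subseteq> singular_simplex_set (Suc p) X" using assms by simp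
  then show ?thesis
  proof (induction rule: qchain_induct)
    case (gen f)
    have "singular_bdry p (singular_bdry (Suc p) (to_rat (frag_of f)))
        = to_rat (chain_boundary p (chain_boundary (Suc p) (frag_of f)))"
      by (simp only: to_rat_boundary)
    also have "\<dots> = 0" using gen chain_boundary_boundary_alt[of p X "frag_of f"]
      by (simp add: singular_chain_of)
    finally show ?case by simp
  qed (auto simp: singular_bdry_add singular_bdry_scale)
qed

section \<open>Iterated subdivision of rational chains and its homotopy to the identity\<close>

definition qsd :: "nat \<Rightarrow> 'a singular qchain \<Rightarrow> 'a singular qchain" where
  "qsd p = qlift (\<lambda>f. to_rat (singular_subdivision p (frag_of f)))"

lemmas qsd_simps = qlift_simps[where h = "\<lambda>f. to_rat (singular_subdivision p (frag_of f))" for p, folded qsd_def]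

lemma qsd_0 [simp]: "qsd p 0 = 0" by (simp add: qsd_def)

lemma qsd_to_rat: "qsd p (to_rat c) = to_rat (singular_subdivision p c)"
  by (simp add: qsd_def singular_subdivision_def to_rat_frag_extend)

lemma qsd_in: "c \<in> ss_chains p X \<Longrightarrow> qsd p c \<in> ss_chains p X"
  unfolding qsd_def
  by (rule qlift_in_subspace[OF subspace_ss_chains])
    (auto simp: ss_chains_to_rat singular_chain_singular_subdivision singular_chain_of simp del: mem_Collect_eq)

lemma qsd_bdry:
  assumes "c \<in> ss_chains p X" shows "singular_bdry p (qsd p c) = qsd (p - 1) (singular_bdry p c)"
proof -
  have "Poly_Mapping.keys c \<subseteq> singular_simplex_set p X" using assms by simp
  then show ?thesis
  proof (induction rule: qchain_induct)
    case (gen f)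
    have "singular_bdry p (qsd p (to_rat (frag_of f))) = qsd (p - 1) (singular_bdry p (to_rat (frag_of f)))"
      unfolding qsd_to_rat to_rat_boundary[symmetric]
      using gen chain_boundary_singular_subdivision[of p X "frag_of f"] by (simp add: singular_chain_of)
    then show ?case by simp
  qed (auto simp: singular_bdry_add singular_bdry_scale qsd_simps)
qed

abbreviation qsd_pow :: "nat \<Rightarrow> nat \<Rightarrow> 'a singular qchain \<Rightarrow> 'a singular qchain" where
  "qsd_pow n p \<equiv> (qsd p ^^ n)"

lemma qsd_pow_in: "c \<in> ss_chains p X \<Longrightarrow> qsd_pow n p c \<in> ss_chains p X"
  by (induction n) (auto simp: qsd_in simp del: mem_Collect_eq)

lemma qsd_pow_bdry:
  "c \<in> ss_chains (Suc p) X \<Longrightarrow> singular_bdry (Suc p) (qsd_pow n (Suc p) c) = qsd_pow n p (singular_bdry (Suc p) c)"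
  by (induction n) (auto simp: qsd_bdry[OF qsd_pow_in] simp del: mem_Collect_eq)

lemma qsd_pow_add: "qsd_pow n p (a + b) = qsd_pow n p a + qsd_pow n p b"
  and qsd_pow_scale: "qsd_pow n p (qscale r a) = qscale r (qsd_pow n p a)"
  and qsd_pow_diff: "qsd_pow n p (a - b) = qsd_pow n p a - qsd_pow n p b"
  and qsd_pow_0: "qsd_pow n p 0 = 0"
  by (induction n) (auto simp: qsd_simps)

lemma qsd_pow_to_rat: "qsd_pow n p (to_rat c) = to_rat ((singular_subdivision p ^^ n) c)"
  by (induction n) (auto simp: qsd_to_rat)

lemma qsd_pow_qlift: "qsd_pow n p c = qlift (\<lambda>f. qsd_pow n p (gen f)) c"
  by (rule qlinear_on_eq_qlift[of UNIV]) (auto simp: qlinear_on_def qsd_pow_add qsd_pow_scale)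

text \<open>Each of the finitely many simplices of \<open>c\<close> has its own bound, and the
  largest one serves all. The claim for every later \<open>m\<close> allows several chains to share
  one number of subdivisions.\<close>

lemma qsd_pow_small:
  assumes U: "\<And>U. U \<in> \<V> \<Longrightarrow> openin X U" "topspace X \<subseteq> \<Union>\<V>" and c: "c \<in> ss_chains p X"
  shows "\<exists>n. \<forall>m\<ge>n. \<forall>f\<in>Poly_Mapping.keys (qsd_pow m p c). \<exists>V\<in>\<V>. f ` standard_simplex p \<subseteq> V"
proof -
  have "\<exists>n. \<forall>m\<ge>n. \<forall>f\<in>Poly_Mapping.keys (qsd_pow m p (gen g)). \<exists>V\<in>\<V>. f ` standard_simplex p \<subseteq> V"
    if "g \<in> Poly_Mapping.keys c" for g
  proof -
    have "singular_chain p X (frag_of g)" using c that by (auto simp: singular_chain_of)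
    then obtain n where "\<And>m f. n \<le> m \<Longrightarrow> f \<in> Poly_Mapping.keys ((singular_subdivision p ^^ m) (frag_of g))
        \<Longrightarrow> \<exists>V\<in>\<V>. f \<in> standard_simplex p \<rightarrow> V"
      using sufficient_iterated_singular_subdivision_exists[OF U] by metis
    then show ?thesis
      by (intro exI[of _ n]) (auto simp: image_subset_iff Pi_iff simp flip: to_rat_of simp: qsd_pow_to_rat)
  qed
  then obtain n where n: "\<And>g m f. g \<in> Poly_Mapping.keys c \<Longrightarrow> m \<ge> n g \<Longrightarrow>
      f \<in> Poly_Mapping.keys (qsd_pow m p (gen g)) \<Longrightarrow> \<exists>V\<in>\<V>. f ` standard_simplex p \<subseteq> V"
    by metis
  show ?thesis
  proof (intro exI[of _ "Max (insert 0 (n ` Poly_Mapping.keys c))"] allI impI ballI)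
    fix m f assume m: "Max (insert 0 (n ` Poly_Mapping.keys c)) \<le> m"
      and f: "f \<in> Poly_Mapping.keys (qsd_pow m p c)"
    obtain g where g: "g \<in> Poly_Mapping.keys c" "f \<in> Poly_Mapping.keys (qsd_pow m p (gen g))"
      using f keys_qlift[of "\<lambda>f. qsd_pow m p (gen f)" c] by (subst (asm) qsd_pow_qlift) auto
    have "n g \<le> m" using m g by simp
    then show "\<exists>V\<in>\<V>. f ` standard_simplex p \<subseteq> V" using n g by blast
  qed
qed

text \<open>The homotopy is chosen before the space: one \<open>h\<close> maps simplices of every
  space to chains of that same space. Applied to subspaces, this shows that it does not enlarge
  supports.\<close>

lemma qsd_pow_homotopy:
  obtains h :: "nat \<Rightarrow> 'a singular \<Rightarrow> 'a singular qchain" where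
    "\<And>p X f. singular_simplex p X f \<Longrightarrow> h p f \<in> ss_chains (Suc p) X"
    "\<And>p X c. c \<in> ss_chains p X \<Longrightarrow>
       singular_bdry (Suc p) (qlift (h p) c) + qlift (h (p - 1)) (singular_bdry p c) = qsd_pow n p c - c"
proof -
  obtain k where k: "\<And>p. k p 0 = (0 :: 'a chain)"
        "\<And>p c1 c2. k p (c1-c2) = k p c1 - k p c2"
        "\<And>p X c. singular_chain p X c \<Longrightarrow> singular_chain (Suc p) X (k p c)"
        "\<And>p X c. singular_chain p X c
                 \<Longrightarrow> chain_boundary (Suc p) (k p c) + k (p - Suc 0) (chain_boundary p c)
                   = (singular_subdivision p ^^ n) c - c"
    using chain_homotopic_iterated_singular_subdivision[of n] by metis
  define h where "h = (\<lambda>p f. to_rat (k p (frag_of f)))"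
  have h: "qlift (h p) (to_rat c) = to_rat (k p c)" for p c
  proof -
    have "Poly_Mapping.keys c \<subseteq> UNIV" by simp
    then show ?thesis
      by (induction c rule: frag_induction) (auto simp: k to_rat_diff qlift_simps h_def)
  qed
  show ?thesis
  proof
    fix p and X :: "'a topology" and f assume "singular_simplex p X f"
    then have "singular_chain (Suc p) X (k p (frag_of f))" using k(3) by (simp add: singular_chain_of)
    then show "h p f \<in> ss_chains (Suc p) X" unfolding h_def ss_chains_to_rat .
  next
    fix p and X :: "'a topology" and c assume "c \<in> ss_chains p X"
    then have "Poly_Mapping.keys c \<subseteq> singular_simplex_set p X" by simp
    then show "singular_bdry (Suc p) (qlift (h p) c) + qlift (h (p - 1)) (singular_bdry p c) = qsd_pow n p c - c"
    proof (induction rule: qchain_induct)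
      case (gen f)
      then have "singular_chain p X (frag_of f)" by (simp add: singular_chain_of)
      from arg_cong[OF k(4)[OF this], of to_rat]
      have "singular_bdry (Suc p) (qlift (h p) (to_rat (frag_of f))) + qlift (h (p - 1)) (singular_bdry p (to_rat (frag_of f)))
        = qsd_pow n p (to_rat (frag_of f)) - to_rat (frag_of f)"
        by (simp add: to_rat_add to_rat_diff to_rat_boundary qsd_pow_to_rat flip: h del: to_rat_of)
      then show ?case by simp
    next
      case (add a b)
      have "singular_bdry (Suc p) (qlift (h p) (a + b)) + qlift (h (p - 1)) (singular_bdry p (a + b))
        = (singular_bdry (Suc p) (qlift (h p) a) + qlift (h (p - 1)) (singular_bdry p a))
        + (singular_bdry (Suc p) (qlift (h p) b) + qlift (h (p - 1)) (singular_bdry p b))"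
        by (simp add: singular_bdry_add qlift_simps)
      then show ?case unfolding add.IH qsd_pow_add by simp
    next
      case (scale r a)
      then show ?case
        by (simp add: singular_bdry_scale qlift_simps qsd_pow_scale flip: qvs.scale_right_distrib qvs.scale_right_diff_distrib)
    qed (simp add: qsd_pow_0)
  qed
qed

section \<open>Small chains\<close>

abbreviation small_simplex :: "'a topology \<Rightarrow> 'a set set \<Rightarrow> nat \<Rightarrow> 'a singular set" where
  "small_simplex X \<V> p \<equiv> {f. singular_simplex p X f \<and> (\<exists>V\<in>\<V>. f ` standard_simplex p \<subseteq> V)}"

lemma singular_face_image:
  assumes "k \<le> Suc p"
  shows "singular_face (Suc p) k f ` standard_simplex p \<subseteq> f ` standard_simplex (Suc p)"
  using assms simplical_face_in_standard_simplex[of "Suc p" k] by (auto simp: singular_face_def)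

lemma small_bdry_in:
  assumes "Poly_Mapping.keys c \<subseteq> small_simplex X \<V> (Suc p)"
  shows "Poly_Mapping.keys (singular_bdry (Suc p) c) \<subseteq> small_simplex X \<V> p"
proof -
  have eq: "singular_bdry (Suc p) c =
      qlift (\<lambda>f. \<Sum>k\<le>Suc p. qscale ((-1) ^ k) (gen (singular_face (Suc p) k f))) c"
    by (simp add: singular_bdry_qlift del: sum.atMost_Suc)
  show ?thesis
    unfolding eq
proof (intro keys_sub_qlift keys_sub_sum keys_sub_scale)
  fix f k assume f: "f \<in> Poly_Mapping.keys c" and k: "k \<in> {..Suc p}"
  have "singular_simplex (Suc p) X f" using f assms by auto
  then have "singular_simplex p X (singular_face (Suc p) k f)"
    using singular_simplex_singular_face[of "Suc p" X f k] k by simp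
  moreover obtain V where "V \<in> \<V>" "f ` standard_simplex (Suc p) \<subseteq> V" using f assms by auto
  moreover from this have "singular_face (Suc p) k f ` standard_simplex p \<subseteq> V"
    using singular_face_image[of k p f] k by blast
  ultimately show "Poly_Mapping.keys (gen (singular_face (Suc p) k f)) \<subseteq> small_simplex X \<V> p"
    by (auto intro!: bexI[of _ V])
qed
qed

lemma chains_singular [simp]: "chains (singular_complex X) p = ss_chains p X"
  "bdry (singular_complex X) = singular_bdry"
  by (simp_all add: singular_complex_def)

lemma chains_small [simp]: "chains (small_singular_complex X \<V>) p = {c. Poly_Mapping.keys c \<subseteq> small_simplex X \<V> p}"
  "bdry (small_singular_complex X \<V>) = singular_bdry"
  by (simp_all add: small_singular_complex_def)

lemma subspace_boundaries:
  assumes "qvs.subspace (chains C (Suc q))" "qlinear_on (chains C (Suc q)) (bdry C (Suc q))"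
  shows "qvs.subspace (boundaries C q)"
  unfolding qvs.subspace_def boundaries_def
proof (intro conjI ballI allI)
  have "bdry C (Suc q) 0 = 0" using assms qlinear_on_0 qvs.subspace_0 by blast
  then show "0 \<in> bdry C (Suc q) ` chains C (Suc q)"
    using imageI[OF qvs.subspace_0[OF assms(1)], of "bdry C (Suc q)"] by simp
next
  fix x y assume "x \<in> bdry C (Suc q) ` chains C (Suc q)" "y \<in> bdry C (Suc q) ` chains C (Suc q)"
  then obtain u v where "u \<in> chains C (Suc q)" "v \<in> chains C (Suc q)" "x = bdry C (Suc q) u" "y = bdry C (Suc q) v"
    by blast
  then show "x + y \<in> bdry C (Suc q) ` chains C (Suc q)"
    using imageI[OF qvs.subspace_add[OF assms(1), of u v], of "bdry C (Suc q)"] qlinear_onD(1)[OF assms(2)] by simp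
next
  fix r x assume "x \<in> bdry C (Suc q) ` chains C (Suc q)"
  then obtain u where "u \<in> chains C (Suc q)" "x = bdry C (Suc q) u" by blast
  then show "qscale r x \<in> bdry C (Suc q) ` chains C (Suc q)"
    using imageI[OF qvs.subspace_scale[OF assms(1), of u r], of "bdry C (Suc q)"] qlinear_onD(2)[OF assms(2)] by simp
qed

lemma subspace_cycles:
  assumes "qvs.subspace (chains C q)" "qlinear_on (chains C q) (bdry C q)"
  shows "qvs.subspace (cycles C q)"
proof -
  have "bdry C q 0 = 0" using assms qlinear_on_0 qvs.subspace_0 by blast
  then show ?thesis
    using assms unfolding qvs.subspace_def cycles_def by (auto simp: qlinear_onD[OF assms(2)])
qed

lemma qpair_singular: "qpair (cycles (singular_complex X) q) (boundaries (singular_complex X) q)"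
  unfolding qpair_def
proof (intro conjI subspace_cycles subspace_boundaries)
  show "boundaries (singular_complex X) q \<subseteq> cycles (singular_complex X) q"
    by (auto simp: boundaries_def cycles_def singular_bdry_bdry dest: singular_bdry_in[simplified])
qed (auto simp: subspace_ss_chains singular_bdry_linear simp del: mem_Collect_eq)

lemma subspace_singular_boundaries: "qvs.subspace (boundaries (singular_complex X) q)"
  using qpair_singular[of X q] unfolding qpair_def by (elim conjE)

lemma singular_bdry_in_boundaries:
  "c \<in> ss_chains (Suc q) X \<Longrightarrow> singular_bdry (Suc q) c \<in> boundaries (singular_complex X) q"
  unfolding boundaries_def chains_singular by (rule imageI)

lemma qlift_ss_chains:
  assumes "\<And>f. singular_simplex p X f \<Longrightarrow> h f \<in> ss_chains q Y" "c \<in> ss_chains p X"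
  shows "qlift h c \<in> ss_chains q Y"
  using assms(2) by (intro qlift_in_subspace[OF subspace_ss_chains] assms(1)) auto

lemma small_sub_singular: "Poly_Mapping.keys c \<subseteq> small_simplex X \<V> p \<Longrightarrow> c \<in> ss_chains p X"
  by auto

lemma qpair_small: "qpair (cycles (small_singular_complex X \<V>) q) (boundaries (small_singular_complex X \<V>) q)"
  unfolding qpair_def
proof (intro conjI subspace_cycles subspace_boundaries)
  show "boundaries (small_singular_complex X \<V>) q \<subseteq> cycles (small_singular_complex X \<V>) q"
    unfolding boundaries_def cycles_def
    using small_bdry_in[where X = X and \<V> = \<V> and p = q]
      singular_bdry_bdry[OF small_sub_singular[where X = X and \<V> = \<V> and p = "Suc q"]]
    by auto
qed (auto simp: subspace_keys singular_bdry_linear simp del: mem_Collect_eq)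

lemma small_iff: "f \<in> small_simplex X \<V> p \<longleftrightarrow> (\<exists>V\<in>\<V>. singular_simplex p (subtopology X V) f)"
  by (auto simp: singular_simplex_subtopology)

lemma small_homotopy:
  assumes "\<And>X f. singular_simplex p X f \<Longrightarrow> h f \<in> ss_chains (Suc p) X"
    and "Poly_Mapping.keys c \<subseteq> small_simplex X \<V> p"
  shows "Poly_Mapping.keys (qlift h c) \<subseteq> small_simplex X \<V> (Suc p)"
proof (rule keys_sub_qlift)
  fix f assume "f \<in> Poly_Mapping.keys c"
  then have "f \<in> small_simplex X \<V> p" using assms(2) by blast
  then obtain V where V: "V \<in> \<V>" "singular_simplex p (subtopology X V) f" unfolding small_iff by auto
  have "Poly_Mapping.keys (h f) \<subseteq> singular_simplex_set (Suc p) (subtopology X V)"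
    using assms(1)[OF V(2)] by simp
  also have "\<dots> \<subseteq> small_simplex X \<V> (Suc p)"
    using V(1) unfolding singular_simplex_subtopology by blast
  finally show "Poly_Mapping.keys (h f) \<subseteq> small_simplex X \<V> (Suc p)" .
qed

text \<open>Surjectivity on homology of the inclusion of small chains: enough subdivisions make a
  cycle small without changing its class.\<close>

lemma cycle_small_exists:
  fixes X :: "'a topology"
  assumes V: "\<And>U. U \<in> \<V> \<Longrightarrow> openin X U" "topspace X \<subseteq> \<Union>\<V>"
    and z: "z \<in> cycles (singular_complex X) q"
  shows "\<exists>z'\<in>cycles (small_singular_complex X \<V>) q. z - z' \<in> boundaries (singular_complex X) q"
proof -
  have zc: "z \<in> ss_chains q X" and zb: "singular_bdry q z = 0" using z by (auto simp: cycles_def)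
  obtain n where n: "\<forall>f\<in>Poly_Mapping.keys (qsd_pow n q z). \<exists>V\<in>\<V>. f ` standard_simplex q \<subseteq> V"
    using qsd_pow_small[OF V zc] by blast
  obtain h where h: "\<And>p (X :: 'a topology) f. singular_simplex p X f \<Longrightarrow> h p f \<in> ss_chains (Suc p) X"
    "\<And>p (X :: 'a topology) c. c \<in> ss_chains p X \<Longrightarrow>
       singular_bdry (Suc p) (qlift (h p) c) + qlift (h (p - 1)) (singular_bdry p c) = qsd_pow n p c - c"
    using qsd_pow_homotopy[of n] by metis
  have "singular_bdry q (qsd_pow n q z) = 0"
  proof (cases q)
    case (Suc r)
    have zc': "z \<in> ss_chains (Suc r) X" and zb': "singular_bdry (Suc r) z = 0" using zc zb Suc by simp_all
    show ?thesis unfolding Suc qsd_pow_bdry[OF zc'] zb' qsd_pow_0 ..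
  qed simp
  then have "qsd_pow n q z \<in> cycles (small_singular_complex X \<V>) q"
    using n qsd_pow_in[OF zc, of n] by (auto simp: cycles_def)
  moreover have "qlift (h q) z \<in> ss_chains (Suc q) X"
    by (rule qlift_ss_chains[OF h(1) zc])
  moreover have "singular_bdry (Suc q) (qlift (h q) z) = qsd_pow n q z - z"
    using h(2)[OF zc] by (simp add: zb)
  ultimately have "qsd_pow n q z - z \<in> boundaries (singular_complex X) q"
    using singular_bdry_in_boundaries[of "qlift (h q) z" q X] by simp
  then have "z - qsd_pow n q z \<in> boundaries (singular_complex X) q"
    by (rule cong_sym[OF subspace_singular_boundaries])
  then show ?thesis using \<open>qsd_pow n q z \<in> _\<close> by (rule bexI)
qed

text \<open>Injectivity on homology of the inclusion of small chains. If \<open>c\<close> fills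
  \<open>z\<close>, a fine subdivision of \<open>c\<close> fills the subdivided \<open>z\<close>,
  and subtracting the homotopy, small because \<open>z\<close> is, gives a small filling of
  \<open>z\<close> itself.\<close>

lemma small_boundary:
  fixes X :: "'a topology"
  assumes V: "\<And>U. U \<in> \<V> \<Longrightarrow> openin X U" "topspace X \<subseteq> \<Union>\<V>"
    and z: "z \<in> cycles (small_singular_complex X \<V>) q" "z \<in> boundaries (singular_complex X) q"
  shows "z \<in> boundaries (small_singular_complex X \<V>) q"
proof -
  have zs: "Poly_Mapping.keys z \<subseteq> small_simplex X \<V> q" and zb: "singular_bdry q z = 0"
    using z(1) by (auto simp: cycles_def)
  obtain c where c: "c \<in> ss_chains (Suc q) X" "z = singular_bdry (Suc q) c"
    using z(2) by (auto simp: boundaries_def)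
  obtain n where n: "\<forall>f\<in>Poly_Mapping.keys (qsd_pow n (Suc q) c). \<exists>V\<in>\<V>. f ` standard_simplex (Suc q) \<subseteq> V"
    using qsd_pow_small[OF V c(1)] by blast
  obtain h where h: "\<And>p (X :: 'a topology) f. singular_simplex p X f \<Longrightarrow> h p f \<in> ss_chains (Suc p) X"
    "\<And>p (X :: 'a topology) c. c \<in> ss_chains p X \<Longrightarrow>
       singular_bdry (Suc p) (qlift (h p) c) + qlift (h (p - 1)) (singular_bdry p c) = qsd_pow n p c - c"
    using qsd_pow_homotopy[of n] by metis
  define w where "w = qsd_pow n (Suc q) c - qlift (h q) z"
  have "Poly_Mapping.keys w \<subseteq> small_simplex X \<V> (Suc q)"
    unfolding w_def using n qsd_pow_in[OF c(1), of n]
    by (intro keys_sub_diff small_homotopy h zs) auto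
  moreover have "singular_bdry (Suc q) w = z"
  proof -
    have "singular_bdry (Suc q) (qlift (h q) z) = qsd_pow n q z - z"
      using h(2)[OF small_sub_singular[OF zs]] zb by simp
    then show ?thesis
      unfolding w_def singular_bdry_diff qsd_pow_bdry[OF c(1)] c(2)[symmetric] by simp
  qed
  ultimately show ?thesis unfolding boundaries_def by (auto intro!: image_eqI[of _ _ w])
qed

lemma qsd_pow_cong:
  fixes X :: "'a topology"
  assumes "z \<in> cycles (singular_complex X) q"
  shows "qsd_pow n q z - z \<in> boundaries (singular_complex X) q"
proof -
  have zc: "z \<in> ss_chains q X" and zb: "singular_bdry q z = 0" using assms by (auto simp: cycles_def)
  obtain h where h: "\<And>p (X :: 'a topology) f. singular_simplex p X f \<Longrightarrow> h p f \<in> ss_chains (Suc p) X"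
    "\<And>p (X :: 'a topology) c. c \<in> ss_chains p X \<Longrightarrow>
       singular_bdry (Suc p) (qlift (h p) c) + qlift (h (p - 1)) (singular_bdry p c) = qsd_pow n p c - c"
    using qsd_pow_homotopy[of n] by metis
  have "qlift (h q) z \<in> ss_chains (Suc q) X"
    by (rule qlift_ss_chains[OF h(1) zc])
  moreover have "singular_bdry (Suc q) (qlift (h q) z) = qsd_pow n q z - z"
    using h(2)[OF zc] by (simp add: zb)
  ultimately show ?thesis using singular_bdry_in_boundaries[of "qlift (h q) z" q X] by simp
qed

section \<open>The induced endomorphism\<close>

lemma homology_eq: "homology C q = quot (cycles C q) (boundaries C q)"
  by (simp add: homology_def)

lemma homology_map_coset:
  assumes f: "qmorph (cycles C q) (boundaries C q) (cycles D q) (boundaries D q) (f q)"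
    and C: "qpair (cycles C q) (boundaries C q)" and D: "qpair (cycles D q) (boundaries D q)"
    and z: "z \<in> cycles C q"
  shows "homology_map C D f q (coset (boundaries C q) z) = coset (boundaries D q) (f q z)"
proof -
  have sub: "qvs.subspace (boundaries C q)" "qvs.subspace (boundaries D q)" "boundaries C q \<subseteq> cycles C q"
      "qvs.subspace (cycles C q)"
    using C D by (auto simp: qpair_def)
  have "coset (boundaries D q) (f q w) = coset (boundaries D q) (f q z)" if w: "w \<in> coset (boundaries C q) z" for w
  proof -
    have "w - z \<in> boundaries C q" using w by (simp add: in_coset)
    moreover from this have "w \<in> cycles C q"
      using z sub qvs.subspace_add[OF sub(4), of "w - z" z] by auto
    ultimately show ?thesis
      using qmorph_cong[OF f C sub(2)] z coset_eq[OF sub(2)] by blast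
  qed
  moreover have "z \<in> coset (boundaries C q) z" using qvs.subspace_0[OF sub(1)] by (simp add: in_coset)
  ultimately show ?thesis unfolding homology_map_def by blast
qed

lemma chain_morphism_qmorph:
  assumes f: "chain_morphism C D f"
    and C: "\<And>p. qvs.subspace (chains C p)"
    and C': "q = 0 \<Longrightarrow> \<forall>c\<in>chains D 0. bdry D 0 c = 0"
    and D: "qpair (cycles D q) (boundaries D q)"
    and CC: "qpair (cycles C q) (boundaries C q)"
  shows "qmorph (cycles C q) (boundaries C q) (cycles D q) (boundaries D q) (f q)"
proof (rule qlinear_on_qmorph[OF _ CC])
  have lin: "qlinear_on (chains C p) (f p)" for p
    using f by (simp add: chain_morphism_def qlinear_on_def)
  show "qlinear_on (cycles C q) (f q)"
    using qlinear_on_sub[OF lin] by (auto simp: cycles_def)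
  show "qvs.subspace (boundaries D q)" using D by (simp add: qpair_def)
  fix z
  show "f q z \<in> cycles D q" if z: "z \<in> cycles C q"
  proof (cases q)
    case 0
    then show ?thesis using z f C' by (auto simp: cycles_def chain_morphism_def)
  next
    case (Suc r)
    have z': "z \<in> chains C (Suc r)" "bdry C (Suc r) z = 0" using z Suc by (simp_all add: cycles_def)
    have b: "f r (bdry C (Suc r) z) = bdry D (Suc r) (f (Suc r) z)" "f q z \<in> chains D q"
      using f z'(1) unfolding Suc chain_morphism_def by (elim conjE; simp)+
    have "bdry D (Suc r) (f (Suc r) z) = f r 0" using b(1) unfolding z'(2) by (rule sym)
    moreover have "f r 0 = 0" using qlinear_on_0[OF lin] qvs.subspace_0[OF C] by blast
    ultimately show ?thesis using b(2) Suc by (simp add: cycles_def)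
  qed
  show "f q z \<in> boundaries D q" if z: "z \<in> boundaries C q"
  proof -
    obtain c where "c \<in> chains C (Suc q)" "z = bdry C (Suc q) c" using z by (auto simp: boundaries_def)
    then show ?thesis using f by (auto simp: chain_morphism_def boundaries_def)
  qed
qed

text \<open>The inverse image in \<open>induced_endo\<close> is evaluated by naming a small cycle
  \<open>w\<close> homologous to \<open>z\<close>; injectivity on classes, which follows from
  \<open>small_boundary\<close>, forces \<open>inv_into\<close> to return the class of
  \<open>w\<close>.\<close>

lemma induced_endo_coset:
  fixes X :: "'a topology"
  assumes V: "open_cover X \<V>" and f: "chain_morphism (small_singular_complex X \<V>) (singular_complex X) \<phi>"
    and z: "z \<in> cycles (singular_complex X) q" and w: "w \<in> cycles (small_singular_complex X \<V>) q"
    and zw: "z - w \<in> boundaries (singular_complex X) q"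
  shows "induced_endo X \<V> \<phi> q (coset (boundaries (singular_complex X) q) z)
    = coset (boundaries (singular_complex X) q) (\<phi> q w)"
proof -
  let ?S = "small_singular_complex X \<V>" and ?X = "singular_complex X"
  have op: "\<And>U. U \<in> \<V> \<Longrightarrow> openin X U" "topspace X \<subseteq> \<Union>\<V>" using V by (auto simp: open_cover_def)
  have id: "chain_morphism ?S ?X (\<lambda>_ c. c)"
    by (auto simp: chain_morphism_def)
  have subS: "\<And>p. qvs.subspace (chains ?S p)" by (simp add: subspace_keys del: mem_Collect_eq)
  have qm: "qmorph (cycles ?S q) (boundaries ?S q) (cycles ?X q) (boundaries ?X q) (g q)"
    if "chain_morphism ?S ?X g" for g
    by (rule chain_morphism_qmorph[OF that subS _ qpair_singular qpair_small]) simp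
  have sB: "qvs.subspace (boundaries ?X q)" "qvs.subspace (boundaries ?S q)"
    using qpair_singular[of X q] qpair_small[of X \<V> q] unfolding qpair_def by simp_all
  note hm = homology_map_coset[where f = "\<lambda>_ c. c" and q = q, OF qm[OF id] qpair_small qpair_singular]
  have inj: "inj_on (homology_map ?S ?X (\<lambda>_ c. c) q) (carrier (homology ?S q))"
  proof (rule inj_onI)
    fix a b assume "a \<in> carrier (homology ?S q)" "b \<in> carrier (homology ?S q)"
      and eq: "homology_map ?S ?X (\<lambda>_ c. c) q a = homology_map ?S ?X (\<lambda>_ c. c) q b"
    then obtain x y where xy: "x \<in> cycles ?S q" "y \<in> cycles ?S q"
      "a = coset (boundaries ?S q) x" "b = coset (boundaries ?S q) y" by (auto simp: homology_eq)
    have "x - y \<in> boundaries ?X q" using eq xy hm coset_eq[OF sB(1)] by simp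
    moreover have "x - y \<in> cycles ?S q"
      using xy qpair_small[of X \<V> q] qvs.subspace_diff unfolding qpair_def by blast
    ultimately have "x - y \<in> boundaries ?S q" using small_boundary[OF op] by blast
    then show "a = b" using xy coset_eq[OF sB(2)] by simp
  qed
  have im: "homology_map ?S ?X (\<lambda>_ c. c) q (coset (boundaries ?S q) w) = coset (boundaries ?X q) z"
    unfolding hm[OF w] using zw coset_eq[OF sB(1), of z w] by simp
  have inc: "coset (boundaries ?S q) w \<in> carrier (homology ?S q)" using w by (simp add: homology_eq)
  have "inv_into (carrier (homology ?S q)) (homology_map ?S ?X (\<lambda>_ c. c) q) (coset (boundaries ?X q) z)
      = coset (boundaries ?S q) w"
    by (rule inv_into_f_eq[OF inj inc im])
  then show ?thesis
    using homology_map_coset[where f = \<phi> and q = q, OF qm[OF f] qpair_small qpair_singular w] by (simp add: induced_endo_def)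
qed

section \<open>Affine simplices as lists of points\<close>

type_synonym point = "nat \<Rightarrow> real"

text \<open>The face of the infinite-dimensional simplex with corners \<open>N\<close>. Arbitrary
  finite \<open>N\<close> occur because the singular simplices used as vertices keep their labels
  when they are restricted to faces.\<close>

definition face_simplex :: "nat set \<Rightarrow> point set" where
  "face_simplex N = {x. (\<forall>i. 0 \<le> x i \<and> x i \<le> 1) \<and> (\<forall>i. i \<notin> N \<longrightarrow> x i = 0) \<and> sum x N = 1}"

lemma face_simplex_atMost: "face_simplex {..p} = standard_simplex p"
  by (auto simp: face_simplex_def standard_simplex_def)

lemma face_simplex_mono:
  assumes "M \<subseteq> N" "finite N" shows "face_simplex M \<subseteq> face_simplex N"
proof
  fix x assume x: "x \<in> face_simplex M"
  then have "sum x N = sum x M" using assms by (intro sum.mono_neutral_right) (auto simp: face_simplex_def)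
  then show "x \<in> face_simplex N" using x assms by (auto simp: face_simplex_def)
qed

definition affine_comb :: "point list \<Rightarrow> (nat \<Rightarrow> real) \<Rightarrow> point" where
  "affine_comb xs t = (\<lambda>i. \<Sum>j<length xs. (xs ! j) i * t j)"

lemma affine_comb_in:
  assumes "set xs \<subseteq> face_simplex N" "\<And>j. 0 \<le> t j" "(\<Sum>j<length xs. t j) = 1" "finite N"
  shows "affine_comb xs t \<in> face_simplex N"
proof -
  have xs: "xs ! j \<in> face_simplex N" if "j < length xs" for j using assms that by auto
  have "affine_comb xs t i \<le> 1" for i
  proof -
    have "affine_comb xs t i \<le> (\<Sum>j<length xs. 1 * t j)"
      unfolding affine_comb_def using assms xs
      by (intro sum_mono mult_right_mono) (auto simp: face_simplex_def)
    then show ?thesis using assms by simp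
  qed
  moreover have "0 \<le> affine_comb xs t i" for i
    unfolding affine_comb_def using assms xs by (intro sum_nonneg mult_nonneg_nonneg) (auto simp: face_simplex_def)
  moreover have "affine_comb xs t i = 0" if "i \<notin> N" for i
    unfolding affine_comb_def using xs that by (intro sum.neutral) (auto simp: face_simplex_def)
  moreover have "sum (affine_comb xs t) N = 1"
  proof -
    have "sum (affine_comb xs t) N = (\<Sum>j<length xs. (\<Sum>i\<in>N. (xs ! j) i) * t j)"
      unfolding affine_comb_def by (subst sum.swap) (simp add: sum_distrib_right)
    also have "\<dots> = (\<Sum>j<length xs. 1 * t j)"
      using xs by (intro sum.cong) (auto simp: face_simplex_def)
    finally show ?thesis using assms by simp
  qed
  ultimately show ?thesis by (auto simp: face_simplex_def)
qed

definition push :: "'a singular \<Rightarrow> point list \<Rightarrow> 'a singular" where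
  "push g xs = simplex_map (length xs - 1) g (oriented_simplex (length xs - 1) (\<lambda>j. xs ! j))"

lemma push_apply:
  assumes "xs \<noteq> []" "t \<in> standard_simplex (length xs - 1)"
  shows "push g xs t = g (affine_comb xs t)"
proof -
  have "{..length xs - Suc 0} = {..<length xs}" using assms(1) by (cases xs) auto
  then show ?thesis
    using assms by (simp add: push_def simplex_map_def oriented_simplex_def affine_comb_def)
qed

lemma push_eqI:
  assumes "length xs = length ys" "xs \<noteq> []"
    and "\<And>t. t \<in> standard_simplex (length xs - 1) \<Longrightarrow> g (affine_comb xs t) = h (affine_comb ys t)"
  shows "push g xs = push h ys"
proof
  fix t
  show "push g xs t = push h ys t"
  proof (cases "t \<in> standard_simplex (length xs - 1)")
    case True
    moreover have "ys \<noteq> []" using assms by auto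
    ultimately show ?thesis using assms push_apply[of xs t g] push_apply[of ys t h] by simp
  next
    case False
    then show ?thesis using assms(1) by (simp add: push_def simplex_map_def)
  qed
qed

lemma standard_simplex_sum:
  "xs \<noteq> [] \<Longrightarrow> t \<in> standard_simplex (length xs - 1) \<Longrightarrow> (\<forall>j. 0 \<le> t j) \<and> (\<Sum>j<length xs. t j) = 1"
  by (cases xs) (auto simp: standard_simplex_def lessThan_Suc_atMost)

lemma affine_comb_face:
  assumes "xs \<noteq> []" "t \<in> standard_simplex (length xs - 1)" "set xs \<subseteq> face_simplex N" "finite N"
  shows "affine_comb xs t \<in> face_simplex N"
  using assms standard_simplex_sum[OF assms(1,2)] by (intro affine_comb_in) auto

lemma singular_face_push:
  assumes "length xs = Suc (Suc k)" "i \<le> Suc k"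
  shows "singular_face (Suc k) i (push g xs) = push g (omit i xs)"
proof
  fix t
  have len: "length (omit i xs) = Suc k" using assms by (simp add: omit_def)
  show "singular_face (Suc k) i (push g xs) t = push g (omit i xs) t"
  proof (cases "t \<in> standard_simplex k")
    case True
    have "singular_face (Suc k) i (oriented_simplex (Suc k) (\<lambda>j. xs ! j)) t
      = oriented_simplex k (\<lambda>j. if j < i then xs ! j else xs ! Suc j) t"
      using singular_face_oriented_simplex[of "Suc k" i "(!) xs"] assms by simp
    then have "oriented_simplex (Suc k) (\<lambda>j. xs ! j) (simplical_face i t)
      = oriented_simplex k (\<lambda>j. if j < i then xs ! j else xs ! Suc j) t"
      using True by (simp add: singular_face_def)
    moreover have "oriented_simplex k (\<lambda>j. if j < i then xs ! j else xs ! Suc j)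
        = oriented_simplex k (\<lambda>j. omit i xs ! j)"
      using assms by (subst oriented_simplex_eq) (auto simp: omit_def nth_append min_def)
    ultimately show ?thesis
      using True assms len simplical_face_in_standard_simplex[of "Suc k" i t]
      by (simp add: singular_face_def push_def simplex_map_def)
  next
    case False
    then show ?thesis using len by (simp add: singular_face_def push_def simplex_map_def)
  qed
qed

definition push_chain :: "'a singular \<Rightarrow> point list qchain \<Rightarrow> 'a singular qchain" where
  "push_chain g = qlift (\<lambda>xs. gen (push g xs))"

lemma push_chain_gen [simp]: "push_chain g (gen xs) = gen (push g xs)" by (simp add: push_chain_def)
lemma push_chain_0 [simp]: "push_chain g 0 = 0" by (simp add: push_chain_def)
lemmas push_chain_simps = qlift_simps[where h = "\<lambda>xs. gen (push g xs)" for g, folded push_chain_def]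

text \<open>Degree 0 is left out: there \<open>obd\<close> gives the empty list, which corresponds
  to no singular simplex, whereas the singular boundary is zero.\<close>

lemma bdry_push_chain:
  assumes "Poly_Mapping.keys c \<subseteq> {xs. length xs = Suc (Suc k)}"
  shows "singular_bdry (Suc k) (push_chain g c) = push_chain g (obd c)"
  using assms
proof (induction rule: qchain_induct)
  case (gen xs)
  then have len: "length xs = Suc (Suc k)" by simp
  have "push_chain g (obd (gen xs)) = (\<Sum>i<length xs. qscale ((-1) ^ i) (gen (push g (omit i xs))))"
    by (simp add: obd_gen_expand push_chain_simps)
  also have "\<dots> = (\<Sum>i\<le>Suc k. qscale ((-1) ^ i) (gen (singular_face (Suc k) i (push g xs))))"
    unfolding len lessThan_Suc_atMost by (intro sum.cong) (auto simp: singular_face_push[OF len])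
  finally show ?case by (simp add: singular_bdry_gen del: sum.atMost_Suc)
qed (auto simp: singular_bdry_add singular_bdry_scale push_chain_simps obd_simps)

lemma singular_simplex_push:
  assumes g: "continuous_map (subtopology (powertop_real UNIV) (face_simplex N)) X g"
    and xs: "xs \<noteq> []" "set xs \<subseteq> face_simplex N" and N: "finite N"
  shows "singular_simplex (length xs - 1) X (push g xs)"
proof -
  have "{..length xs - Suc 0} = {..<length xs}" using xs(1) by (cases xs) auto
  then have "simplicial_simplex (length xs - 1) (face_simplex N) (oriented_simplex (length xs - 1) (\<lambda>j. xs ! j))"
    unfolding simplicial_simplex_oriented_simplex
    using affine_comb_face[OF xs(1) _ xs(2) N] by (auto simp: affine_comb_def)
  then show ?thesis
    unfolding push_def
    by (intro singular_simplex_simplex_map[OF _ g] simplicial_imp_singular_simplex)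
qed

lemma push_image:
  assumes "xs \<noteq> []" "set xs \<subseteq> face_simplex N" "finite N"
  shows "push g xs ` standard_simplex (length xs - 1) \<subseteq> g ` face_simplex N"
  using push_apply[OF assms(1)] affine_comb_face[OF assms(1) _ assms(2,3)] by auto

definition unit_point :: "nat \<Rightarrow> point" where
  "unit_point i = (\<lambda>j. if j = i then 1 else 0)"

definition unit_list :: "nat \<Rightarrow> point list" where
  "unit_list p = map unit_point [0..<Suc p]"

lemma length_unit_list [simp]: "length (unit_list p) = Suc p"
  by (simp add: unit_list_def)

lemma unit_list_nonempty [simp]: "unit_list p \<noteq> []"
  by (simp add: unit_list_def)

lemma set_unit_list: "set (unit_list p) \<subseteq> standard_simplex p"
  by (auto simp: unit_list_def unit_point_def less_Suc_eq_le)

lemma simplical_face_unit: "simplical_face i (unit_point j) = unit_point (if j < i then j else Suc j)"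
  by (auto simp: simplical_face_def unit_point_def fun_eq_iff)

lemma omit_unit_list:
  assumes "i \<le> Suc p"
  shows "omit i (unit_list (Suc p)) = map (simplical_face i) (unit_list p)"
proof (rule nth_equalityI)
  show "length (omit i (unit_list (Suc p))) = length (map (simplical_face i) (unit_list p))"
    using assms by (simp add: omit_def)
  fix j assume "j < length (omit i (unit_list (Suc p)))"
  then have "j < Suc p" using assms by (simp add: omit_def)
  then show "omit i (unit_list (Suc p)) ! j = map (simplical_face i) (unit_list p) ! j"
    using assms by (auto simp: omit_def unit_list_def nth_append simplical_face_unit min_def simp del: upt_Suc)
qed

text \<open>Each singular simplex is the image of the standard one. A natural construction on
  \<open>unit_list p\<close> therefore determines the construction for all singular simplices, in
  the manner of acyclic models.\<close>

lemma push_unit_list: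
  assumes "singular_simplex p X f" shows "push f (unit_list p) = f"
proof
  fix t
  show "push f (unit_list p) t = f t"
  proof (cases "t \<in> standard_simplex p")
    case True
    have "affine_comb (unit_list p) t i = t i" for i
    proof -
      have "affine_comb (unit_list p) t i = (\<Sum>j<Suc p. if j = i then t j else 0)"
        unfolding affine_comb_def length_unit_list
        by (intro sum.cong) (auto simp: unit_list_def unit_point_def simp del: upt_Suc)
      also have "\<dots> = t i" using True by (auto simp: standard_simplex_def)
      finally show ?thesis .
    qed
    then have "affine_comb (unit_list p) t = t" by (rule ext)
    then show ?thesis using True push_apply[of "unit_list p" t f] by simp
  next
    case False
    then show ?thesis using assms by (simp add: push_def simplex_map_def singular_simplex_def extensional_def)
  qed
qed

text \<open>Weighted sums with arbitrary weights are preserved, so the maps meant are linear; face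
  maps are of this kind.\<close>

definition affine_map :: "(point \<Rightarrow> point) \<Rightarrow> bool" where
  "affine_map f \<longleftrightarrow> (\<forall>n (x :: nat \<Rightarrow> point) t. f (\<lambda>i. \<Sum>j<n. x j i * t j) = (\<lambda>i. \<Sum>j<n. f (x j) i * t j))"

lemma affine_map_face: "affine_map (simplical_face k)"
  by (auto simp: affine_map_def simplical_face_def fun_eq_iff)

lemma affine_map_comb: "affine_map f \<Longrightarrow> f (affine_comb xs t) = affine_comb (map f xs) t"
  by (simp add: affine_map_def affine_comb_def)

lemma push_face:
  assumes "xs \<noteq> []" "set xs \<subseteq> standard_simplex p" "i \<le> Suc p"
  shows "push (singular_face (Suc p) i f) xs = push f (map (simplical_face i) xs)"
proof (rule push_eqI)
  fix t assume "t \<in> standard_simplex (length xs - 1)"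
  then have "affine_comb xs t \<in> standard_simplex p"
    using affine_comb_face[of xs t "{..p}"] assms by (simp add: face_simplex_atMost)
  then show "singular_face (Suc p) i f (affine_comb xs t) = f (affine_comb (map (simplical_face i) xs) t)"
    by (simp add: singular_face_def affine_map_comb[OF affine_map_face])
qed (use assms in auto)

lemma push_chain_face:
  assumes "Poly_Mapping.keys c \<subseteq> {xs. xs \<noteq> [] \<and> set xs \<subseteq> standard_simplex p}" "i \<le> Suc p"
  shows "push_chain (singular_face (Suc p) i f) c = push_chain f (omap (simplical_face i) c)"
  unfolding push_chain_def omap_def qlift_qlift
  using assms(1) by (intro qlift_cong) (auto simp: push_face[OF _ _ assms(2)] subset_iff)

text \<open>Compares constructions on the standard simplex and on \<open>f\<close>: if they agree on
  each face, where omitting a corner matches restricting \<open>f\<close>, they agree on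
  boundaries.\<close>

lemma natural_boundary:
  assumes "\<And>i. i \<le> Suc p \<Longrightarrow> A (omit i (unit_list (Suc p))) = B (singular_face (Suc p) i f)"
  shows "qlift A (obd_gen (unit_list (Suc p))) = qlift B (singular_bdry (Suc p) (gen f))"
  unfolding obd_gen_expand singular_bdry_gen length_unit_list lessThan_Suc_atMost[of "Suc p"] qlift_sum qlift_scale qlift_gen
  using assms by (intro sum.cong) auto

section \<open>Barycentric subdivision of ordered chains\<close>

text \<open>The cone over the subdivided boundary, with the list \<open>xs\<close> itself as formal
  barycentre. The recursion runs over the terms of a boundary and is not structural, so
  \<open>n\<close> serves as fuel and \<open>sd_gen\<close> supplies the length.\<close>

fun sd_aux :: "nat \<Rightarrow> 'v list \<Rightarrow> 'v list list qchain" where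
  "sd_aux 0 xs = gen []"
| "sd_aux (Suc n) xs = ocone xs (qlift (sd_aux n) (obd_gen xs))"

definition sd_gen :: "'v list \<Rightarrow> 'v list list qchain" where
  "sd_gen xs = sd_aux (length xs) xs"

definition sd :: "'v list qchain \<Rightarrow> 'v list list qchain" where
  "sd = qlift sd_gen"

lemma sd_gen_eq [simp]: "sd (gen xs) = sd_gen xs" by (simp add: sd_def)
lemma sd_0 [simp]: "sd 0 = 0" by (simp add: sd_def)
lemmas sd_simps = qlift_simps[where h = sd_gen, folded sd_def]

lemma sd_gen_Nil [simp]: "sd_gen [] = gen []" by (simp add: sd_gen_def)

lemma sd_gen_rec: "xs \<noteq> [] \<Longrightarrow> sd_gen xs = ocone xs (sd (obd_gen xs))"
proof -
  assume "xs \<noteq> []"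
  then obtain n where n: "length xs = Suc n" by (cases xs) auto
  have "qlift (sd_aux n) (obd_gen xs) = sd (obd_gen xs)"
    unfolding sd_def using keys_obd_gen[of xs] n by (intro qlift_cong) (auto simp: sd_gen_def)
  then show ?thesis by (simp add: sd_gen_def n)
qed

text \<open>By the cone formula only the term \<open>sd (obd_gen xs)\<close> survives, since by
  induction its own boundary is the subdivision of a vanishing double boundary.\<close>

lemma obd_sd_gen: "obd (sd_gen xs) = sd (obd_gen xs)"
proof (induction "length xs" arbitrary: xs rule: less_induct)
  case less
  show ?case
  proof (cases "xs = []")
    case False
    have "obd (sd (obd_gen xs)) = qlift (\<lambda>ys. obd (sd_gen ys)) (obd_gen xs)"
      by (simp add: obd_def sd_def qlift_qlift)
    also have "\<dots> = qlift (\<lambda>ys. sd (obd_gen ys)) (obd_gen xs)"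
      using less keys_obd_gen[of xs] by (intro qlift_cong) auto
    also have "\<dots> = sd (obd (obd_gen xs))" by (simp add: obd_def sd_def qlift_qlift)
    finally show ?thesis by (simp add: sd_gen_rec[OF False] obd_ocone obd_obd_gen)
  qed simp
qed

lemma obd_sd: "obd (sd c) = sd (obd c)"
  by (induction c rule: qchain_induct[OF subset_UNIV]) (auto simp: sd_simps obd_simps obd_sd_gen)

lemma sd_gen_map: "sd_gen (map f xs) = omap (map f) (sd_gen xs)"
proof (induction "length xs" arbitrary: xs rule: less_induct)
  case less
  show ?case
  proof (cases "xs = []")
    case False
    have "sd (obd_gen (map f xs)) = qlift (\<lambda>ys. sd_gen (map f ys)) (obd_gen xs)"
      by (simp add: obd_omap_gen omap_def sd_def qlift_qlift)
    also have "\<dots> = qlift (\<lambda>ys. omap (map f) (sd_gen ys)) (obd_gen xs)"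
      using less keys_obd_gen[of xs] by (intro qlift_cong) auto
    also have "\<dots> = omap (map f) (sd (obd_gen xs))" by (simp add: omap_def sd_def qlift_qlift)
    finally show ?thesis using False by (simp add: sd_gen_rec omap_ocone)
  qed simp
qed

lemma sd_omap: "sd (omap f c) = omap (map f) (sd c)"
  by (induction c rule: qchain_induct[OF subset_UNIV]) (auto simp: sd_simps omap_simps sd_gen_map)

lemma keys_obd_gen_subseq: "Poly_Mapping.keys (obd_gen xs) \<subseteq> {ys. Suc (length ys) = length xs \<and> subseq ys xs}"
  unfolding obd_gen_expand
proof (intro keys_sub_sum keys_sub_scale)
  fix i assume i: "i \<in> {..<length xs}"
  moreover have "subseq (omit i xs) xs"
  proof -
    have "subseq (take i xs @ drop (Suc i) xs) (take i xs @ drop i xs)"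
      by (intro list_emb_append_mono subseq_order.refl) (use i in \<open>simp flip: Cons_nth_drop_Suc add: list_emb_Cons\<close>)
    then show ?thesis by (simp add: omit_def)
  qed
  ultimately show "Poly_Mapping.keys (gen (omit i xs)) \<subseteq> {ys. Suc (length ys) = length xs \<and> subseq ys xs}"
    by (auto simp: omit_def)
qed

text \<open>The simplices of the subdivision are the flags of sublists, largest first.\<close>

lemma keys_sd_gen:
  "Poly_Mapping.keys (sd_gen xs) \<subseteq> {ls. map length ls = rev [1..<Suc (length xs)] \<and>
     sorted_wrt (\<lambda>l m. subseq m l) ls \<and> (\<forall>l\<in>set ls. subseq l xs)}"
proof (induction "length xs" arbitrary: xs rule: less_induct)
  case less
  show ?case
  proof (cases "xs = []")
    case False
    show ?thesis
    proof
      fix ls assume "ls \<in> Poly_Mapping.keys (sd_gen xs)"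
      then have "ls \<in> (#) xs ` Poly_Mapping.keys (sd (obd_gen xs))"
        using subsetD[OF keys_ocone] False by (simp add: sd_gen_rec)
      then obtain ms where ms: "ls = xs # ms" "ms \<in> Poly_Mapping.keys (sd (obd_gen xs))"
        by blast
      then obtain ys where ys: "ys \<in> Poly_Mapping.keys (obd_gen xs)" "ms \<in> Poly_Mapping.keys (sd_gen ys)"
        using keys_qlift[of sd_gen "obd_gen xs"] by (auto simp: sd_def)
      have y: "Suc (length ys) = length xs" "subseq ys xs" using keys_obd_gen_subseq[of xs] ys(1) by auto
      have "map length ms = rev [1..<Suc (length ys)] \<and> sorted_wrt (\<lambda>l m. subseq m l) ms \<and> (\<forall>l\<in>set ms. subseq l ys)"
        using less[of ys] y(1) ys(2) by auto
      then show "ls \<in> {ls. map length ls = rev [1..<Suc (length xs)] \<and>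
          sorted_wrt (\<lambda>l m. subseq m l) ls \<and> (\<forall>l\<in>set ls. subseq l xs)}"
        using y(2) by (auto simp: ms(1) y(1)[symmetric] intro: subseq_order.trans)
    qed
  qed simp
qed

section \<open>Labelled double subdivision of affine simplices\<close>

definition centroid :: "point list \<Rightarrow> point" where
  "centroid ys = affine_comb ys (\<lambda>_. 1 / real (length ys))"

lemma centroid_map: "affine_map f \<Longrightarrow> f (centroid ys) = centroid (map f ys)"
  by (simp add: centroid_def affine_map_comb)

lemma centroid_in:
  assumes "ys \<noteq> []" "set ys \<subseteq> face_simplex N" "finite N"
  shows "centroid ys \<in> face_simplex N"
  unfolding centroid_def using assms by (intro affine_comb_in) auto

text \<open>In the first subdivision each vertex remembers the dimension of the face of which it is the
  barycentre. The vertices of a simplex then have distinct labels, so that the vertices of the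
  second subdivision determine its simplices.\<close>

definition label :: "point list \<Rightarrow> nat \<times> point" where
  "label ys = (length ys - 1, centroid ys)"

definition lsd_gen :: "point list \<Rightarrow> (nat \<times> point) list qchain" where
  "lsd_gen xs = omap label (sd_gen xs)"

definition dsd_gen :: "point list \<Rightarrow> (nat \<times> point) list list qchain" where
  "dsd_gen xs = sd (lsd_gen xs)"

definition unlabel :: "(nat \<times> point) list \<Rightarrow> point" where
  "unlabel l = centroid (map snd l)"

definition bsd_gen :: "point list \<Rightarrow> point list qchain" where
  "bsd_gen xs = omap unlabel (dsd_gen xs)"

lemma qlift_omap: "omap f (qlift h c) = qlift (\<lambda>x. omap f (h x)) c"
  by (simp add: omap_def qlift_qlift)

lemma obd_dsd_gen: "obd (dsd_gen xs) = qlift dsd_gen (obd_gen xs)"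
proof -
  have "obd (dsd_gen xs) = sd (omap label (sd (obd_gen xs)))"
    by (simp add: dsd_gen_def lsd_gen_def obd_sd obd_omap obd_sd_gen)
  also have "\<dots> = qlift (\<lambda>ys. dsd_gen ys) (obd_gen xs)"
    by (simp add: sd_def omap_def qlift_qlift dsd_gen_def lsd_gen_def)
  finally show ?thesis .
qed

lemma obd_bsd_gen: "obd (bsd_gen xs) = qlift bsd_gen (obd_gen xs)"
  unfolding bsd_gen_def obd_omap obd_dsd_gen qlift_omap ..

text \<open>Affine maps move barycentres and keep dimensions, hence act on the point component
  alone. Labelling by dimension is what makes the double subdivision compatible with face maps,
  which would renumber corners.\<close>

lemma dsd_gen_map:
  assumes "affine_map f" shows "dsd_gen (map f xs) = omap (map (map_prod id f)) (dsd_gen xs)"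
proof -
  have "label (map f ys) = map_prod id f (label ys)" for ys
    using centroid_map[OF assms] by (simp add: label_def)
  then show ?thesis
    by (simp add: dsd_gen_def lsd_gen_def sd_gen_map omap_omap sd_omap comp_def flip: sd_omap)
qed

lemma bsd_gen_map:
  assumes "affine_map f" shows "bsd_gen (map f xs) = omap f (bsd_gen xs)"
proof -
  have "unlabel (map (map_prod id f) l) = f (unlabel l)" for l
    using centroid_map[OF assms] by (simp add: unlabel_def comp_def)
  then show ?thesis by (simp add: bsd_gen_def dsd_gen_map[OF assms] omap_omap comp_def)
qed

lemma bsd_gen_Nil [simp]: "bsd_gen [] = gen []"
  by (simp add: bsd_gen_def dsd_gen_def lsd_gen_def)

lemma dsd_gen_Nil [simp]: "dsd_gen [] = gen []"
  by (simp add: dsd_gen_def lsd_gen_def)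

lemma keys_lsd_gen:
  assumes m: "m \<in> Poly_Mapping.keys (lsd_gen xs)" and xs: "set xs \<subseteq> face_simplex N" and N: "finite N"
  shows "map fst m = rev [0..<length xs]" "snd ` set m \<subseteq> face_simplex N"
proof -
  obtain ls where ls: "ls \<in> Poly_Mapping.keys (sd_gen xs)" "m = map label ls"
    using m keys_omap[of label "sd_gen xs"] by (auto simp: lsd_gen_def)
  have k: "map length ls = rev [1..<Suc (length xs)]" "\<forall>l\<in>set ls. subseq l xs"
    using keys_sd_gen[of xs] ls(1) by auto
  have "map fst m = map (\<lambda>n. n - 1) (map length ls)" by (simp add: ls label_def)
  also have "\<dots> = rev [0..<length xs]"
    unfolding k(1) by (simp add: rev_map[symmetric] map_Suc_upt[symmetric] comp_def del: map_Suc_upt upt_Suc)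
  finally show "map fst m = rev [0..<length xs]" .
  have "centroid l \<in> face_simplex N" if l: "l \<in> set ls" for l
  proof -
    have "length l \<in> set (map length ls)" using l by simp
    then have "l \<noteq> []" unfolding k(1) by auto
    moreover have "set l \<subseteq> set xs" using k(2) l by (metis notin_set_nthsI set_nths_subset subseq_conv_nths)
    ultimately show ?thesis using xs N by (intro centroid_in) auto
  qed
  then show "snd ` set m \<subseteq> face_simplex N" by (auto simp: ls label_def)
qed

lemma keys_dsd_gen:
  assumes ls: "ls \<in> Poly_Mapping.keys (dsd_gen xs)" and xs: "set xs \<subseteq> face_simplex N" and N: "finite N"
  shows "map length ls = rev [1..<Suc (length xs)]" "sorted_wrt (\<lambda>l m. subseq m l) ls"
    "\<And>l. l \<in> set ls \<Longrightarrow> l \<noteq> []" "\<And>l. l \<in> set ls \<Longrightarrow> distinct (map fst l)"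
    "\<And>l. l \<in> set ls \<Longrightarrow> snd ` set l \<subseteq> face_simplex N"
proof -
  obtain m where m: "m \<in> Poly_Mapping.keys (lsd_gen xs)" "ls \<in> Poly_Mapping.keys (sd_gen m)"
    using ls keys_qlift[of sd_gen "lsd_gen xs"] by (auto simp: dsd_gen_def sd_def)
  note k = keys_lsd_gen[OF m(1) xs N]
  have "length m = length xs" using arg_cong[OF k(1), of length] by (simp del: upt_Suc)
  then have s: "map length ls = rev [1..<Suc (length xs)]" "sorted_wrt (\<lambda>l m. subseq m l) ls"
      "\<forall>l\<in>set ls. subseq l m"
    using keys_sd_gen[of m] m(2) by auto
  then show "map length ls = rev [1..<Suc (length xs)]" "sorted_wrt (\<lambda>l m. subseq m l) ls" by auto
  fix l assume l: "l \<in> set ls"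
  have "length l \<in> set (map length ls)" using l by simp
  then show "l \<noteq> []" unfolding s(1) by auto
  have sub: "subseq l m" using s(3) l by blast
  have "distinct (map fst m)" unfolding k(1) by simp
  then show "distinct (map fst l)"
    using sub by (auto simp: subseq_conv_nths nths_map[symmetric] intro: distinct_nthsI)
  have "set l \<subseteq> set m" using sub by (metis notin_set_nthsI set_nths_subset subseq_conv_nths)
  then show "snd ` set l \<subseteq> face_simplex N" using k(2) by auto
qed

lemma keys_bsd_gen:
  assumes xs: "set xs \<subseteq> face_simplex N" and N: "finite N"
  shows "Poly_Mapping.keys (bsd_gen xs) \<subseteq> {ys. length ys = length xs \<and> set ys \<subseteq> face_simplex N}"
proof
  fix ys assume "ys \<in> Poly_Mapping.keys (bsd_gen xs)"
  then obtain ls where ls: "ls \<in> Poly_Mapping.keys (dsd_gen xs)" "ys = map unlabel ls"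
    using keys_omap[of unlabel "dsd_gen xs"] by (auto simp: bsd_gen_def)
  note k = keys_dsd_gen[OF ls(1) xs N]
  have "length ls = length xs" using arg_cong[OF k(1), of length] by (simp del: upt_Suc)
  moreover have "unlabel l \<in> face_simplex N" if "l \<in> set ls" for l
    unfolding unlabel_def using k(3,5)[OF that] N by (intro centroid_in) auto
  ultimately show "ys \<in> {ys. length ys = length xs \<and> set ys \<subseteq> face_simplex N}"
    by (auto simp: ls(2))
qed

text \<open>The chain homotopy from the identity to the second subdivision, by coning off from the
  first vertex.\<close>

fun htpy_aux :: "nat \<Rightarrow> point list \<Rightarrow> point list qchain" where
  "htpy_aux 0 xs = 0"
| "htpy_aux (Suc n) xs = ocone (hd xs) (bsd_gen xs - gen xs - qlift (htpy_aux n) (obd_gen xs))"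

definition htpy_gen :: "point list \<Rightarrow> point list qchain" where
  "htpy_gen xs = htpy_aux (length xs) xs"

lemma htpy_gen_Nil [simp]: "htpy_gen [] = 0" by (simp add: htpy_gen_def)

lemma htpy_gen_rec:
  "xs \<noteq> [] \<Longrightarrow> htpy_gen xs = ocone (hd xs) (bsd_gen xs - gen xs - qlift htpy_gen (obd_gen xs))"
proof -
  assume "xs \<noteq> []"
  then obtain n where n: "length xs = Suc n" by (cases xs) auto
  have "qlift (htpy_aux n) (obd_gen xs) = qlift htpy_gen (obd_gen xs)"
    using keys_obd_gen[of xs] n by (intro qlift_cong) (auto simp: htpy_gen_def)
  then show ?thesis by (simp add: htpy_gen_def n)
qed

text \<open>The chain that is coned off has zero boundary by induction, so the cone formula leaves
  exactly that chain.\<close>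

lemma obd_htpy_gen: "obd (htpy_gen xs) = bsd_gen xs - gen xs - qlift htpy_gen (obd_gen xs)"
proof (induction "length xs" arbitrary: xs rule: less_induct)
  case less
  show ?case
  proof (cases "xs = []")
    case False
    have "obd (qlift htpy_gen (obd_gen xs)) = qlift (\<lambda>ys. obd (htpy_gen ys)) (obd_gen xs)"
      by (simp add: obd_def qlift_qlift)
    also have "\<dots> = qlift (\<lambda>ys. bsd_gen ys - gen ys - qlift htpy_gen (obd_gen ys)) (obd_gen xs)"
      using less keys_obd_gen[of xs] by (intro qlift_cong) auto
    also have "\<dots> = qlift bsd_gen (obd_gen xs) - obd_gen xs - qlift htpy_gen (obd (obd_gen xs))"
      by (simp add: qlift_fun_diff qlift_of_gen obd_def qlift_qlift)
    finally have "obd (bsd_gen xs - gen xs - qlift htpy_gen (obd_gen xs)) = 0"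
      by (simp add: obd_simps obd_bsd_gen obd_obd_gen)
    then show ?thesis by (simp add: htpy_gen_rec[OF False] obd_ocone)
  qed simp
qed

lemma htpy_gen_map:
  assumes f: "affine_map f" shows "htpy_gen (map f xs) = omap f (htpy_gen xs)"
proof (induction "length xs" arbitrary: xs rule: less_induct)
  case less
  show ?case
  proof (cases "xs = []")
    case False
    have "qlift htpy_gen (obd_gen (map f xs)) = qlift (\<lambda>ys. htpy_gen (map f ys)) (obd_gen xs)"
      by (simp add: obd_omap_gen omap_def qlift_qlift)
    also have "\<dots> = qlift (\<lambda>ys. omap f (htpy_gen ys)) (obd_gen xs)"
      using less keys_obd_gen[of xs] by (intro qlift_cong) auto
    also have "\<dots> = omap f (qlift htpy_gen (obd_gen xs))" by (simp add: omap_def qlift_qlift)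
    finally show ?thesis
      using False by (simp add: htpy_gen_rec omap_ocone omap_simps bsd_gen_map[OF f] hd_map)
  qed simp
qed

lemma keys_htpy_gen:
  assumes "set xs \<subseteq> face_simplex N" and N: "finite N"
  shows "Poly_Mapping.keys (htpy_gen xs) \<subseteq> {ys. length ys = Suc (length xs) \<and> set ys \<subseteq> face_simplex N}"
  using assms(1)
proof (induction "length xs" arbitrary: xs rule: less_induct)
  case less
  show ?case
  proof (cases "xs = []")
    case False
    let ?S = "{ys. length ys = length xs \<and> set ys \<subseteq> face_simplex N}"
    have "Poly_Mapping.keys (qlift htpy_gen (obd_gen xs)) \<subseteq> ?S"
    proof (rule keys_sub_qlift)
      fix ys assume "ys \<in> Poly_Mapping.keys (obd_gen xs)"
      then have "Suc (length ys) = length xs" "set ys \<subseteq> set xs" using keys_obd_gen[of xs] by auto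
      then show "Poly_Mapping.keys (htpy_gen ys) \<subseteq> ?S" using less(1)[of ys] less(2) by auto
    qed
    then have "Poly_Mapping.keys (bsd_gen xs - gen xs - qlift htpy_gen (obd_gen xs)) \<subseteq> ?S"
      using keys_bsd_gen[OF less(2) N] less(2) by (intro keys_sub_diff) auto
    then have "Poly_Mapping.keys (htpy_gen xs) \<subseteq> (#) (hd xs) ` ?S"
      unfolding htpy_gen_rec[OF False] by (rule order_trans[OF keys_ocone image_mono])
    moreover have "hd xs \<in> face_simplex N" using False less(2) by auto
    then have "(#) (hd xs) ` ?S \<subseteq> {ys. length ys = Suc (length xs) \<and> set ys \<subseteq> face_simplex N}" by auto
    ultimately show ?thesis by (rule order_trans)
  qed simp
qed

lemma singular_bdry_expand: "singular_bdry p c = qlift (\<lambda>f. singular_bdry p (gen f)) c"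
  by (simp add: singular_bdry_qlift_comp[symmetric] qlift_of_gen)

text \<open>The homotopy on the standard simplex is pushed forward along each singular simplex;
  naturality under face maps turns it into a chain homotopy on singular chains.\<close>

lemma bsd_homologous:
  fixes X :: "'a topology"
  assumes z: "z \<in> cycles (singular_complex X) q"
  shows "qlift (\<lambda>f. push_chain f (bsd_gen (unit_list q))) z - z \<in> boundaries (singular_complex X) q"
proof -
  have zc: "z \<in> ss_chains q X" and zb: "singular_bdry q z = 0" using z by (auto simp: cycles_def)
  define T where "T = (\<lambda>p (f :: 'a singular). push_chain f (htpy_gen (unit_list p)))"
  have keys_u: "Poly_Mapping.keys (htpy_gen (unit_list p)) \<subseteq> {ys. length ys = Suc (Suc p) \<and> set ys \<subseteq> standard_simplex p}" for p
    using keys_htpy_gen[of "unit_list p" "{..p}"] set_unit_list[of p] by (simp add: face_simplex_atMost)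
  have T_in: "T p f \<in> ss_chains (Suc p) X" if f: "singular_simplex p X f" for p f
  proof -
    have "Poly_Mapping.keys (T p f) \<subseteq> singular_simplex_set (Suc p) X"
      unfolding T_def push_chain_def
    proof (rule keys_sub_qlift)
      fix ys assume "ys \<in> Poly_Mapping.keys (htpy_gen (unit_list p))"
      then have "length ys = Suc (Suc p)" "set ys \<subseteq> standard_simplex p" using keys_u by auto
      moreover from this have "ys \<noteq> []" by auto
      ultimately show "Poly_Mapping.keys (gen (push f ys)) \<subseteq> singular_simplex_set (Suc p) X"
        using singular_simplex_push[of "{..p}" X f ys] f
        by (auto simp: face_simplex_atMost singular_simplex_def[of p])
    qed
    then show ?thesis by simp
  qed
  have hom: "singular_bdry (Suc p) (qlift (T p) c) =
      qlift (\<lambda>f. push_chain f (bsd_gen (unit_list p))) c - c - (if p = 0 then 0 else qlift (T (p - 1)) (singular_bdry p c))"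
    if c: "c \<in> ss_chains p X" for p c
  proof -
    have pt: "singular_bdry (Suc p) (T p f) = push_chain f (bsd_gen (unit_list p)) - gen f
        - (if p = 0 then 0 else qlift (T (p - 1)) (singular_bdry p (gen f)))"
      if "f \<in> Poly_Mapping.keys c" for f
    proof -
      have f: "singular_simplex p X f" using c that by auto
      have "singular_bdry (Suc p) (T p f) = push_chain f (obd (htpy_gen (unit_list p)))"
        unfolding T_def using keys_u[of p] by (intro bdry_push_chain) auto
      also have "\<dots> = push_chain f (bsd_gen (unit_list p)) - push_chain f (gen (unit_list p))
          - push_chain f (qlift htpy_gen (obd_gen (unit_list p)))"
        by (simp add: obd_htpy_gen push_chain_simps)
      also have "push_chain f (gen (unit_list p)) = gen f" by (simp add: push_unit_list[OF f])
      also have "push_chain f (qlift htpy_gen (obd_gen (unit_list p)))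
        = (if p = 0 then 0 else qlift (T (p - 1)) (singular_bdry p (gen f)))"
      proof (cases p)
        case 0
        then show ?thesis by (simp add: unit_list_def)
      next
        case (Suc r)
        have "push_chain f (qlift htpy_gen (obd_gen (unit_list p)))
          = qlift (\<lambda>ys. push_chain f (htpy_gen ys)) (obd_gen (unit_list (Suc r)))"
          by (simp add: push_chain_def qlift_qlift Suc)
        also have "\<dots> = qlift (T r) (singular_bdry (Suc r) (gen f))"
        proof (rule natural_boundary)
          fix i assume i: "i \<le> Suc r"
          show "push_chain f (htpy_gen (omit i (unit_list (Suc r)))) = T r (singular_face (Suc r) i f)"
            unfolding T_def omit_unit_list[OF i] htpy_gen_map[OF affine_map_face]
            using keys_u[of r] by (intro push_chain_face[OF _ i, symmetric]) auto
        qed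
        finally show ?thesis by (simp add: Suc)
      qed
      finally show ?thesis .
    qed
    have "singular_bdry (Suc p) (qlift (T p) c) = qlift (\<lambda>f. push_chain f (bsd_gen (unit_list p)) - gen f
        - (if p = 0 then 0 else qlift (T (p - 1)) (singular_bdry p (gen f)))) c"
      unfolding singular_bdry_qlift_comp by (rule qlift_cong[OF pt])
    also have "\<dots> = qlift (\<lambda>f. push_chain f (bsd_gen (unit_list p))) c - c
        - qlift (\<lambda>f. if p = 0 then 0 else qlift (T (p - 1)) (singular_bdry p (gen f))) c"
      by (simp only: qlift_fun_diff qlift_of_gen)
    also have "qlift (\<lambda>f. if p = 0 then 0 else qlift (T (p - 1)) (singular_bdry p (gen f))) c
        = (if p = 0 then 0 else qlift (T (p - 1)) (singular_bdry p c))"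
      by (simp add: qlift_def[of "\<lambda>_. 0"] singular_bdry_expand[of p c] qlift_qlift)
    finally show ?thesis .
  qed
  have "singular_bdry (Suc q) (qlift (T q) z) = qlift (\<lambda>f. push_chain f (bsd_gen (unit_list q))) z - z"
    using hom[OF zc] by (simp add: zb)
  moreover have "qlift (T q) z \<in> ss_chains (Suc q) X" by (rule qlift_ss_chains[OF T_in zc])
  ultimately show ?thesis using singular_bdry_in_boundaries by metis
qed

section \<open>Vertices carrying singular simplices\<close>

text \<open>A vertex is a singular simplex on the face of the infinite-dimensional simplex spanned by
  a finite set \<open>N\<close> of labels; \<open>u\<close> is a face of \<open>v\<close> if it is the restriction of \<open>v\<close> to a
  smaller set of labels.\<close>

definition enc :: "nat set \<Rightarrow> 'a singular \<Rightarrow> 'a vertex" where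
  "enc N g = N \<times> {g}"

definition vdom :: "'a vertex \<Rightarrow> nat set" where "vdom v = fst ` v"
definition vfun :: "'a vertex \<Rightarrow> 'a singular" where "vfun v = the_elem (snd ` v)"

lemma vdom_enc [simp]: "vdom (enc N g) = N" by (auto simp: vdom_def enc_def)
lemma vfun_enc [simp]: "N \<noteq> {} \<Longrightarrow> vfun (enc N g) = g" by (auto simp: vfun_def enc_def the_elem_def)

definition vertex_image :: "'a vertex \<Rightarrow> 'a set" where
  "vertex_image v = vfun v ` face_simplex (vdom v)"

definition valid_vertex :: "'a topology \<Rightarrow> 'a vertex \<Rightarrow> bool" where
  "valid_vertex X v \<longleftrightarrow> finite (vdom v) \<and> vdom v \<noteq> {} \<and>
     continuous_map (subtopology (powertop_real UNIV) (face_simplex (vdom v))) X (vfun v)"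

definition vface :: "'a vertex \<Rightarrow> 'a vertex \<Rightarrow> bool" where
  "vface u v \<longleftrightarrow> vdom u \<subset> vdom v \<and> vfun u = restrict (vfun v) (face_simplex (vdom u))"

definition bary :: "nat set \<Rightarrow> point" where
  "bary N = (\<lambda>i. if i \<in> N then 1 / real (card N) else 0)"

lemma bary_in: "finite N \<Longrightarrow> N \<noteq> {} \<Longrightarrow> bary N \<in> face_simplex N"
  by (auto simp: bary_def face_simplex_def field_simps card_gt_0_iff Suc_le_eq)

definition flag :: "'a vertex list \<Rightarrow> bool" where
  "flag vs \<longleftrightarrow> sorted_wrt (\<lambda>v u. vface u v) vs"

text \<open>The head of a flag has the largest label set, so its map is defined at the barycentres
  of all members.\<close>

definition geo :: "'a vertex list \<Rightarrow> 'a singular" where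
  "geo vs = push (vfun (hd vs)) (map (\<lambda>v. bary (vdom v)) vs)"

text \<open>A simplex \<open>l\<close> of the labelled subdivision becomes a vertex whose map lives
  on the face spanned by the labels of \<open>l\<close>: the affine map that sends the corner with a
  given label to the point carrying it, followed by \<open>f\<close>.\<close>

definition vert :: "'a singular \<Rightarrow> (nat \<times> point) list \<Rightarrow> 'a vertex" where
  "vert f l = enc (fst ` set l)
     (restrict (\<lambda>x. f (affine_comb (map snd l) (\<lambda>j. x (fst (l ! j))))) (face_simplex (fst ` set l)))"

definition vpoint :: "(nat \<times> point) list \<Rightarrow> point \<Rightarrow> point" where
  "vpoint l x = affine_comb (map snd l) (\<lambda>j. x (fst (l ! j)))"

lemma vert_eq: "vert f l = enc (fst ` set l) (restrict (\<lambda>x. f (vpoint l x)) (face_simplex (fst ` set l)))"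
  by (simp add: vert_def vpoint_def)

lemma vpoint_set:
  assumes "distinct (map fst l)" shows "vpoint l x = (\<lambda>i. \<Sum>q\<in>set l. snd q i * x (fst q))"
proof
  fix i
  have "distinct l" using assms distinct_map by blast
  then have "bij_betw ((!) l) {..<length l} (set l)" by (intro bij_betw_nth) auto
  then have "(\<Sum>q\<in>set l. snd q i * x (fst q)) = (\<Sum>j<length l. snd (l ! j) i * x (fst (l ! j)))"
    by (rule sum.reindex_bij_betw[symmetric])
  then show "vpoint l x i = (\<Sum>q\<in>set l. snd q i * x (fst q))"
    by (simp add: vpoint_def affine_comb_def)
qed

lemma vpoint_in:
  assumes l: "distinct (map fst l)" "l \<noteq> []" and s: "snd ` set l \<subseteq> face_simplex N" "finite N"
    and x: "x \<in> face_simplex (fst ` set l)"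
  shows "vpoint l x \<in> face_simplex N"
  unfolding vpoint_def
proof (rule affine_comb_in)
  have "bij_betw ((!) (map fst l)) {..<length l} (fst ` set l)"
    using l by (intro bij_betw_nth) auto
  then have "(\<Sum>j<length l. x (map fst l ! j)) = sum x (fst ` set l)"
    by (rule sum.reindex_bij_betw)
  then show "(\<Sum>j<length (map snd l). x (fst (l ! j))) = 1"
    using x by (simp add: face_simplex_def)
qed (use s x in \<open>auto simp: face_simplex_def\<close>)

text \<open>A face map changes neither the labels nor the composite with \<open>f\<close>, so both
  vertices are equal and not just isomorphic. This equality makes \<open>carry\<close> commute with
  boundaries.\<close>

lemma vert_face:
  assumes l: "distinct (map fst l)" "l \<noteq> []" and s: "snd ` set l \<subseteq> standard_simplex p" and i: "i \<le> Suc p"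
  shows "vert f (map (map_prod id (simplical_face i)) l) = vert (singular_face (Suc p) i f) l"
proof -
  have fst: "fst ` set (map (map_prod id (simplical_face i)) l) = fst ` set l"
    by (auto simp: image_image)
  have "vpoint (map (map_prod id (simplical_face i)) l) x = simplical_face i (vpoint l x)" for x
    unfolding vpoint_def affine_map_comb[OF affine_map_face]
    by (auto simp: affine_comb_def fun_eq_iff intro!: sum.cong)
  moreover have "vpoint l x \<in> standard_simplex p" if "x \<in> face_simplex (fst ` set l)" for x
    using vpoint_in[OF l _ _ that, of "{..p}"] s by (simp add: face_simplex_atMost)
  ultimately show ?thesis
    unfolding vert_eq fst by (intro arg_cong[where f = "enc (fst ` set l)"] restrict_ext)
      (simp add: singular_face_def)
qed

lemma vdom_vert [simp]: "vdom (vert f l) = fst ` set l"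
  by (simp add: vert_eq)

lemma vfun_vert: "l \<noteq> [] \<Longrightarrow> vfun (vert f l) = restrict (\<lambda>x. f (vpoint l x)) (face_simplex (fst ` set l))"
  by (simp add: vert_eq)

lemma valid_vert:
  assumes f: "singular_simplex p X f" and l: "distinct (map fst l)" "l \<noteq> []"
    and s: "snd ` set l \<subseteq> standard_simplex p"
  shows "valid_vertex X (vert f l)" "vertex_image (vert f l) \<subseteq> f ` standard_simplex p"
proof -
  let ?N = "fst ` set l"
  have into: "vpoint l x \<in> standard_simplex p" if "x \<in> face_simplex ?N" for x
    using vpoint_in[OF l _ _ that, of "{..p}"] s by (simp add: face_simplex_atMost)
  have "continuous_map (subtopology (powertop_real UNIV) (face_simplex ?N)) (powertop_real UNIV) (vpoint l)"
    unfolding continuous_map_componentwise vpoint_def affine_comb_def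
    by (force intro: continuous_intros continuous_map_from_subtopology continuous_map_product_projection)
  then have "continuous_map (subtopology (powertop_real UNIV) (face_simplex ?N))
      (subtopology (powertop_real UNIV) (standard_simplex p)) (vpoint l)"
    using into by (simp add: continuous_map_in_subtopology image_subset_iff)
  then have "continuous_map (subtopology (powertop_real UNIV) (face_simplex ?N)) X (f \<circ> vpoint l)"
    using f continuous_map_compose unfolding singular_simplex_def by blast
  then have "continuous_map (subtopology (powertop_real UNIV) (face_simplex ?N)) X (vfun (vert f l))"
    by (rule continuous_map_eq) (simp add: vfun_vert[OF l(2)])
  then show "valid_vertex X (vert f l)" using l by (simp add: valid_vertex_def)
  show "vertex_image (vert f l) \<subseteq> f ` standard_simplex p"
    using into by (auto simp: vertex_image_def vfun_vert[OF l(2)])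
qed

lemma subseq_set: "subseq m l \<Longrightarrow> set m \<subseteq> set l"
  by (metis notin_set_nthsI set_nths_subset subseq_conv_nths)

text \<open>On the face spanned by the labels of \<open>m\<close> the remaining coordinates vanish;
  distinct labels ensure that no entry outside \<open>m\<close> shares a label with one
  inside.\<close>

lemma vpoint_subseq:
  assumes l: "distinct (map fst l)" and m: "subseq m l" and x: "x \<in> face_simplex (fst ` set m)"
  shows "vpoint l x = vpoint m x"
proof -
  have sub: "set m \<subseteq> set l" by (rule subseq_set[OF m])
  have dm: "distinct (map fst m)"
    using m l by (auto simp: subseq_conv_nths nths_map[symmetric] intro: distinct_nthsI)
  have inj: "inj_on fst (set l)" using l distinct_map by blast
  have z: "x (fst q) = 0" if "q \<in> set l - set m" for q
  proof -
    have "fst q \<notin> fst ` set m" using that sub inj by (auto dest: inj_onD)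
    then show ?thesis using x by (simp add: face_simplex_def)
  qed
  show ?thesis
    unfolding vpoint_set[OF l] vpoint_set[OF dm]
  proof
    fix i show "(\<Sum>q\<in>set l. snd q i * x (fst q)) = (\<Sum>q\<in>set m. snd q i * x (fst q))"
      using sub z by (intro sum.mono_neutral_right) auto
  qed
qed

lemma card_fst: "distinct (map fst l) \<Longrightarrow> card (fst ` set l) = length l"
  by (metis distinct_card length_map set_map)

lemma vpoint_bary:
  assumes l: "distinct (map fst l)" shows "vpoint l (bary (fst ` set l)) = unlabel l"
  unfolding vpoint_def unlabel_def centroid_def affine_comb_def
  by (auto simp: bary_def card_fst[OF l] fun_eq_iff intro!: sum.cong)

lemma vface_vert:
  assumes l: "distinct (map fst l)" "m \<noteq> []" and m: "subseq m l" "length m < length l"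
  shows "vface (vert f m) (vert f l)"
proof -
  have dm: "distinct (map fst m)"
    using m l by (auto simp: subseq_conv_nths nths_map[symmetric] intro: distinct_nthsI)
  have sub: "fst ` set m \<subseteq> fst ` set l" using subseq_set[OF m(1)] by auto
  moreover have "fst ` set m \<noteq> fst ` set l"
    using card_fst[OF dm] card_fst[OF l(1)] m(2) by (metis less_irrefl)
  ultimately have "fst ` set m \<subset> fst ` set l" by blast
  moreover have ln: "l \<noteq> []" using m(2) by auto
  have "vfun (vert f m) = restrict (vfun (vert f l)) (face_simplex (fst ` set m))"
    unfolding vfun_vert[OF l(2)] vfun_vert[OF ln]
  proof (rule restrict_ext)
    fix x assume x: "x \<in> face_simplex (fst ` set m)"
    then have "x \<in> face_simplex (fst ` set l)" using face_simplex_mono[OF sub] by auto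
    then show "f (vpoint m x) = restrict (\<lambda>x. f (vpoint l x)) (face_simplex (fst ` set l)) x"
      using vpoint_subseq[OF l(1) m(1) x] by simp
  qed
  ultimately show ?thesis by (simp add: vface_def)
qed

lemma keys_dsd_unit:
  assumes "ls \<in> Poly_Mapping.keys (dsd_gen (unit_list p))"
  shows "length ls = Suc p" "sorted_wrt (\<lambda>l m. subseq m l \<and> length m < length l) ls"
    "\<And>l. l \<in> set ls \<Longrightarrow> l \<noteq> [] \<and> distinct (map fst l) \<and> snd ` set l \<subseteq> standard_simplex p"
proof -
  note k = keys_dsd_gen[OF assms, of "{..p}", unfolded face_simplex_atMost, OF set_unit_list finite_atMost]
  show "length ls = Suc p" using arg_cong[OF k(1), of length] by (simp del: upt_Suc)
  have "sorted_wrt (<) (rev (map length ls))" unfolding k(1) rev_rev_ident by (rule sorted_wrt_upt)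
  then have "sorted_wrt (\<lambda>l m. length m < length l) ls" by (simp add: sorted_wrt_rev sorted_wrt_map)
  then show "sorted_wrt (\<lambda>l m. subseq m l \<and> length m < length l) ls"
    using k(2) by (simp add: sorted_wrt_iff_nth_less)
  show "\<And>l. l \<in> set ls \<Longrightarrow> l \<noteq> [] \<and> distinct (map fst l) \<and> snd ` set l \<subseteq> standard_simplex p"
    using k(3-5) by blast
qed

lemma flag_vert:
  assumes "ls \<in> Poly_Mapping.keys (dsd_gen (unit_list p))"
  shows "flag (map (vert f) ls)"
  using keys_dsd_unit[OF assms] unfolding flag_def sorted_wrt_map
  by (auto simp: sorted_wrt_iff_nth_less intro!: vface_vert)

lemma vpoint_affine_comb: "vpoint l (affine_comb zs t) = affine_comb (map (vpoint l) zs) t"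
proof
  fix i
  have "vpoint l (affine_comb zs t) i
      = (\<Sum>k<length l. \<Sum>j<length zs. snd (l ! k) i * ((zs ! j) (fst (l ! k)) * t j))"
    by (simp add: vpoint_def affine_comb_def sum_distrib_left)
  also have "\<dots> = (\<Sum>j<length zs. \<Sum>k<length l. snd (l ! k) i * ((zs ! j) (fst (l ! k)) * t j))"
    by (rule sum.swap)
  also have "\<dots> = affine_comb (map (vpoint l) zs) t i"
    by (simp add: vpoint_def affine_comb_def sum_distrib_right mult.assoc)
  finally show "vpoint l (affine_comb zs t) i = affine_comb (map (vpoint l) zs) t i" .
qed

lemma affine_comb_map_cong: "(\<And>x. x \<in> set xs \<Longrightarrow> f x = g x) \<Longrightarrow> affine_comb (map f xs) t = affine_comb (map g xs) t"
  by (simp cong: map_cong)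

text \<open>All members of the flag are sublists of the largest one \<open>l\<close>, and the affine
  map of \<open>l\<close> sends the barycentre of the labels of a member to the barycentre of its
  points. The abstract flag therefore realizes the corresponding simplex of the double
  subdivision.\<close>

lemma geo_vert:
  assumes ls: "ls \<in> Poly_Mapping.keys (dsd_gen (unit_list p))"
  shows "geo (map (vert f) ls) = push f (map unlabel ls)"
proof -
  note k = keys_dsd_unit[OF ls]
  have ne: "ls \<noteq> []" using k(1) by auto
  define l where "l = hd ls"
  have l: "l \<in> set ls" using ne by (simp add: l_def)
  have dl: "distinct (map fst l)" "l \<noteq> []" using k(3)[OF l] by auto
  have sub: "subseq m l" if "m \<in> set ls" for m
    using that k(2) ne by (cases ls) (auto simp: l_def)
  show ?thesis
    unfolding geo_def
  proof (rule push_eqI)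
    fix t assume t: "t \<in> standard_simplex (length (map (\<lambda>v. bary (vdom v)) (map (vert f) ls)) - 1)"
    let ?bs = "map (\<lambda>m. bary (fst ` set m)) ls"
    have bs: "map (\<lambda>v. bary (vdom v)) (map (vert f) ls) = ?bs" by (simp add: comp_def)
    have b_in: "bary (fst ` set m) \<in> face_simplex (fst ` set m)" if "m \<in> set ls" for m
      using k(3)[OF that] by (intro bary_in) auto
    have "set ?bs \<subseteq> face_simplex (fst ` set l)"
    proof
      fix b assume "b \<in> set ?bs"
      then obtain m where m: "m \<in> set ls" "b = bary (fst ` set m)" by auto
      have "fst ` set m \<subseteq> fst ` set l" using subseq_set[OF sub[OF m(1)]] by auto
      then show "b \<in> face_simplex (fst ` set l)" using b_in[OF m(1)] face_simplex_mono m(2) by blast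
    qed
    then have "affine_comb ?bs t \<in> face_simplex (fst ` set l)"
      using t ne by (intro affine_comb_face) auto
    moreover have "vpoint l (affine_comb ?bs t) = affine_comb (map unlabel ls) t"
    proof -
      have "vpoint l (bary (fst ` set m)) = unlabel m" if "m \<in> set ls" for m
        using vpoint_subseq[OF dl(1) sub[OF that] b_in[OF that]] vpoint_bary k(3)[OF that] by simp
      then show ?thesis
        unfolding vpoint_affine_comb map_map comp_def by (rule affine_comb_map_cong)
    qed
    ultimately show "vfun (hd (map (vert f) ls)) (affine_comb (map (\<lambda>v. bary (vdom v)) (map (vert f) ls)) t)
      = f (affine_comb (map unlabel ls) t)"
      unfolding bs using ne by (simp add: hd_map l_def[symmetric] vfun_vert[OF dl(2)])
  qed (use ne in auto)
qed

definition carry :: "nat \<Rightarrow> 'a singular \<Rightarrow> 'a vertex list qchain" where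
  "carry p f = omap (vert f) (dsd_gen (unit_list p))"

lemma obd_carry_0: "obd (carry 0 f) = gen []"
  by (simp add: carry_def obd_omap obd_dsd_gen unit_list_def qlift_simps)

lemma obd_carry: "obd (carry (Suc p) f) = qlift (carry p) (singular_bdry (Suc p) (gen f))"
proof -
  have "obd (carry (Suc p) f) = qlift (\<lambda>xs. omap (vert f) (dsd_gen xs)) (obd_gen (unit_list (Suc p)))"
    by (simp add: carry_def obd_omap obd_dsd_gen qlift_omap)
  also have "\<dots> = qlift (carry p) (singular_bdry (Suc p) (gen f))"
  proof (rule natural_boundary)
    fix i assume i: "i \<le> Suc p"
    show "omap (vert f) (dsd_gen (omit i (unit_list (Suc p)))) = carry p (singular_face (Suc p) i f)"
      unfolding carry_def omit_unit_list[OF i] dsd_gen_map[OF affine_map_face] omap_omap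
    proof (rule omap_cong)
      fix ls l assume "ls \<in> Poly_Mapping.keys (dsd_gen (unit_list p))" "l \<in> set ls"
      then have "l \<noteq> []" "distinct (map fst l)" "snd ` set l \<subseteq> standard_simplex p"
        using keys_dsd_unit(3) by blast+
      then show "(vert f \<circ> map (map_prod id (simplical_face i))) l = vert (singular_face (Suc p) i f) l"
        by (simp add: vert_face[OF _ _ _ i])
    qed
  qed
  finally show ?thesis .
qed

lemma keys_carry:
  assumes f: "singular_simplex p X f"
  shows "Poly_Mapping.keys (carry p f) \<subseteq> {vs. length vs = Suc p \<and> flag vs \<and>
    (\<forall>v\<in>set vs. valid_vertex X v \<and> vertex_image v \<subseteq> f ` standard_simplex p)}"
proof
  fix vs assume "vs \<in> Poly_Mapping.keys (carry p f)"
  then obtain ls where ls: "ls \<in> Poly_Mapping.keys (dsd_gen (unit_list p))" "vs = map (vert f) ls"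
    using keys_omap[of "vert f" "dsd_gen (unit_list p)"] by (auto simp: carry_def)
  have "valid_vertex X (vert f l) \<and> vertex_image (vert f l) \<subseteq> f ` standard_simplex p" if "l \<in> set ls" for l
    using keys_dsd_unit(3)[OF ls(1) that] valid_vert[OF f, of l] by blast
  then show "vs \<in> {vs. length vs = Suc p \<and> flag vs \<and>
    (\<forall>v\<in>set vs. valid_vertex X v \<and> vertex_image v \<subseteq> f ` standard_simplex p)}"
    using keys_dsd_unit(1)[OF ls(1)] flag_vert[OF ls(1)] by (auto simp: ls(2))
qed

section \<open>The complex of singular simplices and its realization on flags\<close>

definition vertex_complex :: "'a topology \<Rightarrow> 'a set set \<Rightarrow> 'a vertex set set" where
  "vertex_complex X \<V> = {A. finite A \<and> A \<noteq> {} \<and> (\<forall>v\<in>A. valid_vertex X v) \<and>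
     (\<exists>V\<in>\<V>. \<forall>v\<in>A. vertex_image v \<subseteq> V)}"

definition flag_complex :: "'a topology \<Rightarrow> 'a set set \<Rightarrow> 'a vertex set set" where
  "flag_complex X \<V> = {A \<in> vertex_complex X \<V>. \<exists>vs. flag vs \<and> set vs = A}"

text \<open>Only the decreasing ordering of a flag is kept. Among the permuted lists in the oriented
  generator of a flag exactly one is of this form, so the generator goes to one singular simplex
  with coefficient 1.\<close>

definition flag_map :: "'a vertex list qchain \<Rightarrow> 'a singular qchain" where
  "flag_map = qlift (\<lambda>vs. if flag vs then gen (geo vs) else 0)"

lemmas flag_map_simps = qlift_simps[where h = "\<lambda>vs. if flag vs then gen (geo vs) else 0", folded flag_map_def]

lemma flag_map_gen [simp]: "flag_map (gen vs) = (if flag vs then gen (geo vs) else 0)"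
  by (simp add: flag_map_def)

lemma flag_distinct: "flag vs \<Longrightarrow> distinct vs"
  unfolding flag_def distinct_conv_nth sorted_wrt_iff_nth_less
  by (metis linorder_neqE_nat psubset_eq vface_def)

text \<open>Members of a flag have strictly nested label sets, so a set of vertices admits at most
  one decreasing ordering.\<close>

lemma flag_unique:
  assumes "flag vs" "flag ws" "set vs = set ws" shows "vs = ws"
  using assms
proof (induction vs arbitrary: ws)
  case (Cons v vs)
  then obtain w us where ws: "ws = w # us" by (cases ws) auto
  have "v = w"
  proof (rule ccontr)
    assume "v \<noteq> w"
    then have "w \<in> set vs" "v \<in> set us" using Cons.prems(3) ws by auto
    then have "vface w v" "vface v w" using Cons.prems(1,2) ws by (auto simp: flag_def)
    then show False by (auto simp: vface_def)
  qed
  moreover have "v \<notin> set vs" "w \<notin> set us"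
    using flag_distinct[OF Cons.prems(1)] flag_distinct[OF Cons.prems(2)] ws by simp_all
  ultimately have "set vs = set us" using Cons.prems(3) ws by auto
  then show ?case using Cons ws \<open>v = w\<close> by (auto simp: flag_def)
qed simp

lemma simplicial_vertex_complex: "simplicial_complex (vertex_complex X \<V>)"
  unfolding simplicial_complex_def vertex_complex_def
  using finite_subset by (auto simp: subset_iff) metis

lemma simplicial_flag_complex: "simplicial_complex (flag_complex X \<V>)"
  unfolding simplicial_complex_def
proof (intro conjI ballI allI impI)
  fix A assume A: "A \<in> flag_complex X \<V>"
  then show "finite A" "A \<noteq> {}" by (auto simp: flag_complex_def vertex_complex_def)
  fix B assume B: "B \<subseteq> A \<and> B \<noteq> {}"
  obtain vs where vs: "flag vs" "set vs = A" using A by (auto simp: flag_complex_def)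
  have "B \<in> vertex_complex X \<V>"
    using A B simplicial_vertex_complex[of X \<V>] unfolding simplicial_complex_def flag_complex_def by blast
  moreover have "flag (filter (\<lambda>v. v \<in> B) vs)" using vs(1) unfolding flag_def by (rule sorted_wrt_filter)
  moreover have "set (filter (\<lambda>v. v \<in> B) vs) = B" using B vs(2) by auto
  ultimately show "B \<in> flag_complex X \<V>" unfolding flag_complex_def by blast
qed

lemma flag_bary_in:
  assumes vs: "flag vs" "vs \<noteq> []" and v: "\<forall>v\<in>set vs. valid_vertex X v"
  shows "set (map (\<lambda>v. bary (vdom v)) vs) \<subseteq> face_simplex (vdom (hd vs))"
proof
  fix b assume "b \<in> set (map (\<lambda>v. bary (vdom v)) vs)"
  then obtain u where u: "u \<in> set vs" "b = bary (vdom u)" by auto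
  have "vdom u \<subseteq> vdom (hd vs)"
    using vs u(1) by (cases vs) (auto simp: flag_def vface_def)
  moreover have "finite (vdom (hd vs))" "finite (vdom u)" "vdom u \<noteq> {}"
    using v vs(2) u(1) by (auto simp: valid_vertex_def)
  ultimately show "b \<in> face_simplex (vdom (hd vs))"
    using bary_in[of "vdom u"] face_simplex_mono u(2) by blast
qed

lemma singular_simplex_geo:
  assumes vs: "flag vs" "vs \<noteq> []" and v: "\<forall>v\<in>set vs. valid_vertex X v"
  shows "singular_simplex (length vs - 1) X (geo vs)"
    and "geo vs ` standard_simplex (length vs - 1) \<subseteq> vertex_image (hd vs)"
proof -
  have h: "valid_vertex X (hd vs)" using vs v by simp
  show "singular_simplex (length vs - 1) X (geo vs)"
    using singular_simplex_push[OF _ _ flag_bary_in[OF vs v], of X "vfun (hd vs)"] h vs(2)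
    by (simp add: geo_def valid_vertex_def)
  show "geo vs ` standard_simplex (length vs - 1) \<subseteq> vertex_image (hd vs)"
    using push_image[OF _ flag_bary_in[OF vs v], of "vfun (hd vs)"] h vs(2)
    by (simp add: geo_def valid_vertex_def vertex_image_def)
qed

lemma map_omit: "map f (omit i xs) = omit i (map f xs)"
  by (simp add: omit_def take_map drop_map)

lemma flag_omit:
  assumes "flag vs" shows "flag (omit i vs)"
proof -
  have "sorted_wrt (\<lambda>v u. vface u v) (take i vs @ drop i vs)" using assms by (simp add: flag_def)
  moreover have "set (drop (Suc i) vs) \<subseteq> set (drop i vs)" by (rule set_drop_subset_set_drop) simp
  moreover have "sorted_wrt (\<lambda>v u. vface u v) (drop (Suc i) vs)"
    using assms unfolding flag_def by (rule sorted_wrt_drop)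
  ultimately show ?thesis unfolding flag_def omit_def sorted_wrt_append by blast
qed

text \<open>Omitting a vertex other than the head omits a barycentre. Omitting the head also
  replaces its map by that of the next vertex, which is its restriction to a face containing the
  remaining barycentres.\<close>

lemma singular_face_geo:
  assumes vs: "flag vs" "length vs = Suc (Suc k)" and v: "\<forall>v\<in>set vs. valid_vertex X v" and i: "i \<le> Suc k"
  shows "singular_face (Suc k) i (geo vs) = geo (omit i vs)"
proof -
  obtain v w us where eq: "vs = v # w # us" using vs(2) by (cases vs; cases "tl vs") auto
  have "singular_face (Suc k) i (geo vs) = push (vfun (hd vs)) (map (\<lambda>v. bary (vdom v)) (omit i vs))"
    unfolding geo_def map_omit using vs i by (intro singular_face_push) auto
  also have "\<dots> = geo (omit i vs)"
  proof (cases i)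
    case (Suc j)
    then show ?thesis by (simp add: geo_def eq omit_def)
  next
    case 0
    have wus: "flag (w # us)" "\<forall>v\<in>set (w # us). valid_vertex X v" using vs v by (auto simp: eq flag_def)
    have "push (vfun v) (map (\<lambda>v. bary (vdom v)) (w # us)) = push (vfun w) (map (\<lambda>v. bary (vdom v)) (w # us))"
    proof (rule push_eqI)
      fix t assume t: "t \<in> standard_simplex (length (map (\<lambda>v. bary (vdom v)) (w # us)) - 1)"
      have "affine_comb (map (\<lambda>v. bary (vdom v)) (w # us)) t \<in> face_simplex (vdom w)"
        using affine_comb_face[OF _ t] flag_bary_in[OF wus(1) _ wus(2)] wus(2) by (simp add: valid_vertex_def)
      moreover have "vface w v" using vs(1) by (simp add: eq flag_def)
      ultimately show "vfun v (affine_comb (map (\<lambda>v. bary (vdom v)) (w # us)) t)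
        = vfun w (affine_comb (map (\<lambda>v. bary (vdom v)) (w # us)) t)"
        by (simp add: vface_def)
    qed auto
    then show ?thesis using 0 by (simp add: geo_def eq omit_def)
  qed
  finally show ?thesis .
qed

lemma flag_map_oriented_gen:
  assumes vs: "flag vs" shows "flag_map (oriented_gen vs) = gen (geo vs)"
proof -
  let ?P = "{\<pi>. \<pi> permutes {..<length vs}}"
  have id: "\<pi> = id" if p: "\<pi> \<in> ?P" and f: "flag (permute_list \<pi> vs)" for \<pi>
  proof
    fix i
    have "permute_list \<pi> vs = vs" using p by (intro flag_unique[OF f vs]) auto
    moreover have "permute_list \<pi> vs ! i = vs ! \<pi> i" if "i < length vs"
      using p that by (intro permute_list_nth) auto
    moreover have "\<pi> i < length vs" if "i < length vs" using p that permutes_in_image[of \<pi> _ i] by auto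
    ultimately have "\<pi> i = i" if "i < length vs"
      using that flag_distinct[OF vs] by (metis nth_eq_iff_index_eq)
    moreover have "\<pi> i = i" if "\<not> i < length vs" using p that by (auto simp: permutes_def)
    ultimately show "\<pi> i = id i" by auto
  qed
  have "flag_map (oriented_gen vs) = (\<Sum>\<pi>\<in>?P. qscale (of_int (sign \<pi>)) (flag_map (gen (permute_list \<pi> vs))))"
    by (simp only: oriented_gen_gen flag_map_simps)
  also have "\<dots> = (\<Sum>\<pi>\<in>{id}. qscale (of_int (sign \<pi>)) (flag_map (gen (permute_list \<pi> vs))))"
    using id by (intro sum.mono_neutral_right) (auto simp: finite_permutations permutes_id)
  also have "\<dots> = gen (geo vs)" using vs by simp
  finally show ?thesis .
qed

lemma orient_singular_face_geo:
  assumes vs: "flag vs" "length vs = Suc (Suc k)" and v: "\<forall>v\<in>set vs. valid_vertex X v"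
  shows "flag_map (tail_bdry (oriented_gen vs)) = singular_bdry (Suc k) (flag_map (oriented_gen vs))"
proof -
  have ne: "vs \<noteq> []" using vs by auto
  have "flag_map (tail_bdry (oriented_gen vs)) = (\<Sum>i<length vs. qscale ((-1) ^ i) (flag_map (oriented_gen (omit i vs))))"
    unfolding tail_bdry_oriented_gen[OF ne] obd_gen_expand qlift_simps qlift_gen flag_map_simps ..
  also have "\<dots> = (\<Sum>i\<le>Suc k. qscale ((-1) ^ i) (gen (singular_face (Suc k) i (geo vs))))"
    unfolding vs(2) lessThan_Suc_atMost
    by (intro sum.cong) (auto simp: flag_map_oriented_gen[OF flag_omit[OF vs(1)]] singular_face_geo[OF vs v])
  finally show ?thesis by (simp add: flag_map_oriented_gen[OF vs(1)] singular_bdry_gen del: sum.atMost_Suc)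
qed

text \<open>Boundaries are compared on oriented generators; an arbitrary ordering of a flag differs
  from the decreasing one by a permutation, whose sign both sides share.\<close>

lemma flag_map_chain_morphism:
  "chain_morphism (oriented_complex (flag_complex X \<V>)) (singular_complex X) (\<lambda>_. flag_map)"
  (is "chain_morphism (oriented_complex ?L) _ _")
proof -
  have keys: "length vs = Suc p \<and> (\<forall>v\<in>set vs. valid_vertex X v)"
    if "c \<in> oriented_chains ?L p" "vs \<in> Poly_Mapping.keys c" for c p vs
    using that by (auto simp: oriented_chains_def flag_complex_def vertex_complex_def)
  have into: "flag_map c \<in> ss_chains p X" if c: "c \<in> oriented_chains ?L p" for p c
    unfolding flag_map_def
  proof (rule qlift_in_subspace[OF subspace_ss_chains])
    fix vs assume "vs \<in> Poly_Mapping.keys c"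
    then have "length vs = Suc p" "\<forall>v\<in>set vs. valid_vertex X v" using keys[OF c] by auto
    then show "(if flag vs then gen (geo vs) else 0) \<in> ss_chains p X"
      using singular_simplex_geo(1)[of vs X] by (cases vs) auto
  qed
  have tl: "qlinear_on S tail_bdry" for S :: "'a vertex list qchain set"
    unfolding tail_bdry_def by (rule qlift_linear)
  have bd: "flag_map (tail_bdry c) = singular_bdry (Suc p) (flag_map c)"
    if c: "c \<in> oriented_chains ?L (Suc p)" for p c
  proof (rule oriented_linear_eqI[OF _ _ _ c])
    show "qlinear_on (oriented_chains ?L (Suc p)) (\<lambda>c. flag_map (tail_bdry c))"
      by (simp add: qlinear_on_def tail_bdry_def qlift_simps flag_map_simps)
    show "qlinear_on (oriented_chains ?L (Suc p)) (\<lambda>c. singular_bdry (Suc p) (flag_map c))"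
      by (simp add: qlinear_on_def flag_map_simps singular_bdry_add singular_bdry_scale)
    fix vs :: "'a vertex list" assume vs: "length vs = Suc (Suc p)" "distinct vs" "set vs \<in> ?L"
    then obtain ws where ws: "flag ws" "set ws = set vs" by (auto simp: flag_complex_def)
    have "mset vs = mset ws" using vs(2) ws flag_distinct set_eq_iff_mset_eq_distinct by metis
    then obtain \<pi> where \<pi>: "\<pi> permutes {..<length ws}" "permute_list \<pi> ws = vs"
      using mset_eq_permutation by blast
    have len: "length ws = Suc (Suc p)" using \<pi>(2) vs(1) by auto
    have "\<forall>v\<in>set ws. valid_vertex X v" using vs(3) ws(2) by (auto simp: flag_complex_def vertex_complex_def)
    note e = orient_singular_face_geo[OF ws(1) len this]
    show "flag_map (tail_bdry (oriented_gen vs)) = singular_bdry (Suc p) (flag_map (oriented_gen vs))"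
      unfolding \<pi>(2)[symmetric] oriented_gen_permute[OF \<pi>(1)]
      using e by (simp add: tail_bdry_def qlift_scale flag_map_simps singular_bdry_scale)
  qed
  have aug: "augmentation (flag_map c) = augmentation c" if c: "c \<in> oriented_chains ?L 0" for c
    unfolding flag_map_def
  proof (rule augmentation_qlift_1)
    fix vs assume "vs \<in> Poly_Mapping.keys c"
    then have "length vs = Suc 0" using keys[OF c] by auto
    then obtain v where "vs = [v]" by (cases vs) auto
    then show "augmentation (if flag vs then gen (geo vs) else 0) = 1" by (simp add: flag_def)
  qed
  show ?thesis
    unfolding chain_morphism_def
    using into bd aug by (auto simp: oriented_complex_def flag_map_simps oriented_bdry_eq simp del: mem_Collect_eq)
qed

lemma chain_support_flag_map:
  assumes "distinct vs" "vs \<noteq> []" "\<forall>v\<in>set vs. valid_vertex X v \<and> vertex_image v \<subseteq> V"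
  shows "chain_support (length vs - 1) (flag_map (oriented_gen vs)) \<subseteq> V"
proof -
  have "f ` standard_simplex (length vs - 1) \<subseteq> V" if f: "f \<in> Poly_Mapping.keys (flag_map (oriented_gen vs))" for f
  proof -
    obtain ws where ws: "ws \<in> Poly_Mapping.keys (oriented_gen vs)" "flag ws" "f = geo ws"
      using f keys_qlift[of "\<lambda>vs. if flag vs then gen (geo vs) else 0" "oriented_gen vs"]
      unfolding flag_map_def by (auto split: if_splits)
    have m: "mset ws = mset vs" using permutes_length_keys[of vs] ws(1) by auto
    then have "set ws = set vs" "length ws = length vs" using mset_eq_setD mset_eq_length by blast+
    moreover from this have "ws \<noteq> []" using assms(2) by auto
    ultimately show ?thesis
      using singular_simplex_geo(2)[OF ws(2), of X] assms(3) ws(3) list.set_sel(1)[of ws] by force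
  qed
  then show ?thesis by (auto simp: chain_support_def)
qed

text \<open>The partial realization to which the retract property will be applied. It is small
  because the simplex of a flag lies in the image of its head, and single vertices belong to
  \<open>flag_complex\<close> as flags of length one.\<close>

lemma partial_realization_flag_map:
  "partial_realization X \<V> (vertex_complex X \<V>) (flag_complex X \<V>) (\<lambda>_. flag_map)"
  unfolding partial_realization_def
proof (intro conjI allI impI ballI)
  fix v assume "{v} \<in> vertex_complex X \<V>"
  moreover have "flag [v]" "set [v] = {v}" by (auto simp: flag_def)
  ultimately show "{v} \<in> flag_complex X \<V>" unfolding flag_complex_def by blast
next
  fix A assume A: "A \<in> vertex_complex X \<V>"
  then obtain V where V: "V \<in> \<V>" "\<forall>v\<in>A. vertex_image v \<subseteq> V" by (auto simp: vertex_complex_def)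
  show "\<exists>U\<in>\<V>. \<forall>\<tau>\<in>flag_complex X \<V>. \<tau> \<subseteq> A \<longrightarrow> (\<forall>vs. distinct vs \<and> set vs = \<tau> \<longrightarrow>
      chain_support (length vs - 1) (flag_map (oriented_gen vs)) \<subseteq> U)"
  proof (intro bexI[OF _ V(1)] ballI impI allI)
    fix \<tau> vs assume "\<tau> \<in> flag_complex X \<V>" "\<tau> \<subseteq> A" "distinct vs \<and> set vs = \<tau>"
    then show "chain_support (length vs - 1) (flag_map (oriented_gen vs)) \<subseteq> V"
      using V(2) A by (intro chain_support_flag_map[where X = X])
        (auto simp: flag_complex_def vertex_complex_def)
  qed
qed (auto simp: simplicial_flag_complex flag_map_chain_morphism, auto simp: flag_complex_def)

text \<open>This fixes the realization on \<open>carry p f\<close> as the geometric double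
  subdivision of \<open>f\<close>, to which \<open>bsd_homologous\<close> applies.\<close>

lemma flag_map_orient_carry:
  assumes f: "singular_simplex p X f"
  shows "flag_map (orient (carry p f)) = push_chain f (bsd_gen (unit_list p))"
proof -
  have "flag_map (orient (carry p f)) = qlift (\<lambda>ls. flag_map (oriented_gen (map (vert f) ls))) (dsd_gen (unit_list p))"
    by (simp add: carry_def orient_def omap_def flag_map_def qlift_qlift)
  also have "\<dots> = qlift (\<lambda>ls. gen (push f (map unlabel ls))) (dsd_gen (unit_list p))"
    by (intro qlift_cong) (simp add: flag_map_oriented_gen[OF flag_vert] geo_vert)
  finally show ?thesis
    by (simp add: push_chain_def bsd_gen_def omap_def qlift_qlift)
qed

section \<open>Acyclic carriers\<close>

text \<open>A homotopy \<open>D\<close> with boundary \<open>A - D \<partial>\<close>, built degree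
  by degree by coning off this chain from the vertex \<open>w p f\<close>. A cone over a carried
  chain is carried if its apex is, so the fillings are explicit.\<close>

primrec carrier_htpy :: "(nat \<Rightarrow> 'a singular \<Rightarrow> 'v list qchain) \<Rightarrow> (nat \<Rightarrow> 'a singular \<Rightarrow> 'v) \<Rightarrow>
    nat \<Rightarrow> 'a singular \<Rightarrow> 'v list qchain" where
  "carrier_htpy A w 0 = (\<lambda>f. ocone (w 0 f) (A 0 f))"
| "carrier_htpy A w (Suc p) = (\<lambda>f. ocone (w (Suc p) f)
     (A (Suc p) f - qlift (carrier_htpy A w p) (singular_bdry (Suc p) (gen f))))"

text \<open>Here \<open>A\<close> is the difference of two augmentation-preserving chain maps, both carried by \<open>Q\<close>.\<close>

lemma carrier_homotopy:
  fixes Y :: "'a topology" and A :: "nat \<Rightarrow> 'a singular \<Rightarrow> 'v list qchain"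
  assumes A0: "\<And>f. obd (A 0 f) = 0"
    and A_Suc: "\<And>p f. obd (A (Suc p) f) = qlift (A p) (singular_bdry (Suc p) (gen f))"
    and keys_A: "\<And>p f. singular_simplex p Y f \<Longrightarrow>
      Poly_Mapping.keys (A p f) \<subseteq> {vs. length vs = Suc p \<and> (\<forall>v\<in>set vs. Q (f ` standard_simplex p) v)}"
    and w: "\<And>p f. singular_simplex p Y f \<Longrightarrow> Q (f ` standard_simplex p) (w p f)"
    and mono: "\<And>S T v. S \<subseteq> T \<Longrightarrow> Q S v \<Longrightarrow> Q T v"
  shows "singular_simplex p Y f \<Longrightarrow> Poly_Mapping.keys (carrier_htpy A w p f)
      \<subseteq> {vs. length vs = Suc (Suc p) \<and> (\<forall>v\<in>set vs. Q (f ` standard_simplex p) v)}" (is "_ \<Longrightarrow> ?keys p f")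
    and "c \<in> ss_chains p Y \<Longrightarrow> obd (qlift (carrier_htpy A w p) c)
      = qlift (A p) c - (if p = 0 then 0 else qlift (carrier_htpy A w (p - 1)) (singular_bdry p c))"
proof -
  let ?D = "carrier_htpy A w"
  have cone_keys: "Poly_Mapping.keys (ocone (w p f) b) \<subseteq> {vs. length vs = Suc (Suc p) \<and> (\<forall>v\<in>set vs. Q (f ` standard_simplex p) v)}"
    if "singular_simplex p Y f" "Poly_Mapping.keys b \<subseteq> {vs. length vs = Suc p \<and> (\<forall>v\<in>set vs. Q (f ` standard_simplex p) v)}"
    for p f b
  proof -
    have "(#) (w p f) ` {vs. length vs = Suc p \<and> (\<forall>v\<in>set vs. Q (f ` standard_simplex p) v)}
      \<subseteq> {vs. length vs = Suc (Suc p) \<and> (\<forall>v\<in>set vs. Q (f ` standard_simplex p) v)}"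
      using w[OF that(1)] by auto
    then show ?thesis
      using order_trans[OF keys_ocone image_mono[OF that(2)]] by blast
  qed
  show keys: "?keys p f" if "singular_simplex p Y f" for p f
    using that
  proof (induction p arbitrary: f)
    case 0
    then show ?case using cone_keys[OF 0 keys_A[OF 0]] by simp
  next
    case (Suc p)
    have "Poly_Mapping.keys (qlift (?D p) (singular_bdry (Suc p) (gen f)))
      \<subseteq> {vs. length vs = Suc (Suc p) \<and> (\<forall>v\<in>set vs. Q (f ` standard_simplex (Suc p)) v)}"
      unfolding singular_bdry_gen qlift_sum qlift_scale qlift_gen
    proof (intro keys_sub_sum keys_sub_scale)
      fix k assume k: "k \<in> {..Suc p}"
      have "singular_simplex p Y (singular_face (Suc p) k f)"
        using singular_simplex_singular_face[OF Suc.prems, of k] k by simp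
      then have "Poly_Mapping.keys (?D p (singular_face (Suc p) k f)) \<subseteq> {vs. length vs = Suc (Suc p) \<and>
          (\<forall>v\<in>set vs. Q (singular_face (Suc p) k f ` standard_simplex p) v)}"
        by (rule Suc.IH)
      also have "\<dots> \<subseteq> {vs. length vs = Suc (Suc p) \<and> (\<forall>v\<in>set vs. Q (f ` standard_simplex (Suc p)) v)}"
        using mono[OF singular_face_image[of k p f]] k by auto
      finally show "Poly_Mapping.keys (?D p (singular_face (Suc p) k f))
        \<subseteq> {vs. length vs = Suc (Suc p) \<and> (\<forall>v\<in>set vs. Q (f ` standard_simplex (Suc p)) v)}" .
    qed
    then show ?case
      using cone_keys[OF Suc.prems keys_sub_diff[OF keys_A[OF Suc.prems]]] by simp
  qed
  show "obd (qlift (?D p) c) = qlift (A p) c - (if p = 0 then 0 else qlift (?D (p - 1)) (singular_bdry p c))"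
    if "c \<in> ss_chains p Y" for p c
    using that
  proof (induction p arbitrary: c)
    case 0
    have "obd (?D 0 f) = A 0 f" for f by (simp add: obd_ocone A0)
    then show ?case by (simp add: obd_def qlift_qlift)
  next
    case (Suc p)
    have pt: "obd (?D (Suc p) f) = A (Suc p) f - qlift (?D p) (singular_bdry (Suc p) (gen f))"
      if f: "f \<in> Poly_Mapping.keys c" for f
    proof -
      have g: "gen f \<in> ss_chains (Suc p) Y" using Suc.prems f by auto
      have bb: "singular_bdry p (singular_bdry (Suc p) (gen f)) = 0" by (rule singular_bdry_bdry[OF g])
      \<comment> \<open>The chain to be coned off is a cycle, by the induction hypothesis for the
        boundary of \<open>f\<close> and the naturality of \<open>A\<close>.\<close>
      have "obd (A (Suc p) f - qlift (?D p) (singular_bdry (Suc p) (gen f))) = 0"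
        using Suc.IH[OF singular_bdry_in[OF g]] by (simp add: obd_simps A_Suc bb)
      then show ?thesis by (simp add: obd_ocone)
    qed
    have "obd (qlift (?D (Suc p)) c) = qlift (\<lambda>f. A (Suc p) f - qlift (?D p) (singular_bdry (Suc p) (gen f))) c"
      unfolding obd_def qlift_qlift by (rule qlift_cong[OF pt[unfolded obd_def]])
    also have "\<dots> = qlift (A (Suc p)) c - qlift (?D p) (singular_bdry (Suc p) c)"
      by (simp add: qlift_fun_diff singular_bdry_expand[of "Suc p" c] qlift_qlift)
    finally show ?case by simp
  qed
qed

section \<open>Traces of displacing maps on oriented chains\<close>

lemma oriented_linear_expand:
  assumes f: "qlinear_on (oriented_chains K p) f" and c: "c \<in> oriented_chains K p"
  shows "f c = qscale (1 / fact (Suc p))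
    (\<Sum>vs\<in>Poly_Mapping.keys c. qscale (Poly_Mapping.lookup c vs) (f (oriented_gen vs)))"
proof -
  note sub = subspace_oriented_chains[of K p]
  have in_ch: "oriented_gen vs \<in> oriented_chains K p" if "vs \<in> Poly_Mapping.keys c" for vs
    using c that by (intro oriented_gen_in_chains) (auto simp: oriented_chains_def)
  have oc: "orient c \<in> oriented_chains K p"
    unfolding orient_def by (rule qlift_in_subspace[OF sub in_ch])
  have "f (orient c) = (\<Sum>vs\<in>Poly_Mapping.keys c. qscale (Poly_Mapping.lookup c vs) (f (oriented_gen vs)))"
    unfolding orient_def qlift_def by (rule qlinear_on_sum[OF f in_ch sub])
  then show ?thesis
    using oriented_chain_eq[OF c] qlinear_onD(2)[OF f oc, of "1 / fact (Suc p)"] by metis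
qed

lemma oriented_linear_in:
  assumes f: "qlinear_on (oriented_chains K p) f" and c: "c \<in> oriented_chains K p" and T: "qvs.subspace T"
    and gen: "\<And>vs. length vs = Suc p \<Longrightarrow> distinct vs \<Longrightarrow> set vs \<in> K \<Longrightarrow> f (oriented_gen vs) \<in> T"
  shows "f c \<in> T"
  unfolding oriented_linear_expand[OF f c]
  using c by (intro qvs.subspace_scale[OF T] qvs.subspace_sum[OF T] gen) (auto simp: oriented_chains_def)

lemma lookup_oriented_gen_self: "distinct vs \<Longrightarrow> Poly_Mapping.lookup (oriented_gen vs) vs = 1"
proof -
  assume d: "distinct vs"
  let ?P = "{\<pi>. \<pi> permutes {..<length vs}}"
  have id: "\<pi> = id" if p: "\<pi> \<in> ?P" and e: "permute_list \<pi> vs = vs" for \<pi>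
  proof
    fix i
    show "\<pi> i = id i"
    proof (cases "i < length vs")
      case True
      then have "vs ! \<pi> i = vs ! i" using permute_list_nth[of \<pi> vs i] p e by simp
      moreover have "\<pi> i < length vs" using p True permutes_in_image[of \<pi> _ i] by auto
      ultimately show ?thesis using d True nth_eq_iff_index_eq by auto
    next
      case False
      then show ?thesis using p by (simp add: permutes_def)
    qed
  qed
  have "Poly_Mapping.lookup (oriented_gen vs) vs
      = (\<Sum>\<pi>\<in>?P. of_int (sign \<pi>) * (if permute_list \<pi> vs = vs then 1 else 0))"
    by (simp add: oriented_gen_gen lookup_sum lookup_gen)
  also have "\<dots> = (\<Sum>\<pi>\<in>{id}. of_int (sign \<pi>) * (if permute_list \<pi> vs = vs then 1 else 0))"
    using id by (intro sum.mono_neutral_right) (auto simp: finite_permutations permutes_id)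
  finally show ?thesis by simp
qed

lemma lookup_oriented_gen_other: "set vs \<noteq> set ws \<Longrightarrow> Poly_Mapping.lookup (oriented_gen vs) ws = 0"
  using permutes_length_keys[of vs] by (force simp: in_keys_iff dest: mset_eq_setD)

text \<open>With one oriented generator for each simplex as basis, the diagonal entries of
  \<open>T\<close> are the coefficients that \<open>disp\<close> makes zero.\<close>

lemma displacing_trace:
  assumes fin: "finite {A \<in> K. card A = Suc p}" and K: "simplicial_complex K"
    and T: "qlinear_on (oriented_chains K p) T" "\<And>c. c \<in> oriented_chains K p \<Longrightarrow> T c \<in> oriented_chains K p"
    and disp: "\<And>vs. length vs = Suc p \<Longrightarrow> distinct vs \<Longrightarrow> set vs \<in> K \<Longrightarrow>
      Poly_Mapping.lookup (T (oriented_gen vs)) vs = 0"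
  shows "has_qtrace (oriented_chains K p) {0} T 0"
proof -
  define As where "As = {A \<in> K. card A = Suc p}"
  define ord where "ord = (\<lambda>A :: 'a set. SOME vs. distinct vs \<and> set vs = A)"
  have ord: "distinct (ord A)" "set (ord A) = A" "length (ord A) = Suc p" if "A \<in> As" for A
  proof -
    have "finite A" using that K by (auto simp: As_def simplicial_complex_def)
    then have "\<exists>vs. distinct vs \<and> set vs = A" using finite_distinct_list by blast
    then have *: "distinct (ord A) \<and> set (ord A) = A" unfolding ord_def by (rule someI_ex)
    then show "distinct (ord A)" "set (ord A) = A" by auto
    show "length (ord A) = Suc p" using * that distinct_card[of "ord A"] by (auto simp: As_def)
  qed
  define g where "g = (\<lambda>A. oriented_gen (ord A))"
  have lk: "Poly_Mapping.lookup (g A) (ord A') = (if A = A' then 1 else 0)" if "A \<in> As" "A' \<in> As" for A A'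
    using ord[OF that(1)] ord[OF that(2)] by (simp add: g_def lookup_oriented_gen_self lookup_oriented_gen_other)
  have inj: "inj_on g As"
    by (rule inj_onI) (metis lk zero_neq_one)
  have g_in: "g A \<in> oriented_chains K p" if "A \<in> As" for A
    unfolding g_def using ord[OF that] that by (intro oriented_gen_in_chains) (auto simp: As_def)
  have finA: "finite As" using fin by (simp add: As_def)
  have expand: "c = (\<Sum>A\<in>As. qscale (Poly_Mapping.lookup c (ord A)) (g A))" if c: "c \<in> oriented_chains K p" for c
  proof (rule oriented_linear_eqI[OF _ _ _ c, where f = "\<lambda>c. c"])
    show "qlinear_on (oriented_chains K p) (\<lambda>c. \<Sum>A\<in>As. qscale (Poly_Mapping.lookup c (ord A)) (g A))"
      by (simp add: qlinear_on_def lookup_add qvs.scale_left_distrib sum.distrib qvs.scale_sum_right)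
    fix vs :: "'a list" assume vs: "length vs = Suc p" "distinct vs" "set vs \<in> K"
    then have A: "set vs \<in> As" by (simp add: As_def distinct_card)
    have "mset vs = mset (ord (set vs))"
      using vs(2) ord[OF A] set_eq_iff_mset_eq_distinct by metis
    then obtain \<pi> where \<pi>: "\<pi> permutes {..<length (ord (set vs))}" "permute_list \<pi> (ord (set vs)) = vs"
      using mset_eq_permutation by blast
    have e: "oriented_gen vs = qscale (of_int (sign \<pi>)) (g (set vs))"
      using oriented_gen_permute[OF \<pi>(1)] \<pi>(2) by (simp add: g_def)
    have "(\<Sum>A\<in>As. qscale (Poly_Mapping.lookup (oriented_gen vs) (ord A)) (g A))
        = (\<Sum>A\<in>As. if A = set vs then qscale (of_int (sign \<pi>)) (g A) else 0)"
      by (rule sum.cong) (auto simp: e lk A)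
    then show "oriented_gen vs = (\<Sum>A\<in>As. qscale (Poly_Mapping.lookup (oriented_gen vs) (ord A)) (g A))"
      using A finA by (simp add: e)
  qed (simp add: qlinear_on_def)
  have lc: "lincomb (g ` As) a = (\<Sum>A\<in>As. qscale (a (g A)) (g A))" for a
    unfolding lincomb_def using inj by (simp add: sum.reindex)
  define co where "co = (\<lambda>(c :: 'a list qchain) e. Poly_Mapping.lookup c (ord (inv_into As g e)))"
  have lc_co: "c = lincomb (g ` As) (co c)" if "c \<in> oriented_chains K p" for c
    unfolding lc co_def using inj expand[OF that] by simp
  have "qbasis (oriented_chains K p) {0} (g ` As)"
    unfolding qbasis_def
  proof (intro conjI ballI allI impI)
    fix c assume "c \<in> oriented_chains K p"
    then have "c - lincomb (g ` As) (co c) = 0" using lc_co by simp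
    then show "\<exists>a. c - lincomb (g ` As) a \<in> {0}" by blast
  next
    fix a e assume a: "lincomb (g ` As) a \<in> {0}" and "e \<in> g ` As"
    then obtain A where A: "A \<in> As" "e = g A" by auto
    have "0 = Poly_Mapping.lookup (lincomb (g ` As) a) (ord A)" using a by simp
    also have "\<dots> = (\<Sum>A'\<in>As. if A' = A then a (g A') else 0)"
      unfolding lc lookup_sum lookup_qscale using A by (intro sum.cong) (auto simp: lk)
    finally show "a e = 0" using A finA by simp
  qed (use finA g_in in auto)
  moreover have "T e - lincomb (g ` As) (co (T e)) \<in> {0}" if e: "e \<in> g ` As" for e
    using lc_co[OF T(2)] e g_in by auto
  moreover have "(\<Sum>e\<in>g ` As. co (T e) e) = 0"
  proof (rule sum.neutral, rule ballI)
    fix e assume "e \<in> g ` As"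
    then obtain A where A: "A \<in> As" "e = g A" by auto
    then have "inv_into As g e = A" using inj by simp
    then show "co (T e) e = 0"
      using disp[of "ord A"] ord[OF A(1)] A by (simp add: co_def g_def As_def)
  qed
  ultimately show ?thesis
    unfolding has_qtrace_def by (intro exI[of _ "g ` As"] exI[of _ "\<lambda>e' e. co (T e) e'"]) auto
qed

section \<open>Lefschetz numbers of acyclic spaces\<close>

text \<open>Here the homology is the rationals in degree 0 and zero above. A morphism that preserves
  augmentations acts as the identity in degree 0, so the only trace left is 1.\<close>

lemma Lefschetz_reduced_homology_zero:
  fixes X :: "'a topology"
  assumes V: "open_cover X \<V>" and f: "chain_morphism (small_singular_complex X \<V>) (singular_complex X) \<phi>"
    and red: "reduced_homology_zero (singular_complex X)"
  shows "Lefschetz X \<V> \<phi> = 1"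
proof -
  let ?X = "singular_complex X" and ?S = "small_singular_complex X \<V>"
  have op: "\<And>U. U \<in> \<V> \<Longrightarrow> openin X U" "topspace X \<subseteq> \<Union>\<V>" using V by (auto simp: open_cover_def)
  have sB: "qvs.subspace (boundaries ?X q)" for q by (rule subspace_singular_boundaries)
  have triv: "Z \<subseteq> B" if "qvs.subspace B" "coset B ` Z = {B}" for Z B :: "'a singular qchain set"
    using that coset_eq[OF that(1), of _ 0] by (metis coset_0 diff_zero imageI singletonD subsetI)
  have red_q: "(if q = 0 then {c \<in> chains ?X 0. augmentation c = 0} else cycles ?X q) \<subseteq> boundaries ?X q" for q
    using red triv[OF sB[of q]] unfolding reduced_homology_zero_def reduced_homology_def by simp
  define A where "A = augmentation ` chains ?X 0"
  \<comment> \<open>Vanishing in degree -1 says that the augmentation is onto; this supplies a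
    0-chain \<open>c0\<close> of augmentation 1.\<close>
  have "coset A ` UNIV = {A}"
    using red unfolding reduced_homology_zero_def reduced_homology_minus_one_def A_def by (simp add: quotient_space_def)
  then have "coset A 1 = A" by blast
  moreover have "(0::rat) \<in> A" unfolding A_def by (rule image_eqI[of _ _ 0]) auto
  then have "1 \<in> coset A 1" by (simp add: in_coset)
  ultimately have "1 \<in> A" by simp
  then obtain c0 where c0: "c0 \<in> chains ?X 0" "augmentation c0 = 1" by (auto simp: A_def)
  have cyc0: "cycles C 0 = chains C 0" if "bdry C = singular_bdry" for C :: "'a singular qcomplex"
    using that by (simp add: cycles_def)
  have aug_B: "augmentation b = 0" if b: "b \<in> boundaries ?X 0" for b
  proof -
    obtain c where c: "c \<in> ss_chains (Suc 0) X" "b = singular_bdry (Suc 0) c"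
      using b by (auto simp: boundaries_def)
    have "Poly_Mapping.keys c \<subseteq> UNIV" by simp
    then have "augmentation (singular_bdry (Suc 0) c) = 0"
      by (induction rule: qchain_induct)
        (auto simp: singular_bdry_gen augmentation_simps singular_bdry_add singular_bdry_scale)
    then show ?thesis using c by simp
  qed
  have T0: "induced_endo X \<V> \<phi> 0 (coset (boundaries ?X 0) z) = coset (boundaries ?X 0) z"
    if z: "z \<in> cycles ?X 0" for z
  proof -
    obtain w where w: "w \<in> cycles ?S 0" "z - w \<in> boundaries ?X 0"
      using cycle_small_exists[OF op z] by blast
    have wc: "w \<in> chains ?S 0" using w(1) by (simp add: cycles_def)
    have "augmentation (\<phi> 0 w) = augmentation w" "\<phi> 0 w \<in> chains ?X 0"
      using f wc unfolding chain_morphism_def by (elim conjE; simp)+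
    moreover have "augmentation z = augmentation w"
      using aug_B[OF w(2)] by (simp add: augmentation_diff)
    moreover have "z \<in> chains ?X 0" using z by (simp add: cycles_def)
    ultimately have "\<phi> 0 w - z \<in> {c \<in> chains ?X 0. augmentation c = 0}"
      by (simp add: augmentation_diff keys_sub_diff)
    then have "\<phi> 0 w - z \<in> boundaries ?X 0" using red_q[of 0] by auto
    then show ?thesis
      using induced_endo_coset[OF V f z w] coset_eq[OF sB] by simp
  qed
  have s0: "qvs.subspace {0 :: 'a singular qchain}" by (rule qvs.subspace_single_0)
  have tr0: "trace_fin_rank (homology ?X 0) (induced_endo X \<V> \<phi> 0) = 1"
    unfolding homology_eq
  \<comment> \<open>In degree 0 the map factors through the line spanned by \<open>c0\<close>: the
    augmentation maps a cycle to this line, and the inclusion brings it back.\<close>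
  proof (rule trace_fin_rank_factor[OF qpair_singular, where F = "{c0}" and Z' = "qvs.span {c0}" and B' = "{0}"
        and R = "\<lambda>z. qscale (augmentation z) c0" and P = "\<lambda>z. z" and f = "\<lambda>z. z"])
    have sub: "qvs.span {c0} \<subseteq> cycles ?X 0"
      using c0 subspace_ss_chains[of 0 X] by (intro qvs.span_minimal) (auto simp: cyc0)
    show p: "qpair (qvs.span {c0}) {0}" using s0 by (auto simp: qpair_def qvs.span_zero)
    show "qmorph (cycles ?X 0) (boundaries ?X 0) (qvs.span {c0}) {0} (\<lambda>z. qscale (augmentation z) c0)"
      unfolding qmorph_def
      by (auto simp: augmentation_simps qvs.scale_left_distrib aug_B intro: qvs.span_scale qvs.span_base)
    show "qmorph (qvs.span {c0}) {0} (cycles ?X 0) (boundaries ?X 0) (\<lambda>z. z)"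
      using p sub sB[of 0] qvs.subspace_0 by (intro qmorph_id qpair_singular) auto
    show "qmorph (qvs.span {c0}) {0} (qvs.span {c0}) {0} (\<lambda>z. z)"
      using p by (intro qmorph_id) auto
    show "induced_endo X \<V> \<phi> 0 (coset (boundaries ?X 0) z) = coset (boundaries ?X 0) (qscale (augmentation z) c0)"
      if z: "z \<in> cycles ?X 0" for z
    proof -
      have "z \<in> ss_chains 0 X" "c0 \<in> ss_chains 0 X" using z c0 by (simp_all add: cyc0)
      then have "z - qscale (augmentation z) c0 \<in> ss_chains 0 X"
        by (intro qvs.subspace_diff[OF subspace_ss_chains] qvs.subspace_scale[OF subspace_ss_chains])
      then have "z - qscale (augmentation z) c0 \<in> {c \<in> chains ?X 0. augmentation c = 0}"
        using c0(2) by (simp add: augmentation_simps)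
      then have "z - qscale (augmentation z) c0 \<in> boundaries ?X 0" using red_q[of 0] by auto
      then show ?thesis unfolding T0[OF z] coset_eq[OF sB] .
    qed
    have sp: "\<exists>r. z = qscale r c0" if "z \<in> qvs.span {c0}" for z
      using that by (auto simp: qvs.span_singleton)
    show "z - qscale (augmentation z) c0 \<in> {0}" if "z \<in> qvs.span {c0}" for z
      using sp[OF that] c0(2) by (auto simp: augmentation_scale)
    have "c0 \<noteq> 0" using c0(2) by auto
    then show "has_qtrace (qvs.span {c0}) {0} (\<lambda>z. z) 1"
      unfolding has_qtrace_def
      by (intro exI[of _ "{c0}"] exI[of _ "\<lambda>_ _. 1"])
        (auto simp: qbasis_def lincomb_def qvs.span_base dest!: sp)
  qed auto
  have trq: "trace_fin_rank (homology ?X q) (induced_endo X \<V> \<phi> q) = 0" if q: "q \<noteq> 0" for q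
    unfolding homology_eq
  proof (rule trace_fin_rank_factor[OF qpair_singular, where F = "{}" and Z' = "{0}" and B' = "{0}"
        and R = "\<lambda>z. 0" and P = "\<lambda>z. 0" and f = "\<lambda>z. 0"])
    show p: "qpair {0} {0 :: 'a singular qchain}" using s0 by (auto simp: qpair_def)
    fix z assume z: "z \<in> cycles ?X q"
    obtain w where w: "w \<in> cycles ?S q" "z - w \<in> boundaries ?X q"
      using cycle_small_exists[OF op z] by blast
    have subS: "\<And>p. qvs.subspace (chains ?S p)" by (simp add: subspace_keys del: mem_Collect_eq)
    have "\<phi> q w \<in> cycles ?X q"
      by (rule qmorphD(1)[OF chain_morphism_qmorph[OF f subS _ qpair_singular qpair_small] w(1)])
        (use q in simp)
    then have "\<phi> q w - 0 \<in> boundaries ?X q" using red_q[of q] q by auto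
    then show "induced_endo X \<V> \<phi> q (coset (boundaries ?X q) z) = coset (boundaries ?X q) 0"
      unfolding induced_endo_coset[OF V f z w] coset_eq[OF sB] .
  qed (use sB qpair_singular[of X q] qvs.subspace_0 in \<open>auto simp: qmorph_def qpair_def has_qtrace_zero\<close>)
  have "{q. trace_fin_rank (homology ?X q) (induced_endo X \<V> \<phi> q) \<noteq> 0} = {0}"
    using tr0 trq by auto
  then show ?thesis unfolding Lefschetz_def Let_def by (simp add: tr0)
qed

section \<open>Homology of oriented complexes\<close>

lemma oriented_bdry_in:
  assumes K: "simplicial_complex K" and c: "c \<in> oriented_chains K (Suc p)"
  shows "tail_bdry c \<in> oriented_chains K p"
proof (rule oriented_linear_in[OF _ c subspace_oriented_chains])
  show "qlinear_on (oriented_chains K (Suc p)) tail_bdry"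
    unfolding tail_bdry_def by (rule qlift_linear)
  fix vs :: "'a list" assume vs: "length vs = Suc (Suc p)" "distinct vs" "set vs \<in> K"
  then have ne: "vs \<noteq> []" by auto
  show "tail_bdry (oriented_gen vs) \<in> oriented_chains K p"
    unfolding tail_bdry_oriented_gen[OF ne]
  proof (intro qlift_in_subspace[OF subspace_oriented_chains] oriented_gen_in_chains)
    fix ws assume "ws \<in> Poly_Mapping.keys (obd_gen vs)"
    then have ws: "Suc (length ws) = length vs" "set ws \<subseteq> set vs" using keys_obd_gen[of vs] by auto
    then show "length ws = Suc p" using vs(1) by simp
    then have "set ws \<noteq> {}" by auto
    then show "set ws \<in> K" using K vs(3) ws(2) unfolding simplicial_complex_def by blast
  qed
qed

lemma tail_bdry_tail_bdry:
  assumes c: "c \<in> oriented_chains K (Suc (Suc p))" shows "tail_bdry (tail_bdry c) = 0"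
proof -
  have "tail_bdry (tail_bdry c) \<in> {0}"
  proof (rule oriented_linear_in[OF _ c])
    show "qlinear_on (oriented_chains K (Suc (Suc p))) (\<lambda>c. tail_bdry (tail_bdry c))"
      by (simp add: qlinear_on_def tail_bdry_def qlift_simps)
    fix vs :: "'a list" assume vs: "length vs = Suc (Suc (Suc p))"
    then have ne: "vs \<noteq> []" by auto
    have "Poly_Mapping.keys (obd_gen vs) \<subseteq> {ws. ws \<noteq> []}" using keys_obd_gen[of vs] vs by auto
    then have "tail_bdry (qlift oriented_gen (obd_gen vs)) = 0"
      using tail_bdry_orient[of "obd_gen vs"] by (simp add: orient_def obd_obd_gen)
    then show "tail_bdry (tail_bdry (oriented_gen vs)) \<in> {0}"
      unfolding tail_bdry_oriented_gen[OF ne] by simp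
  qed (rule qvs.subspace_single_0)
  then show ?thesis by simp
qed

lemma chains_oriented [simp]: "chains (oriented_complex K) = oriented_chains K"
  "bdry (oriented_complex K) = oriented_bdry"
  by (simp_all add: oriented_complex_def)

lemma oriented_bdry_linear: "qlinear_on S (oriented_bdry p)"
  by (simp add: qlinear_on_def oriented_bdry_eq tail_bdry_def qlift_simps)

lemma oriented_bdry_oriented_bdry:
  "c \<in> oriented_chains K (Suc p) \<Longrightarrow> oriented_bdry p (oriented_bdry (Suc p) c) = 0"
  using tail_bdry_tail_bdry[of c K "p - 1"] by (cases p) (auto simp: oriented_bdry_eq)

lemma qpair_oriented:
  assumes "simplicial_complex K"
  shows "qpair (cycles (oriented_complex K) q) (boundaries (oriented_complex K) q)"
  unfolding qpair_def
proof (intro conjI subspace_cycles subspace_boundaries)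
  show "boundaries (oriented_complex K) q \<subseteq> cycles (oriented_complex K) q"
  proof
    fix b assume "b \<in> boundaries (oriented_complex K) q"
    then obtain c where c: "c \<in> oriented_chains K (Suc q)" "b = oriented_bdry (Suc q) c"
      by (auto simp: boundaries_def)
    show "b \<in> cycles (oriented_complex K) q"
      using oriented_bdry_in[OF assms c(1)] oriented_bdry_oriented_bdry[OF c(1)]
      by (simp add: cycles_def c(2) oriented_bdry_eq[of "Suc q"])
  qed
qed (simp_all add: subspace_oriented_chains oriented_bdry_linear)

lemma oriented_chains_mono: "K \<subseteq> K' \<Longrightarrow> oriented_chains K p \<subseteq> oriented_chains K' p"
  by (auto simp: oriented_chains_def)

section \<open>Factoring a compact space through a finite complex\<close>

definition point_vertex :: "'a \<Rightarrow> 'a vertex" where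
  "point_vertex c = enc {0} (restrict (\<lambda>_. c) (face_simplex {0}))"

lemma face_simplex_singleton: "face_simplex {0} = standard_simplex 0"
  using face_simplex_atMost[of 0] by simp

lemma vertex_image_point [simp]: "vertex_image (point_vertex c) = {c}"
  using nonempty_standard_simplex[of 0] by (auto simp: vertex_image_def point_vertex_def face_simplex_singleton)

lemma valid_point_vertex: "c \<in> topspace X \<Longrightarrow> valid_vertex X (point_vertex c)"
  unfolding valid_vertex_def point_vertex_def
  by (auto intro: continuous_map_eq[of _ _ "\<lambda>_. c"])

text \<open>\<open>\<mu>\<close> realizes the complex of \<open>\<V>\<close>-small vertex sets
  inside members of \<open>\<U>\<close> and extends the prescribed values on flags. \<open>S\<close>
  is the finite net used for \<open>C\<close>, and \<open>\<W>\<close> covers \<open>C\<close> so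
  finely that a member and the net points chosen for it lie in a common member of
  \<open>\<V>\<close>.\<close>

locale finite_net =
  fixes X :: "'a topology" and \<U> \<V> \<W> :: "'a set set" and \<mu> :: "nat \<Rightarrow> 'a vertex list qchain \<Rightarrow> 'a singular qchain"
    and C S :: "'a set" and near :: "'a \<Rightarrow> 'a"
  assumes \<mu>: "complete_realization X \<U> (vertex_complex X \<V>) \<mu>"
    and \<mu>_flag: "\<And>p c. c \<in> oriented_chains (flag_complex X \<V>) p \<Longrightarrow> \<mu> p c = flag_map c"
    and finite_S: "finite S" and S_sub: "S \<subseteq> topspace X" and C_sub: "C \<subseteq> topspace X"
    and near: "\<And>y. y \<in> C \<Longrightarrow> near y \<in> S"
    and \<W>: "\<And>W. W \<in> \<W> \<Longrightarrow> openin (subtopology X C) W" "C \<subseteq> \<Union>\<W>"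
    and small: "\<And>W. W \<in> \<W> \<Longrightarrow> \<exists>V\<in>\<V>. W \<union> near ` W \<subseteq> V"
begin

abbreviation "K \<equiv> vertex_complex X \<V>"
abbreviation "XC \<equiv> subtopology X C"

definition "K0 = {A \<in> K. A \<subseteq> point_vertex ` S}"

definition nu :: "nat \<Rightarrow> 'a singular \<Rightarrow> 'a vertex list qchain" where
  "nu p f = gen (map (\<lambda>x. point_vertex (near (f x))) (unit_list p))"

text \<open>\<open>nu\<close> keeps lists with repeated net points, so that it commutes with
  boundaries without exception; \<open>orient\<close> then removes them.\<close>

definition nerve_map :: "nat \<Rightarrow> 'a singular qchain \<Rightarrow> 'a vertex list qchain" where
  "nerve_map p c = orient (qlift (nu p) c)"

abbreviation small_chains :: "nat \<Rightarrow> 'a singular qchain set" where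
  "small_chains p \<equiv> {c. Poly_Mapping.keys c \<subseteq> small_simplex XC \<W> p}"

lemma K0_sub: "K0 \<subseteq> K" by (auto simp: K0_def)

lemma simplicial_K0: "simplicial_complex K0"
  unfolding simplicial_complex_def
proof (intro conjI ballI allI impI)
  fix A assume A: "A \<in> K0"
  then have K: "A \<in> K" and sub: "A \<subseteq> point_vertex ` S" by (simp_all add: K0_def)
  then show "finite A" "A \<noteq> {}" by (simp_all add: vertex_complex_def)
  fix B assume B: "B \<subseteq> A \<and> B \<noteq> {}"
  then have "B \<in> K"
    by (rule simplicial_vertex_complex[of X \<V>, unfolded simplicial_complex_def, THEN conjunct2, rule_format, OF K])
  moreover have "B \<subseteq> point_vertex ` S" using B sub by (meson order_trans)
  ultimately show "B \<in> K0" by (simp add: K0_def)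
qed

lemma topspace_XC: "topspace XC = C" using C_sub by auto

lemma obd_nu_0: "obd (nu 0 f) = gen []"
  by (simp add: nu_def unit_list_def)

lemma obd_nu: "obd (nu (Suc p) f) = qlift (nu p) (singular_bdry (Suc p) (gen f))"
proof -
  have "obd (nu (Suc p) f) = qlift (\<lambda>xs. gen (map (\<lambda>x. point_vertex (near (f x))) xs)) (obd_gen (unit_list (Suc p)))"
    by (simp only: nu_def obd_gen_eq obd_omap_gen omap_def)
  also have "\<dots> = qlift (nu p) (singular_bdry (Suc p) (gen f))"
  proof (rule natural_boundary)
    fix i assume i: "i \<le> Suc p"
    have "f (simplical_face i x) = singular_face (Suc p) i f x" if "x \<in> set (unit_list p)" for x
      using subsetD[OF set_unit_list that] by (simp add: singular_face_def)
    then show "gen (map (\<lambda>x. point_vertex (near (f x))) (omit i (unit_list (Suc p)))) = nu p (singular_face (Suc p) i f)"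
      unfolding nu_def omit_unit_list[OF i] by (intro arg_cong[where f = gen]) simp
  qed
  finally show ?thesis .
qed

text \<open>The common carrier of \<open>carry\<close> and \<open>nu\<close>: a vertex of the
  subdivision has its image in \<open>A\<close>, and a vertex of the net lies in the image of
  \<open>A\<close> under \<open>near\<close>.\<close>

definition carries :: "'a set \<Rightarrow> 'a vertex \<Rightarrow> bool" where
  "carries A v \<longleftrightarrow> valid_vertex X v \<and> vertex_image v \<subseteq> A \<union> near ` A"

lemma simplex_in_C: "singular_simplex p XC f \<Longrightarrow> f ` standard_simplex p \<subseteq> C"
  by (auto simp: singular_simplex_subtopology)

lemma carries_near:
  assumes f: "singular_simplex p XC f" and x: "x \<in> standard_simplex p"
  shows "carries (f ` standard_simplex p) (point_vertex (near (f x)))"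
proof -
  have "near (f x) \<in> S" using near simplex_in_C[OF f] x by blast
  then have "valid_vertex X (point_vertex (near (f x)))" using S_sub by (intro valid_point_vertex) auto
  then show ?thesis using x by (auto simp: carries_def)
qed

lemma keys_nu:
  assumes f: "singular_simplex p XC f"
  shows "Poly_Mapping.keys (nu p f) \<subseteq> {vs. length vs = Suc p \<and> (\<forall>v\<in>set vs. carries (f ` standard_simplex p) v)}"
  using carries_near[OF f] set_unit_list[of p] by (auto simp: nu_def)

lemma keys_carry': 
  assumes f: "singular_simplex p XC f"
  shows "Poly_Mapping.keys (carry p f) \<subseteq> {vs. length vs = Suc p \<and> (\<forall>v\<in>set vs. carries (f ` standard_simplex p) v)}"
proof -
  have "singular_simplex p X f" using f by (simp add: singular_simplex_subtopology)
  then show ?thesis using keys_carry[of p X f] by (auto simp: carries_def)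
qed

text \<open>For a small simplex the carrier is a full simplex: every finite nonempty set of carried
  vertices belongs to \<open>K\<close>. Cones inside the carrier therefore stay in the
  complex.\<close>

lemma carried_in_K:
  assumes f: "f \<in> small_simplex XC \<W> p" and A: "finite A" "A \<noteq> {}" "\<forall>v\<in>A. carries (f ` standard_simplex p) v"
  shows "A \<in> K"
proof -
  obtain W where W: "W \<in> \<W>" "f ` standard_simplex p \<subseteq> W" using f by auto
  obtain V where V: "V \<in> \<V>" "W \<union> near ` W \<subseteq> V" using small[OF W(1)] by blast
  have "\<forall>v\<in>A. valid_vertex X v \<and> vertex_image v \<subseteq> V"
    using A(3) W(2) V(2) unfolding carries_def by blast
  then show ?thesis using V(1) A(1,2) unfolding vertex_complex_def by blast
qed

lemma orient_carried:
  assumes c: "c \<in> small_chains p"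
    and h: "\<And>f. singular_simplex p XC f \<Longrightarrow> Poly_Mapping.keys (h f)
      \<subseteq> {vs. length vs = Suc q \<and> (\<forall>v\<in>set vs. carries (f ` standard_simplex p) v)}"
  shows "orient (qlift h c) \<in> oriented_chains K q"
proof (rule orient_in_chains)
  fix vs assume "vs \<in> Poly_Mapping.keys (qlift h c)"
  then obtain f where f: "f \<in> Poly_Mapping.keys c" "vs \<in> Poly_Mapping.keys (h f)" using keys_qlift[of h c] by blast
  have fs: "f \<in> small_simplex XC \<W> p" using c f(1) by auto
  then have vs: "length vs = Suc q" "\<forall>v\<in>set vs. carries (f ` standard_simplex p) v" using h[of f] f(2) by auto
  moreover have "set vs \<noteq> {}" using vs(1) by auto
  ultimately show "length vs = Suc q \<and> (distinct vs \<longrightarrow> set vs \<in> K)"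
    using carried_in_K[OF fs, of "set vs"] by simp
qed

lemma small_sub: "c \<in> small_chains p \<Longrightarrow> c \<in> ss_chains p XC"
  by auto

lemma ss_chains_XC: "c \<in> ss_chains p XC \<Longrightarrow> c \<in> ss_chains p X"
  by (auto simp: singular_simplex_subtopology)

lemma nerve_map_in:
  assumes c: "c \<in> small_chains p" shows "nerve_map p c \<in> oriented_chains K0 p"
proof -
  have "nerve_map p c \<in> oriented_chains K p"
    unfolding nerve_map_def by (rule orient_carried[OF c keys_nu])
  moreover have "set vs \<subseteq> point_vertex ` S" if vs: "vs \<in> Poly_Mapping.keys (nerve_map p c)" for vs
  proof -
    obtain us where us: "us \<in> Poly_Mapping.keys (qlift (nu p) c)" "mset vs = mset us"
      using vs keys_orient[of "qlift (nu p) c"] unfolding nerve_map_def by auto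
    then obtain f where f: "f \<in> Poly_Mapping.keys c" "us = map (\<lambda>x. point_vertex (near (f x))) (unit_list p)"
      using keys_qlift[of "nu p" c] by (auto simp: nu_def)
    have "singular_simplex p XC f" using f(1) c by auto
    then have fC: "f ` standard_simplex p \<subseteq> C" by (rule simplex_in_C)
    have "near (f x) \<in> S" if "x \<in> set (unit_list p)" for x
      using that set_unit_list[of p] fC by (intro near) auto
    then have "set us \<subseteq> point_vertex ` S" by (auto simp: f(2))
    then show ?thesis using us(2) mset_eq_setD by blast
  qed
  ultimately show ?thesis by (auto simp: oriented_chains_def K0_def)
qed

lemma nerve_map_linear: "nerve_map p (a + b) = nerve_map p a + nerve_map p b"
  "nerve_map p (qscale r a) = qscale r (nerve_map p a)" "nerve_map p (a - b) = nerve_map p a - nerve_map p b"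
  by (simp_all add: nerve_map_def orient_simps qlift_simps)

lemma nerve_map_bdry:
  "oriented_bdry (Suc p) (nerve_map (Suc p) c) = nerve_map p (singular_bdry (Suc p) c)"
proof -
  have "Poly_Mapping.keys (qlift (nu (Suc p)) c) \<subseteq> {vs. vs \<noteq> []}"
    by (rule keys_sub_qlift) (auto simp: nu_def unit_list_def)
  then have "oriented_bdry (Suc p) (nerve_map (Suc p) c) = orient (obd (qlift (nu (Suc p)) c))"
    by (simp add: oriented_bdry_eq nerve_map_def tail_bdry_orient)
  also have "obd (qlift (nu (Suc p)) c) = qlift (\<lambda>f. obd (nu (Suc p) f)) c"
    by (simp add: obd_def qlift_qlift)
  also have "\<dots> = qlift (nu p) (singular_bdry (Suc p) c)"
    by (simp add: obd_nu singular_bdry_expand[of "Suc p" c] qlift_qlift)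
  finally show ?thesis by (simp add: nerve_map_def)
qed

lemma \<mu>_chain: "chain_morphism (oriented_complex K) (singular_complex X) \<mu>"
  using \<mu> by (simp add: complete_realization_def partial_realization_def)

lemma \<mu>_linear: "qlinear_on (oriented_chains K p) (\<mu> p)"
  using \<mu>_chain by (simp add: chain_morphism_def qlinear_on_def)

lemma \<mu>_in: "c \<in> oriented_chains K p \<Longrightarrow> \<mu> p c \<in> ss_chains p X"
  using \<mu>_chain by (simp add: chain_morphism_def)

lemma \<mu>_bdry: "c \<in> oriented_chains K (Suc p) \<Longrightarrow> \<mu> p (oriented_bdry (Suc p) c) = singular_bdry (Suc p) (\<mu> (Suc p) c)"
  using \<mu>_chain by (simp add: chain_morphism_def)

text \<open>On flags \<open>\<mu>\<close> is prescribed, so it turns the oriented image of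
  \<open>carry\<close> into the double barycentric subdivision, which does not change
  classes.\<close>

lemma carry_realized:
  assumes z: "z \<in> cycles (small_singular_complex XC \<W>) q"
  shows "\<mu> q (orient (qlift (carry q) z)) - z \<in> boundaries (singular_complex X) q"
proof -
  have zs: "z \<in> small_chains q" using z by (simp add: cycles_def)
  have zX: "z \<in> cycles (singular_complex X) q"
    using z ss_chains_XC[OF small_sub[OF zs]] by (simp add: cycles_def)
  have "orient (qlift (carry q) z) \<in> oriented_chains (flag_complex X \<V>) q"
  proof (rule orient_in_chains)
    fix vs assume "vs \<in> Poly_Mapping.keys (qlift (carry q) z)"
    then obtain f where f: "f \<in> Poly_Mapping.keys z" "vs \<in> Poly_Mapping.keys (carry q f)"
      using keys_qlift[of "carry q" z] by blast
    have fs: "f \<in> small_simplex XC \<W> q" using zs f(1) by auto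
    then have fX: "singular_simplex q X f" by (simp add: singular_simplex_subtopology)
    have vs: "length vs = Suc q" "\<forall>v\<in>set vs. carries (f ` standard_simplex q) v"
      using keys_carry'[of q f] fs f(2) by auto
    have "flag vs" using keys_carry[OF fX] f(2) by auto
    moreover have "set vs \<noteq> {}" using vs(1) by auto
    then have "set vs \<in> K" using carried_in_K[OF fs _ _ vs(2)] by simp
    ultimately show "length vs = Suc q \<and> (distinct vs \<longrightarrow> set vs \<in> flag_complex X \<V>)"
      using vs(1) unfolding flag_complex_def by blast
  qed
  then have "\<mu> q (orient (qlift (carry q) z)) = flag_map (orient (qlift (carry q) z))" by (rule \<mu>_flag)
  also have "\<dots> = qlift (\<lambda>f. flag_map (orient (carry q f))) z"
    by (simp add: flag_map_def orient_def qlift_qlift)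
  also have "\<dots> = qlift (\<lambda>f. push_chain f (bsd_gen (unit_list q))) z"
    using zX by (intro qlift_cong flag_map_orient_carry) (auto simp: cycles_def)
  finally show ?thesis using bsd_homologous[OF zX] by simp
qed

text \<open>\<open>carry\<close> and \<open>nu\<close> have a common acyclic carrier, so on a cycle
  they differ by a boundary in \<open>K\<close>, which \<open>\<mu>\<close> maps to a singular
  boundary. The filling uses simplices of \<open>K\<close> that mix singular simplices and net
  points, where in general only the retract property defines \<open>\<mu>\<close>.\<close>

lemma nerve_homologous:
  assumes z: "z \<in> cycles (small_singular_complex XC \<W>) q"
  shows "z - \<mu> q (nerve_map q z) \<in> boundaries (singular_complex X) q"
proof -
  let ?B = "boundaries (singular_complex X) q"
  define A where "A = (\<lambda>p f. carry p f - nu p f)"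
  define D where "D = carrier_htpy A (\<lambda>p f. point_vertex (near (f (unit_point 0))))"
  have zs: "z \<in> small_chains q" and zb: "singular_bdry q z = 0" using z by (simp_all add: cycles_def)
  have unit: "unit_point 0 \<in> standard_simplex p" for p
    using basis_in_standard_simplex[of 0 p] by (simp add: unit_point_def)
  have A1: "obd (A 0 f) = 0" for f by (simp add: A_def obd_simps obd_carry_0 obd_nu_0)
  have A2: "obd (A (Suc p) f) = qlift (A p) (singular_bdry (Suc p) (gen f))" for p f
    unfolding A_def qlift_fun_diff by (simp add: obd_simps obd_carry obd_nu)
  have A3: "Poly_Mapping.keys (A p f) \<subseteq> {vs. length vs = Suc p \<and> (\<forall>v\<in>set vs. carries (f ` standard_simplex p) v)}"
    if "singular_simplex p XC f" for p f
    unfolding A_def by (intro keys_sub_diff keys_carry'[OF that] keys_nu[OF that])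
  have A4: "carries (f ` standard_simplex p) (point_vertex (near (f (unit_point 0))))" if "singular_simplex p XC f" for p f
    by (rule carries_near[OF that unit])
  have A5: "carries T v" if "S' \<subseteq> T" "carries S' v" for S' T v
    using that unfolding carries_def by blast
  have H: "obd (qlift (D p) c) = qlift (A p) c - (if p = 0 then 0 else qlift (D (p - 1)) (singular_bdry p c))"
    if "c \<in> ss_chains p XC" for p c
    unfolding D_def using A1 A2 A3 A4 A5 that by (rule carrier_homotopy(2))
  have obd: "obd (qlift (D q) z) = qlift (carry q) z - qlift (nu q) z"
    using H[OF small_sub[OF zs]] by (simp add: zb A_def qlift_fun_diff)
  have keysD: "Poly_Mapping.keys (D q f) \<subseteq> {vs. length vs = Suc (Suc q) \<and> (\<forall>v\<in>set vs. carries (f ` standard_simplex q) v)}"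
    if "singular_simplex q XC f" for f
    unfolding D_def using A1 A2 A3 A4 A5 that by (rule carrier_homotopy(1))
  have Din: "orient (qlift (D q) z) \<in> oriented_chains K (Suc q)"
    by (rule orient_carried[OF zs keysD])
  have "Poly_Mapping.keys (qlift (D q) z) \<subseteq> {vs. vs \<noteq> []}"
  proof (rule keys_sub_qlift)
    fix f assume "f \<in> Poly_Mapping.keys z"
    then have "singular_simplex q XC f" using zs by auto
    then show "Poly_Mapping.keys (D q f) \<subseteq> {vs. vs \<noteq> []}" using keysD by fastforce
  qed
  then have bd: "oriented_bdry (Suc q) (orient (qlift (D q) z)) = orient (qlift (carry q) z) - nerve_map q z"
    by (simp add: oriented_bdry_eq tail_bdry_orient obd orient_simps nerve_map_def)
  have in1: "orient (qlift (carry q) z) \<in> oriented_chains K q"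
    by (rule orient_carried[OF zs keys_carry'])
  have in2: "nerve_map q z \<in> oriented_chains K q"
    using nerve_map_in[OF zs] oriented_chains_mono[OF K0_sub] by blast
  have "\<mu> q (orient (qlift (carry q) z)) - \<mu> q (nerve_map q z) = singular_bdry (Suc q) (\<mu> (Suc q) (orient (qlift (D q) z)))"
    unfolding \<mu>_bdry[OF Din, symmetric] bd
    by (rule qlinear_on_diff[OF \<mu>_linear in1 in2 subspace_oriented_chains, symmetric])
  then have "\<mu> q (orient (qlift (carry q) z)) - \<mu> q (nerve_map q z) \<in> ?B"
    using singular_bdry_in_boundaries[OF \<mu>_in[OF Din]] by simp
  then show ?thesis
    using cong_trans[OF subspace_singular_boundaries cong_sym[OF subspace_singular_boundaries carry_realized[OF z]]]
    by blast
qed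

end

text \<open>The set \<open>C\<close> now contains the supports of all values of
  \<open>\<phi>\<close>, so that \<open>\<phi>\<close> also is a morphism into the chains of
  \<open>C\<close>, on which \<open>nerve_map\<close> can act after subdivision.\<close>

locale compact_morphism_net = finite_net +
  fixes \<O> :: "'a set set" and \<phi> :: "nat \<Rightarrow> 'a singular qchain \<Rightarrow> 'a singular qchain"
  assumes cover: "open_cover X \<O>"
    and \<phi>: "chain_morphism (small_singular_complex X \<O>) (singular_complex X) \<phi>"
    and \<phi>_C: "\<And>p c. c \<in> chains (small_singular_complex X \<O>) p \<Longrightarrow> \<phi> p c \<in> ss_chains p (subtopology X C)"
begin

abbreviation "SO \<equiv> small_singular_complex X \<O>"
abbreviation "SX \<equiv> singular_complex X"
abbreviation "SC \<equiv> singular_complex XC"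
abbreviation "SW \<equiv> small_singular_complex XC \<W>"
abbreviation "N0 \<equiv> oriented_complex K0"

lemma cover': "\<And>U. U \<in> \<O> \<Longrightarrow> openin X U" "topspace X \<subseteq> \<Union>\<O>"
  using cover by (auto simp: open_cover_def)

lemma cover_W: "\<And>W. W \<in> \<W> \<Longrightarrow> openin XC W" "topspace XC \<subseteq> \<Union>\<W>"
  using \<W> topspace_XC by auto

lemma \<phi>_chain: "chain_morphism SO SC \<phi>"
  using \<phi> \<phi>_C by (auto simp: chain_morphism_def)

lemma boundaries_mono: "boundaries SC q \<subseteq> boundaries SX q"
  using ss_chains_XC by (auto simp: boundaries_def singular_simplex_subtopology)

lemma subS: "qvs.subspace (chains (small_singular_complex Y \<P>) p)"
  by (simp add: subspace_keys del: mem_Collect_eq)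

lemma \<phi>_qmorph: "qmorph (cycles SO q) (boundaries SO q) (cycles SC q) (boundaries SC q) (\<phi> q)"
  by (rule chain_morphism_qmorph[OF \<phi>_chain subS _ qpair_singular qpair_small]) simp

lemma nerve_qmorph: "qmorph (cycles SW q) (boundaries SW q) (cycles N0 q) (boundaries N0 q) (nerve_map q)"
proof (rule chain_morphism_qmorph[OF _ subS _ qpair_oriented[OF simplicial_K0] qpair_small])
  have aug: "augmentation (nerve_map 0 c) = augmentation c" for c
  proof -
    have "nerve_map 0 c = qlift (\<lambda>f. gen (map (\<lambda>x. point_vertex (near (f x))) (unit_list 0))) c"
      by (simp add: nerve_map_def orient_def nu_def[abs_def] qlift_qlift unit_list_def oriented_gen_single)
    then show ?thesis by (simp add: augmentation_qlift_1)
  qed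
  show "chain_morphism SW N0 nerve_map"
    unfolding chain_morphism_def
    using nerve_map_in aug nerve_map_bdry by (auto simp: nerve_map_linear)
qed (simp add: oriented_bdry_eq)

lemma \<mu>_qmorph: "qmorph (cycles N0 q) (boundaries N0 q) (cycles SX q) (boundaries SX q) (\<mu> q)"
proof (rule chain_morphism_qmorph[OF _ _ _ qpair_singular qpair_oriented[OF simplicial_K0]])
  show "chain_morphism N0 SX \<mu>"
    using \<mu>_chain oriented_chains_mono[OF K0_sub] unfolding chain_morphism_def chains_oriented
    by (meson subsetD)
qed (simp_all add: subspace_oriented_chains)

text \<open>\<open>linked q z w\<close>: the class of \<open>w\<close> in the homology of \<open>C\<close> is the image under \<open>\<phi>\<close> of
  the class of \<open>z\<close>.\<close>

definition linked :: "nat \<Rightarrow> 'a singular qchain \<Rightarrow> 'a singular qchain \<Rightarrow> bool" where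
  "linked q z w \<longleftrightarrow> w \<in> cycles SW q \<and>
     (\<exists>z'\<in>cycles SO q. z - z' \<in> boundaries SX q \<and> \<phi> q z' - w \<in> boundaries SC q)"

lemma linked_exists: "z \<in> cycles SX q \<Longrightarrow> \<exists>w. linked q z w"
proof -
  assume "z \<in> cycles SX q"
  then obtain z' where z': "z' \<in> cycles SO q" "z - z' \<in> boundaries SX q"
    using cycle_small_exists[OF cover'] by blast
  have "\<phi> q z' \<in> cycles SC q" by (rule qmorphD(1)[OF \<phi>_qmorph z'(1)])
  then show ?thesis
    using cycle_small_exists[OF cover_W] z' unfolding linked_def by blast
qed

lemma subspaces: "qvs.subspace (cycles SO q)" "qvs.subspace (cycles SW q)"
  "qvs.subspace (boundaries SX q)" "qvs.subspace (boundaries SC q)" "qvs.subspace (cycles SX q)"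
  "qvs.subspace (boundaries N0 q)" "qvs.subspace (cycles N0 q)"
  using qpair_small[of X \<O> q] qpair_small[of XC \<W> q] qpair_singular[of X q] qpair_singular[of XC q]
    qpair_oriented[OF simplicial_K0, of q] unfolding qpair_def by simp_all

lemma linked_scale: "linked q z w \<Longrightarrow> linked q (qscale r z) (qscale r w)"
proof -
  assume "linked q z w"
  then obtain z' where z': "w \<in> cycles SW q" "z' \<in> cycles SO q" "z - z' \<in> boundaries SX q"
    "\<phi> q z' - w \<in> boundaries SC q" unfolding linked_def by blast
  have "\<phi> q (qscale r z') - qscale r w \<in> boundaries SC q"
    by (rule cong_trans[OF subspaces(4) qmorphD(3)[OF \<phi>_qmorph z'(2)] cong_scale[OF subspaces(4) z'(4)]])
  then show ?thesis
    unfolding linked_def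
    using qvs.subspace_scale[OF subspaces(2) z'(1), of r] qvs.subspace_scale[OF subspaces(1) z'(2), of r]
      cong_scale[OF subspaces(3) z'(3), of r] by blast
qed

lemma linked_add: "linked q z w \<Longrightarrow> linked q y v \<Longrightarrow> linked q (z + y) (w + v)"
proof -
  assume "linked q z w" "linked q y v"
  then obtain z' y' where z': "w \<in> cycles SW q" "z' \<in> cycles SO q" "z - z' \<in> boundaries SX q"
    "\<phi> q z' - w \<in> boundaries SC q" and y': "v \<in> cycles SW q" "y' \<in> cycles SO q" "y - y' \<in> boundaries SX q"
    "\<phi> q y' - v \<in> boundaries SC q" unfolding linked_def by blast
  have "\<phi> q (z' + y') - (w + v) \<in> boundaries SC q"
    by (rule cong_trans[OF subspaces(4) qmorphD(2)[OF \<phi>_qmorph z'(2) y'(2)] cong_add[OF subspaces(4) z'(4) y'(4)]])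
  then show ?thesis
    unfolding linked_def
    using qvs.subspace_add[OF subspaces(2) z'(1) y'(1)] qvs.subspace_add[OF subspaces(1) z'(2) y'(2)]
      cong_add[OF subspaces(3) z'(3) y'(3)] by blast
qed

lemma linked_diff: "linked q z w \<Longrightarrow> linked q y v \<Longrightarrow> linked q (z - y) (w - v)"
  using linked_add[of q z w "qscale (-1) y" "qscale (-1) v"] linked_scale[of q y v "-1"] by simp

text \<open>The two passages to small chains, for \<open>\<O>\<close> before \<open>\<phi>\<close>
  and for \<open>\<W>\<close> after it, must respect boundaries; each is an application of
  \<open>small_boundary\<close>. With linearity this makes the class of \<open>nerve_map q w\<close>
  depend only on the class of \<open>z\<close>.\<close>

lemma linked_boundary:
  assumes "linked q z w" "z \<in> boundaries SX q"
  shows "nerve_map q w \<in> boundaries N0 q"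
proof -
  obtain z' where z': "w \<in> cycles SW q" "z' \<in> cycles SO q" "z - z' \<in> boundaries SX q"
    "\<phi> q z' - w \<in> boundaries SC q" using assms unfolding linked_def by blast
  have b1: "z' \<in> boundaries SX q"
    using qvs.subspace_diff[OF subspaces(3) assms(2) z'(3)] by simp
  have "z' \<in> boundaries SO q" by (rule small_boundary[OF _ cover'(2) z'(2) b1]) (rule cover'(1))
  then have "\<phi> q z' \<in> boundaries SC q" by (rule qmorphD(4)[OF \<phi>_qmorph])
  then have b2: "w \<in> boundaries SC q"
    using qvs.subspace_diff[OF subspaces(4) _ z'(4), of "\<phi> q z'"] by simp
  have "w \<in> boundaries SW q" by (rule small_boundary[OF _ cover_W(2) z'(1) b2]) (rule cover_W(1))
  then show ?thesis by (rule qmorphD(4)[OF nerve_qmorph])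
qed

lemma linked_unique:
  assumes "linked q z w" "linked q y v" "z - y \<in> boundaries SX q"
  shows "nerve_map q w - nerve_map q v \<in> boundaries N0 q"
  using linked_boundary[OF linked_diff[OF assms(1,2)] assms(3)] by (simp add: nerve_map_linear)

definition "link q z = (SOME w. linked q z w)"

lemma linked_link: "z \<in> cycles SX q \<Longrightarrow> linked q z (link q z)"
  unfolding link_def using linked_exists by (rule someI_ex)

text \<open>The factor from the homology of \<open>X\<close> to that of \<open>K0\<close>; the other
  factor is \<open>\<mu>\<close>. Because representatives are chosen, linearity holds only modulo
  boundaries.\<close>

definition "descend q z = nerve_map q (link q z)"

lemma descend_qmorph: "qmorph (cycles SX q) (boundaries SX q) (cycles N0 q) (boundaries N0 q) (descend q)"
  unfolding qmorph_def
proof (intro conjI ballI allI)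
  fix z assume z: "z \<in> cycles SX q"
  then show "descend q z \<in> cycles N0 q"
    using linked_link[OF z] qmorphD(1)[OF nerve_qmorph] unfolding descend_def linked_def by blast
  have zero: "x - x \<in> boundaries SX q" for x using qvs.subspace_0[OF subspaces(3)] by simp
  show "descend q (qscale r z) - qscale r (descend q z) \<in> boundaries N0 q" for r
    using linked_unique[OF linked_link[OF qvs.subspace_scale[OF subspaces(5) z]] linked_scale[OF linked_link[OF z]] zero]
    by (simp add: descend_def nerve_map_linear)
  fix y assume y: "y \<in> cycles SX q"
  show "descend q (z + y) - (descend q z + descend q y) \<in> boundaries N0 q"
    using linked_unique[OF linked_link[OF qvs.subspace_add[OF subspaces(5) z y]]
        linked_add[OF linked_link[OF z] linked_link[OF y]] zero]
    by (simp add: descend_def nerve_map_linear)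
next
  fix z assume z: "z \<in> boundaries SX q"
  then have "z \<in> cycles SX q" using qpair_singular[of X q] unfolding qpair_def by blast
  then show "descend q z \<in> boundaries N0 q"
    unfolding descend_def by (rule linked_boundary[OF linked_link z])
qed

text \<open>The chosen cycle of \<open>C\<close> is homologous to the image under
  \<open>\<phi>\<close>, and by \<open>nerve_homologous\<close> passing to the net and realizing
  again does not change its class in \<open>X\<close>.\<close>

lemma induced_descend:
  assumes z: "z \<in> cycles SX q"
  shows "induced_endo X \<O> \<phi> q (coset (boundaries SX q) z) = coset (boundaries SX q) (\<mu> q (descend q z))"
proof -
  obtain z' where z': "link q z \<in> cycles SW q" "z' \<in> cycles SO q" "z - z' \<in> boundaries SX q"
    "\<phi> q z' - link q z \<in> boundaries SC q" using linked_link[OF z] unfolding linked_def by blast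
  have "\<phi> q z' - link q z \<in> boundaries SX q" using z'(4) boundaries_mono by blast
  then have "\<phi> q z' - \<mu> q (descend q z) \<in> boundaries SX q"
    using cong_trans[OF subspaces(3) _ nerve_homologous[OF z'(1)]] unfolding descend_def by blast
  then show ?thesis
    using induced_endo_coset[OF cover \<phi> z z'(2,3)] coset_eq[OF subspaces(3)] by simp
qed

text \<open>Since the complex is finite, the numbers \<open>m\<close> and \<open>k\<close> of subdivisions that make the
  chains small can be chosen uniformly.\<close>

definition net_map :: "nat \<Rightarrow> nat \<Rightarrow> nat \<Rightarrow> 'a vertex list qchain \<Rightarrow> 'a vertex list qchain" where
  "net_map m k p c = nerve_map p (qsd_pow k p (\<phi> p (qsd_pow m p (\<mu> p c))))"

definition simplex_lists :: "'a vertex list set" where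
  "simplex_lists = {vs. distinct vs \<and> set vs \<in> K0}"

lemma finite_simplex_lists: "finite simplex_lists"
proof -
  have "simplex_lists \<subseteq> {vs. set vs \<subseteq> point_vertex ` S \<and> length vs \<le> card (point_vertex ` S)}"
  proof
    fix vs assume "vs \<in> simplex_lists"
    then have "set vs \<subseteq> point_vertex ` S" "distinct vs" by (simp_all add: simplex_lists_def K0_def)
    moreover from this have "length vs \<le> card (point_vertex ` S)"
      using card_mono[of "point_vertex ` S" "set vs"] finite_S by (simp add: distinct_card)
    ultimately show "vs \<in> {vs. set vs \<subseteq> point_vertex ` S \<and> length vs \<le> card (point_vertex ` S)}" by simp
  qed
  moreover have "finite {vs. set vs \<subseteq> point_vertex ` S \<and> length vs \<le> card (point_vertex ` S)}"
    using finite_S by (intro finite_lists_length_le) auto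
  ultimately show ?thesis by (rule finite_subset)
qed

lemma uniform_bound:
  assumes "\<And>vs. vs \<in> simplex_lists \<Longrightarrow> \<exists>n. \<forall>m\<ge>n. P m vs"
  shows "\<exists>n::nat. \<forall>vs\<in>simplex_lists. P n vs"
proof -
  obtain n where n: "\<And>vs m. vs \<in> simplex_lists \<Longrightarrow> n vs \<le> m \<Longrightarrow> P m vs" using assms by metis
  have "P (Max (insert 0 (n ` simplex_lists))) vs" if "vs \<in> simplex_lists" for vs
    using that finite_simplex_lists by (intro n) auto
  then show ?thesis by blast
qed

lemma oriented_gen_K: "vs \<in> simplex_lists \<Longrightarrow> length vs = Suc p \<Longrightarrow> oriented_gen vs \<in> oriented_chains K p"
  using K0_sub by (intro oriented_gen_in_chains) (auto simp: simplex_lists_def)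

lemma \<mu>_linear0: "qlinear_on (oriented_chains K0 p) (\<mu> p)"
  by (rule qlinear_on_sub[OF \<mu>_linear oriented_chains_mono[OF K0_sub]])

text \<open>On homology the endomorphism of \<open>X\<close> and the composite
  \<open>descend\<close> after \<open>\<mu>\<close> on \<open>K0\<close> have equal traces. The
  latter is represented by the chain map \<open>net_map m k\<close>, so the Hopf trace formula
  applies, and the hypothesis makes its diagonal entries zero.\<close>

lemma Lefschetz_zero_if_displacing:
  assumes disp: "\<And>m k p vs. length vs = Suc p \<Longrightarrow> vs \<in> simplex_lists \<Longrightarrow>
      qsd_pow m p (\<mu> p (oriented_gen vs)) \<in> chains SO p \<Longrightarrow>
      Poly_Mapping.lookup (net_map m k p (oriented_gen vs)) vs = 0"
  shows "Lefschetz X \<O> \<phi> = 0"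
proof -
  have len: "\<exists>p. length vs = Suc p" if "vs \<in> simplex_lists" for vs
    using that simplicial_K0 by (cases vs) (auto simp: simplex_lists_def simplicial_complex_def)
  have "\<exists>m. \<forall>vs\<in>simplex_lists. \<forall>p. length vs = Suc p \<longrightarrow> qsd_pow m p (\<mu> p (oriented_gen vs)) \<in> chains SO p"
  proof (rule uniform_bound)
    fix vs assume vs: "vs \<in> simplex_lists"
    obtain p where p: "length vs = Suc p" using len[OF vs] by blast
    have c: "\<mu> p (oriented_gen vs) \<in> ss_chains p X" by (rule \<mu>_in[OF oriented_gen_K[OF vs p]])
    obtain n where "\<forall>m\<ge>n. \<forall>f\<in>Poly_Mapping.keys (qsd_pow m p (\<mu> p (oriented_gen vs))). \<exists>V\<in>\<O>. f ` standard_simplex p \<subseteq> V"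
      using qsd_pow_small[OF cover' c] by blast
    moreover have "Poly_Mapping.keys (qsd_pow m p (\<mu> p (oriented_gen vs))) \<subseteq> singular_simplex_set p X" for m
      using qsd_pow_in[OF c] by simp
    ultimately have "\<forall>m\<ge>n. qsd_pow m p (\<mu> p (oriented_gen vs)) \<in> chains SO p"
      unfolding chains_small by blast
    then show "\<exists>n. \<forall>m\<ge>n. \<forall>p. length vs = Suc p \<longrightarrow> qsd_pow m p (\<mu> p (oriented_gen vs)) \<in> chains SO p"
      using p by auto
  qed
  then obtain m where m: "\<And>vs p. vs \<in> simplex_lists \<Longrightarrow> length vs = Suc p \<Longrightarrow>
      qsd_pow m p (\<mu> p (oriented_gen vs)) \<in> chains SO p" by blast
  define g where "g = (\<lambda>p c. qsd_pow m p (\<mu> p c))"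
  have g_lin: "qlinear_on (oriented_chains K0 p) (g p)" for p
    using \<mu>_linear0[of p] unfolding qlinear_on_def g_def by (simp add: qsd_pow_add qsd_pow_scale)
  have g_in: "g p c \<in> chains SO p" if c: "c \<in> oriented_chains K0 p" for p c
  proof (rule oriented_linear_in[OF g_lin c subS])
    fix vs assume "length vs = Suc p" "distinct vs" "set vs \<in> K0"
    then show "g p (oriented_gen vs) \<in> chains SO p"
      unfolding g_def by (intro m) (simp_all add: simplex_lists_def)
  qed
  have \<phi>_lin: "qlinear_on (chains SO p) (\<phi> p)" for p
    using \<phi> by (simp add: chain_morphism_def qlinear_on_def)
  have gb: "g p (oriented_bdry (Suc p) c) = singular_bdry (Suc p) (g (Suc p) c)" if c: "c \<in> oriented_chains K0 (Suc p)" for p c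
  proof -
    have cK: "c \<in> oriented_chains K (Suc p)" using c oriented_chains_mono[OF K0_sub] by blast
    show ?thesis
      unfolding g_def \<mu>_bdry[OF cK] by (rule qsd_pow_bdry[OF \<mu>_in[OF cK], symmetric])
  qed
  define g' where "g' = (\<lambda>p c. \<phi> p (g p c))"
  have g'_lin: "qlinear_on (oriented_chains K0 p) (g' p)" for p
    using g_lin[of p] \<phi>_lin[of p] g_in unfolding qlinear_on_def g'_def by simp
  have g'_in: "g' p c \<in> ss_chains p XC" if c: "c \<in> oriented_chains K0 p" for p c
    unfolding g'_def by (rule \<phi>_C[OF g_in[OF c]])
  have og0: "oriented_gen vs \<in> oriented_chains K0 p" if "vs \<in> simplex_lists" "length vs = Suc p" for vs p
    using that by (intro oriented_gen_in_chains) (auto simp: simplex_lists_def)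
  have "\<exists>k. \<forall>vs\<in>simplex_lists. \<forall>p. length vs = Suc p \<longrightarrow> qsd_pow k p (g' p (oriented_gen vs)) \<in> small_chains p"
  proof (rule uniform_bound)
    fix vs assume vs: "vs \<in> simplex_lists"
    obtain p where p: "length vs = Suc p" using len[OF vs] by blast
    note c = g'_in[OF og0[OF vs p]]
    obtain n where "\<forall>m\<ge>n. \<forall>f\<in>Poly_Mapping.keys (qsd_pow m p (g' p (oriented_gen vs))). \<exists>V\<in>\<W>. f ` standard_simplex p \<subseteq> V"
      using qsd_pow_small[OF cover_W c] by blast
    moreover have "Poly_Mapping.keys (qsd_pow m p (g' p (oriented_gen vs))) \<subseteq> singular_simplex_set p XC" for m
      using qsd_pow_in[OF c] by simp
    ultimately have "\<forall>m\<ge>n. qsd_pow m p (g' p (oriented_gen vs)) \<in> small_chains p"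
      by blast
    then show "\<exists>n. \<forall>m\<ge>n. \<forall>p. length vs = Suc p \<longrightarrow> qsd_pow m p (g' p (oriented_gen vs)) \<in> small_chains p"
      using p by auto
  qed
  then obtain k where k: "\<And>vs p. vs \<in> simplex_lists \<Longrightarrow> length vs = Suc p \<Longrightarrow>
      qsd_pow k p (g' p (oriented_gen vs)) \<in> small_chains p" by blast
  define g'' where "g'' = (\<lambda>p c. qsd_pow k p (g' p c))"
  have g''_lin: "qlinear_on (oriented_chains K0 p) (g'' p)" for p
    using g'_lin[of p] unfolding qlinear_on_def g''_def by (simp add: qsd_pow_add qsd_pow_scale)
  have g''_in: "g'' p c \<in> small_chains p" if c: "c \<in> oriented_chains K0 p" for p c
  proof (rule oriented_linear_in[OF g''_lin c subspace_keys])
    fix vs assume "length vs = Suc p" "distinct vs" "set vs \<in> K0"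
    then show "g'' p (oriented_gen vs) \<in> small_chains p"
      unfolding g''_def by (intro k) (simp_all add: simplex_lists_def)
  qed
  have g''b: "g'' p (oriented_bdry (Suc p) c) = singular_bdry (Suc p) (g'' (Suc p) c)" if c: "c \<in> oriented_chains K0 (Suc p)" for p c
  proof -
    have "\<phi> p (singular_bdry (Suc p) (g (Suc p) c)) = singular_bdry (Suc p) (\<phi> (Suc p) (g (Suc p) c))"
      using \<phi> g_in[OF c] by (simp add: chain_morphism_def)
    then show ?thesis
      unfolding g''_def g'_def gb[OF c]
      using qsd_pow_bdry[OF g'_in[OF c], of k] by (simp add: g'_def)
  qed
  define \<psi> where "\<psi> = net_map m k"
  have \<psi>_eq: "\<psi> p c = nerve_map p (g'' p c)" for p c by (simp add: \<psi>_def net_map_def g''_def g'_def g_def)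
  have \<psi>_lin: "qlinear_on (oriented_chains K0 p) (\<psi> p)" for p
    using g''_lin[of p] unfolding qlinear_on_def \<psi>_eq by (simp add: nerve_map_linear)
  have \<psi>_in: "\<psi> p c \<in> oriented_chains K0 p" if "c \<in> oriented_chains K0 p" for p c
    unfolding \<psi>_eq by (rule nerve_map_in[OF g''_in[OF that]])
  have \<psi>_b: "\<psi> p (oriented_bdry (Suc p) c) = oriented_bdry (Suc p) (\<psi> (Suc p) c)"
    if "c \<in> oriented_chains K0 (Suc p)" for p c
    unfolding \<psi>_eq nerve_map_bdry g''b[OF that] ..
  \<comment> \<open>A simplex of \<open>K0\<close> has at most as many vertices as the net, so there
    are no nonzero chains above degree \<open>N\<close>.\<close>
  define N where "N = card (point_vertex ` S)"
  define F where "F = (\<lambda>p. oriented_gen ` {vs \<in> simplex_lists. length vs = Suc p})"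
  have F: "oriented_chains K0 p \<subseteq> qvs.span (F p)" for p
  proof
    fix c assume c: "c \<in> oriented_chains K0 p"
    show "c \<in> qvs.span (F p)"
      by (rule oriented_linear_in[where f = "\<lambda>c. c", OF _ c qvs.subspace_span])
        (auto simp: qlinear_on_def F_def simplex_lists_def intro!: qvs.span_base)
  qed
  have zero: "oriented_chains K0 p = {0}" if p: "N < p" for p
  proof -
    have "Poly_Mapping.keys c = {}" if c: "c \<in> oriented_chains K0 p" for c
    proof (rule ccontr)
      assume "Poly_Mapping.keys c \<noteq> {}"
      then obtain vs where v: "vs \<in> Poly_Mapping.keys c" by blast
      have "length vs = Suc p" "distinct vs" "set vs \<in> K0"
        using c v by (auto simp: oriented_chains_def)
      then have "Suc p = card (set vs)" "set vs \<subseteq> point_vertex ` S" by (auto simp: distinct_card K0_def)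
      then have "Suc p \<le> N" unfolding N_def using card_mono[OF finite_imageI[OF finite_S], of "set vs" point_vertex] by simp
      then show False using p by simp
    qed
    then show ?thesis using qvs.subspace_0[OF subspace_oriented_chains[of K0 p]] by auto
  qed
  have fin: "finite {A \<in> K0. card A = Suc p}" for p
    by (rule finite_subset[of _ "Pow (point_vertex ` S)"]) (use finite_S in \<open>auto simp: K0_def\<close>)
  have tr: "has_qtrace (oriented_chains K0 p) {0} (\<psi> p) 0" for p
  proof (rule displacing_trace[OF fin simplicial_K0 \<psi>_lin \<psi>_in])
    fix vs assume vs: "length vs = Suc p" "distinct vs" "set vs \<in> K0"
    then have l: "vs \<in> simplex_lists" by (simp add: simplex_lists_def)
    show "Poly_Mapping.lookup (\<psi> p (oriented_gen vs)) vs = 0"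
      unfolding \<psi>_def by (rule disp[OF vs(1) l m[OF l vs(1)]])
  qed
  have bd_in: "oriented_bdry (Suc p) c \<in> oriented_chains K0 p" if "c \<in> oriented_chains K0 (Suc p)" for p c
    using oriented_bdry_in[OF simplicial_K0 that] by (simp add: oriented_bdry_eq)
  have "\<exists>h. (\<forall>p. has_qtrace {c \<in> oriented_chains K0 p. oriented_bdry p c = 0}
        (oriented_bdry (Suc p) ` oriented_chains K0 (Suc p)) (\<psi> p) (h p)) \<and>
      (\<forall>p>N. h p = 0) \<and> (\<Sum>p\<le>N. (-1) ^ p * h p) = 0"
  proof (rule Hopf_trace[where F = F])
    show "finite (F p)" for p using finite_simplex_lists by (simp add: F_def)
  qed (simp_all add: subspace_oriented_chains F oriented_bdry_linear bd_in oriented_bdry_oriented_bdry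
      \<psi>_lin \<psi>_in \<psi>_b zero tr, simp add: oriented_bdry_eq)
  then obtain h where h: "\<And>p. has_qtrace (cycles N0 p) (boundaries N0 p) (\<psi> p) (h p)"
    "\<And>p. N < p \<Longrightarrow> h p = 0" "(\<Sum>p\<le>N. (-1) ^ p * h p) = 0"
    by (auto simp: cycles_def boundaries_def)
  have Pcyc: "\<mu> q z \<in> cycles SX q" if "z \<in> cycles N0 q" for q z
    by (rule qmorphD(1)[OF \<mu>_qmorph that])
  \<comment> \<open>Subdivision changes no class, neither before nor after \<open>\<phi>\<close>, so
    \<open>g'' q z\<close> is a legitimate choice for the image of \<open>\<mu> q z\<close>; by
    uniqueness \<open>\<psi>\<close> and \<open>descend\<close> after \<open>\<mu>\<close> agree
    modulo boundaries.\<close>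
  have \<psi>_link: "\<psi> q z - descend q (\<mu> q z) \<in> boundaries N0 q" if z: "z \<in> cycles N0 q" for q z
  proof -
    have zK: "z \<in> oriented_chains K0 q" using z by (simp add: cycles_def)
    have gz: "g q z \<in> cycles SO q"
    proof (cases q)
      case 0 then show ?thesis using g_in[OF zK] by (simp add: cycles_def)
    next
      case (Suc r)
      have "singular_bdry (Suc r) (g (Suc r) z) = g r (oriented_bdry (Suc r) z)"
        using gb zK Suc by simp
      also have "\<dots> = g r 0" using z Suc by (simp add: cycles_def)
      also have "\<dots> = 0" by (rule qlinear_on_0[OF g_lin qvs.subspace_0[OF subspace_oriented_chains]])
      finally show ?thesis using g_in[OF zK] Suc by (simp add: cycles_def)
    qed
    have "\<mu> q z - g q z \<in> boundaries SX q"
      unfolding g_def by (rule cong_sym[OF subspaces(3) qsd_pow_cong[OF Pcyc[OF z]]])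
    moreover have pc: "\<phi> q (g q z) \<in> cycles SC q" by (rule qmorphD(1)[OF \<phi>_qmorph gz])
    have "\<phi> q (g q z) - g'' q z \<in> boundaries SC q"
      unfolding g''_def g'_def by (rule cong_sym[OF subspaces(4) qsd_pow_cong[OF pc]])
    moreover have "g'' q z \<in> cycles SW q"
    proof -
      have "g'' q z \<in> cycles SC q"
        using \<open>\<phi> q (g q z) - g'' q z \<in> boundaries SC q\<close> pc qpair_singular[of XC q] qvs.subspace_diff[of "cycles SC q" "\<phi> q (g q z)" "\<phi> q (g q z) - g'' q z"]
        by (auto simp: qpair_def)
      then show ?thesis using g''_in[OF zK] by (simp add: cycles_def)
    qed
    ultimately have "linked q (\<mu> q z) (g'' q z)" unfolding linked_def using gz by blast
    then show ?thesis
      unfolding \<psi>_eq descend_def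
      using linked_unique[OF _ linked_link[OF Pcyc[OF z]]] qvs.subspace_0[OF subspaces(3)] by simp
  qed
  have \<psi>q: "qmorph (cycles N0 q) (boundaries N0 q) (cycles N0 q) (boundaries N0 q) (\<psi> q)" for q
  proof (rule qlinear_on_qmorph[OF _ qpair_oriented[OF simplicial_K0] subspaces(6)])
    show "qlinear_on (cycles N0 q) (\<psi> q)" by (rule qlinear_on_sub[OF \<psi>_lin]) (auto simp: cycles_def)
    show "\<psi> q z \<in> boundaries N0 q" if z: "z \<in> boundaries N0 q" for z
      using z \<psi>_b \<psi>_in by (auto simp: boundaries_def)
    fix z assume z: "z \<in> cycles N0 q"
    have "descend q (\<mu> q z) \<in> cycles N0 q" by (rule qmorphD(1)[OF descend_qmorph Pcyc[OF z]])
    moreover have "\<psi> q z - descend q (\<mu> q z) \<in> cycles N0 q"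
      using \<psi>_link[OF z] qpair_oriented[OF simplicial_K0, of q] by (auto simp: qpair_def)
    ultimately show "\<psi> q z \<in> cycles N0 q"
      using qvs.subspace_add[OF subspaces(7), of "\<psi> q z - descend q (\<mu> q z)" q "descend q (\<mu> q z)"] by simp
  qed
  have "trace_fin_rank (homology SX q) (induced_endo X \<O> \<phi> q) = h q" for q
    unfolding homology_eq
  proof (rule trace_fin_rank_factor[OF qpair_singular qpair_oriented[OF simplicial_K0] descend_qmorph \<mu>_qmorph
        induced_descend \<psi>q \<psi>_link h(1)])
    show "cycles N0 q \<subseteq> qvs.span (F q)" using F by (auto simp: cycles_def)
    show "finite (F q)" using finite_simplex_lists by (simp add: F_def)
  qed
  then have "Lefschetz X \<O> \<phi> = (\<Sum>q\<in>{q. h q \<noteq> 0}. (-1) ^ q * h q)"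
    by (simp add: Lefschetz_def)
  also have "\<dots> = (\<Sum>q\<le>N. (-1) ^ q * h q)"
    using h(2) by (intro sum.mono_neutral_left) (auto simp: not_less[symmetric])
  finally show ?thesis using h(3) by simp
qed

end

section \<open>Fixed points\<close>

text \<open>Around each \<open>c\<close> upper semicontinuity yields a ball whose points have values
  away from \<open>c\<close>. Finitely many such balls are selected so as to cover the compact set
  that contains the values, and not the space of arguments.\<close>

lemma (in Metric_space) uniform_displacement:
  assumes F: "multivalued_map mtopology mtopology F" "compact_multivalued mtopology mtopology F"
    "upper_semicontinuous mtopology mtopology F"
    and nofix: "\<And>x. x \<in> M \<Longrightarrow> x \<notin> F x"
  shows "\<exists>\<rho>>0. \<forall>x\<in>M. \<forall>y\<in>F x. \<rho> \<le> d x y"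
proof -
  obtain C where C: "compactin mtopology C" "\<And>x. x \<in> M \<Longrightarrow> F x \<subseteq> C"
    using F(2) by (auto simp: compact_multivalued_def)
  have CM: "C \<subseteq> M" using compactin_subset_topspace[OF C(1)] by simp
  \<comment> \<open>The ball for \<open>x\<close> has twice the radius of the ball for values: a
    point \<open>x\<close> with a value in the small ball, at distance below \<open>t\<close> from
    \<open>x\<close>, lies in the large one.\<close>
  have "\<exists>t>0. \<forall>x\<in>mball c (2 * t). F x \<inter> mball c t = {}" if c: "c \<in> M" for c
  proof -
    have "closedin mtopology (F c)" using F(1) c by (auto simp: multivalued_map_def)
    then obtain s where s: "s > 0" "disjnt (F c) (mball c s)"
      using c nofix unfolding closedin_metric by blast
    have Fc: "F c \<subseteq> M" using C(2)[OF c] CM by blast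
    let ?U = "M - mcball c (s / 2)"
    have "openin mtopology ?U" by (metis closedin_mcball openin_topspace openin_diff topspace_mtopology)
    then have "openin mtopology {x \<in> M. F x \<subseteq> ?U}"
      using F(3) by (simp add: upper_semicontinuous_def)
    moreover have "F c \<subseteq> ?U"
    proof
      fix y assume y: "y \<in> F c"
      then have "\<not> d c y < s" using s(2) c Fc by (auto simp: disjnt_iff)
      then show "y \<in> ?U" using y Fc s(1) by auto
    qed
    ultimately obtain r where r: "r > 0" "mball c r \<subseteq> {x \<in> M. F x \<subseteq> ?U}"
      using c unfolding openin_mtopology by blast
    \<comment> \<open>The double of the radius is at most \<open>r\<close>, where upper
      semicontinuity controls the values, and the radius itself is at most \<open>s / 4\<close>, so
      the ball of values lies inside the excluded closed ball of radius
      \<open>s / 2\<close>.\<close>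
    have "F x \<inter> mball c (min r (s / 2) / 2) = {}" if "x \<in> mball c (2 * (min r (s / 2) / 2))" for x
    proof -
      have "x \<in> mball c r" using that by auto
      then have "F x \<subseteq> ?U" using r(2) by blast
      then show ?thesis using s(1) by auto
    qed
    then show ?thesis using r(1) s(1) by (intro exI[of _ "min r (s / 2) / 2"]) auto
  qed
  then obtain t where t: "\<And>c. c \<in> M \<Longrightarrow> t c > 0" "\<And>c x. c \<in> M \<Longrightarrow> x \<in> mball c (2 * t c) \<Longrightarrow> F x \<inter> mball c (t c) = {}"
    by metis
  have "\<exists>\<F>. finite \<F> \<and> \<F> \<subseteq> (\<lambda>c. mball c (t c)) ` C \<and> C \<subseteq> \<Union>\<F>"
  proof -
    have "C \<subseteq> \<Union>((\<lambda>c. mball c (t c)) ` C)" using t(1) CM by auto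
    then show ?thesis using C(1) unfolding compactin_def by auto
  qed
  then obtain \<F> where \<F>: "finite \<F>" "\<F> \<subseteq> (\<lambda>c. mball c (t c)) ` C" "C \<subseteq> \<Union>\<F>" by blast
  obtain J where J: "J \<subseteq> C" "finite J" "\<F> = (\<lambda>c. mball c (t c)) ` J"
    using finite_subset_image[OF \<F>(1,2)] by blast
  note JC = \<F>(3)[unfolded J(3)]
  \<comment> \<open>Inserting 1 keeps the minimum defined if \<open>J\<close> is empty.\<close>
  define \<rho> where "\<rho> = Min (insert 1 (t ` J))"
  have "t c > 0" if "c \<in> J" for c using that J(1) t(1) CM by blast
  then have "\<rho> > 0" unfolding \<rho>_def using J(2) by simp
  moreover have "\<rho> \<le> d x y" if x: "x \<in> M" and y: "y \<in> F x" for x y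
  proof (rule ccontr)
    assume "\<not> \<rho> \<le> d x y"
    have "y \<in> C" using C(2)[OF x] y by blast
    then obtain c where c: "c \<in> J" "y \<in> mball c (t c)" using JC by blast
    have "\<rho> \<le> t c" unfolding \<rho>_def using c(1) J(2) by simp
    then have "d x y < t c" using \<open>\<not> \<rho> \<le> d x y\<close> by simp
    moreover have "d c x \<le> d c y + d x y" using triangle[of c y x] c(2) x by (simp add: commute)
    ultimately have "x \<in> mball c (2 * t c)" using c(2) x by auto
    moreover have "c \<in> M" using c(1) J(1) CM by blast
    ultimately show False using t(2) y c(2) by blast
  qed
  ultimately show ?thesis by blast
qed

lemma keys_qsd_pow_qlift:
  assumes "f \<in> Poly_Mapping.keys (qsd_pow k p (qlift h c))"
  obtains g where "g \<in> Poly_Mapping.keys c" "f \<in> Poly_Mapping.keys (qsd_pow k p (h g))"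
proof -
  have "qsd_pow k p (qlift h c) = qlift (\<lambda>g. qlift (\<lambda>f. qsd_pow k p (gen f)) (h g)) c"
    unfolding qsd_pow_qlift[of k p "qlift h c"] by (rule qlift_qlift)
  also have "\<dots> = qlift (\<lambda>g. qsd_pow k p (h g)) c"
    by (simp only: qsd_pow_qlift[symmetric])
  finally have "qsd_pow k p (qlift h c) = qlift (\<lambda>g. qsd_pow k p (h g)) c" .
  then show ?thesis using that assms keys_qlift[of "\<lambda>g. qsd_pow k p (h g)" c] by auto
qed

lemma ss_chains_subtopologyD:
  assumes "c \<in> ss_chains p (subtopology X A)" "f \<in> Poly_Mapping.keys c"
  shows "f ` standard_simplex p \<subseteq> A"
proof -
  have "singular_simplex p (subtopology X A) f" using subsetD[of "Poly_Mapping.keys c" _ f] assms by auto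
  then show ?thesis by (simp add: singular_simplex_subtopology)
qed

lemma ss_chains_supportI:
  assumes "c \<in> ss_chains p X" "chain_support p c \<subseteq> A"
  shows "c \<in> ss_chains p (subtopology X A)"
proof -
  have "singular_simplex p (subtopology X A) f" if f: "f \<in> Poly_Mapping.keys c" for f
  proof -
    have "singular_simplex p X f" using assms(1) f subsetD[of "Poly_Mapping.keys c" _ f] by auto
    moreover have "f ` standard_simplex p \<subseteq> A" using assms(2) f unfolding chain_support_def by blast
    ultimately show ?thesis by (simp add: singular_simplex_subtopology)
  qed
  then show ?thesis by auto
qed

text \<open>A simplex of \<open>K0\<close> occurring in its own image would yield \<open>x'\<close>
  and \<open>e \<in> F x'\<close> at distance below \<open>\<rho>\<close>: smallness of the
  realization ties its net points to the singular simplices that realize it, and the approximation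
  ties their images to \<open>F\<close>.\<close>

lemma Lefschetz_approximation_zero:
  fixes X :: "'a topology" and d :: "'a \<Rightarrow> 'a \<Rightarrow> real"
  assumes M: "Metric_space (topspace X) d" and top: "Metric_space.mtopology (topspace X) d = X"
    and ANR: "algebraic_ANR TYPE('a vertex) X"
    and F: "\<And>x. x \<in> topspace X \<Longrightarrow> F x \<subseteq> topspace X"
    and \<rho>: "\<rho> > 0" "\<And>x y. x \<in> topspace X \<Longrightarrow> y \<in> F x \<Longrightarrow> \<rho> \<le> d x y"
    and \<U>: "open_cover X \<U>" "finer \<U> ((\<lambda>x. Metric_space.mball (topspace X) d x (\<rho> / 8)) ` topspace X)"
    and \<epsilon>: "\<epsilon> < \<rho> / 8"
    and appr: "approximation X X d F \<U> \<epsilon> \<O> \<phi>"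
  shows "Lefschetz X \<O> \<phi> = 0"
proof -
  interpret Metric_space "topspace X" d by (rule M)
  let ?balls = "(\<lambda>x. mball x (\<rho> / 8)) ` topspace X"
  have "openin X (mball x r)" for x r using openin_mball[of x r] by (simp only: top)
  then have balls: "open_cover X ?balls" using \<rho>(1) by (auto simp: open_cover_def)
  have cover: "open_cover X \<O>" and \<phi>: "chain_morphism (small_singular_complex X \<O>) (singular_complex X) \<phi>"
    using appr by (simp_all only: approximation_def compact_chain_morphism_def)
  obtain C where C: "compactin X C" and \<phi>_into: "\<And>p. \<phi> p ` chains (small_singular_complex X \<O>) p \<subseteq> chains (singular_complex (subtopology X C)) p"
    using appr unfolding approximation_def compact_chain_morphism_def by (elim conjE exE) (rule that, assumption, erule spec)
  have near_F: "\<And>V. V \<in> \<O> \<Longrightarrow> \<exists>U\<in>\<U>. V \<subseteq> U \<and> (\<forall>p. \<phi> p ` chains (singular_complex (subtopology X V)) p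
      \<subseteq> chains (singular_complex (subtopology X (nbhd X d (\<Union>x\<in>U. F x) \<epsilon>))) p)"
    using appr unfolding approximation_def by (elim conjE) (rule bspec)
  have CM: "C \<subseteq> topspace X" by (rule compactin_subset_topspace[OF C])
  obtain \<V> where \<V>: "open_cover X \<V>" and ext: "\<And>(K :: 'a vertex set set) L \<mu>. simplicial_complex K \<Longrightarrow>
      partial_realization X \<V> K L \<mu> \<Longrightarrow> (\<exists>\<mu>'. complete_realization X ?balls K \<mu>' \<and>
        (\<forall>p. \<forall>c\<in>chains (oriented_complex L) p. \<mu>' p c = \<mu> p c))"
    using ANR balls unfolding algebraic_ANR_def by metis
  obtain \<mu> where \<mu>: "complete_realization X ?balls (vertex_complex X \<V>) \<mu>"
    and \<mu>_flag: "\<And>p c. c \<in> oriented_chains (flag_complex X \<V>) p \<Longrightarrow> \<mu> p c = flag_map c"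
    using ext[OF simplicial_vertex_complex partial_realization_flag_map] unfolding chains_oriented by blast
  \<comment> \<open>A Lebesgue number of \<open>\<V>\<close> on the compact set
    \<open>C\<close>.\<close>
  obtain r where r: "r > 0" "\<And>x. x \<in> C \<Longrightarrow> \<exists>V\<in>\<V>. mball x r \<subseteq> V"
    using lebesgue_number[of C \<V>] C \<V> CM unfolding top open_cover_def by auto
  \<comment> \<open>With \<open>r / 4\<close>, net points of a set of radius \<open>r / 4\<close>
    remain in the ball of radius \<open>r\<close>; \<open>\<rho> / 8\<close> is the share of the net
    in the final estimate.\<close>
  define \<delta> where "\<delta> = min (r / 4) (\<rho> / 8)"
  have \<delta>: "\<delta> > 0" "\<delta> \<le> r / 4" "\<delta> \<le> \<rho> / 8" using r(1) \<rho>(1) by (auto simp: \<delta>_def)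
  have "\<exists>\<F>. finite \<F> \<and> \<F> \<subseteq> (\<lambda>c. mball c \<delta>) ` C \<and> C \<subseteq> \<Union>\<F>"
  proof -
    have "C \<subseteq> \<Union>((\<lambda>c. mball c \<delta>) ` C)" using \<delta>(1) CM by auto
    then show ?thesis using C \<open>\<And>x r. openin X (mball x r)\<close> unfolding compactin_def by auto
  qed
  then obtain \<F> where \<F>: "finite \<F>" "\<F> \<subseteq> (\<lambda>c. mball c \<delta>) ` C" "C \<subseteq> \<Union>\<F>" by blast
  obtain S where S: "S \<subseteq> C" "finite S" "\<F> = (\<lambda>c. mball c \<delta>) ` S"
    using finite_subset_image[OF \<F>(1,2)] by blast
  note SC = \<F>(3)[unfolded S(3)]
  define near where "near = (\<lambda>y. SOME c. c \<in> S \<and> d c y < \<delta>)"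
  have near_net: "near y \<in> S" "d (near y) y < \<delta>" if "y \<in> C" for y
  proof -
    have "\<exists>c. c \<in> S \<and> d c y < \<delta>" using subsetD[OF SC that] by auto
    then have "near y \<in> S \<and> d (near y) y < \<delta>" unfolding near_def by (rule someI_ex)
    then show "near y \<in> S" "d (near y) y < \<delta>" by auto
  qed
  define \<W> where "\<W> = (\<lambda>x. mball x (r / 4) \<inter> C) ` C"
  interpret compact_morphism_net X ?balls \<V> \<W> \<mu> C S near \<O> \<phi>
  proof
    show "complete_realization X ?balls (vertex_complex X \<V>) \<mu>" by (rule \<mu>)
    show "S \<subseteq> topspace X" using S(1) CM by blast
    show "\<And>W. W \<in> \<W> \<Longrightarrow> openin (subtopology X C) W"
      unfolding \<W>_def using \<open>\<And>x r. openin X (mball x r)\<close> by (auto simp: openin_subtopology)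
    show "C \<subseteq> \<Union>\<W>" unfolding \<W>_def using r(1) CM by auto
    fix W assume "W \<in> \<W>"
    then obtain x where x: "x \<in> C" "W = mball x (r / 4) \<inter> C" by (auto simp: \<W>_def)
    obtain V where V: "V \<in> \<V>" "mball x r \<subseteq> V" using r(2)[OF x(1)] by blast
    have "W \<union> near ` W \<subseteq> mball x r"
    proof -
      have "near y \<in> mball x r" if y: "y \<in> W" for y
      proof -
        have yC: "y \<in> C" "d x y < r / 4" using y x by auto
        have nM: "near y \<in> topspace X" using near_net(1)[OF yC(1)] S(1) CM by blast
        have "d x (near y) \<le> d x y + d (near y) y"
          using triangle[of x y "near y"] nM yC(1) x(1) CM by (simp add: commute subset_iff)
        then show ?thesis using near_net(2)[OF yC(1)] yC(2) \<delta>(2) r(1) nM x(1) CM by auto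
      qed
      moreover have "W \<subseteq> mball x r" using x(2) r(1) by auto
      ultimately show ?thesis by blast
    qed
    then show "\<exists>V\<in>\<V>. W \<union> near ` W \<subseteq> V" using V by blast
  next
    show "\<phi> p c \<in> ss_chains p (subtopology X C)" if "c \<in> chains (small_singular_complex X \<O>) p" for p c
      using \<phi>_into[of p] that by auto
  qed (use \<mu>_flag S(2) CM near_net(1) cover \<phi> in auto)
  show ?thesis
  proof (rule Lefschetz_zero_if_displacing, rule ccontr)
    fix m k p vs
    assume len: "length vs = Suc p" and vs: "vs \<in> simplex_lists"
      and sm: "qsd_pow m p (\<mu> p (oriented_gen vs)) \<in> chains SO p"
      and nz: "Poly_Mapping.lookup (net_map m k p (oriented_gen vs)) vs \<noteq> 0"
    define x where "x = qsd_pow m p (\<mu> p (oriented_gen vs))"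
    have K: "set vs \<in> K" and dist: "distinct vs" and inS: "set vs \<subseteq> point_vertex ` S"
      using vs by (auto simp: simplex_lists_def K0_def)
    \<comment> \<open>One ball contains the realizations of all faces of \<open>vs\<close>: of the
      whole simplex, from which \<open>g\<close> will come, and of the single vertices, which are
      net points.\<close>
    obtain B where B: "B \<in> ?balls" and suppB: "\<And>\<tau> us. \<tau> \<in> K \<Longrightarrow> \<tau> \<subseteq> set vs \<Longrightarrow> distinct us \<Longrightarrow> set us = \<tau> \<Longrightarrow>
        chain_support (length us - 1) (\<mu> (length us - 1) (oriented_gen us)) \<subseteq> B"
    proof -
      have p: "partial_realization X ?balls K K \<mu>" using \<mu> by (simp only: complete_realization_def)
      obtain U where U: "U \<in> ?balls" and "\<forall>\<tau>\<in>K. \<tau> \<subseteq> set vs \<longrightarrow> (\<forall>us. distinct us \<and> set us = \<tau> \<longrightarrow>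
          chain_support (length us - 1) (\<mu> (length us - 1) (oriented_gen us)) \<subseteq> U)"
        using bspec[OF p[unfolded partial_realization_def, THEN conjunct2, THEN conjunct2, THEN conjunct2, THEN conjunct2] K]
        by (elim bexE) (rule that)
      then show ?thesis by (intro that[OF U]) simp
    qed
    obtain b where b: "b \<in> topspace X" "B = mball b (\<rho> / 8)" using B by auto
    have "vs \<in> Poly_Mapping.keys (orient (qlift (nu p) (qsd_pow k p (\<phi> p x))))"
      using nz by (simp add: in_keys_iff net_map_def nerve_map_def x_def)
    then obtain us where us: "us \<in> Poly_Mapping.keys (qlift (nu p) (qsd_pow k p (\<phi> p x)))" "mset vs = mset us"
      using keys_orient by blast
    obtain f where f: "f \<in> Poly_Mapping.keys (qsd_pow k p (\<phi> p x))"
        "us = map (\<lambda>y. point_vertex (near (f y))) (unit_list p)"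
      using us(1) keys_qlift[of "nu p" "qsd_pow k p (\<phi> p x)"] by (auto simp: nu_def)
    have "\<phi> p x = qlift (\<lambda>g. \<phi> p (gen g)) x"
    proof (rule qlinear_on_eq_qlift)
      show "qlinear_on {c. Poly_Mapping.keys c \<subseteq> small_simplex X \<O> p} (\<phi> p)"
        using \<phi> by (simp add: chain_morphism_def qlinear_on_def)
      show "Poly_Mapping.keys x \<subseteq> small_simplex X \<O> p" using sm by (simp add: x_def)
    qed
    then obtain g where g: "g \<in> Poly_Mapping.keys x" "f \<in> Poly_Mapping.keys (qsd_pow k p (\<phi> p (gen g)))"
      using f(1) keys_qsd_pow_qlift[of f k p "\<lambda>g. \<phi> p (gen g)" x] by metis
    have "g \<in> small_simplex X \<O> p" using g(1) sm by (auto simp: x_def)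
    then obtain V where V: "V \<in> \<O>" "g ` standard_simplex p \<subseteq> V" "singular_simplex p X g" by auto
    obtain U where U: "U \<in> \<U>" "V \<subseteq> U" and img: "\<phi> p ` chains (singular_complex (subtopology X V)) p
      \<subseteq> chains (singular_complex (subtopology X (nbhd X d (\<Union>x\<in>U. F x) \<epsilon>))) p" using near_F[OF V(1)] by blast
    obtain a where a: "a \<in> topspace X" "U \<subseteq> mball a (\<rho> / 8)" using \<U>(2) U(1) by (auto simp: finer_def)
    have "gen g \<in> chains (singular_complex (subtopology X V)) p"
      using V by (simp add: singular_simplex_subtopology)
    then have "\<phi> p (gen g) \<in> ss_chains p (subtopology X (nbhd X d (\<Union>x\<in>U. F x) \<epsilon>))"
      using img unfolding chains_singular by blast
    then have "qsd_pow k p (\<phi> p (gen g)) \<in> ss_chains p (subtopology X (nbhd X d (\<Union>x\<in>U. F x) \<epsilon>))"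
      by (rule qsd_pow_in)
    then have f_nbhd: "f ` standard_simplex p \<subseteq> nbhd X d (\<Union>x\<in>U. F x) \<epsilon>"
      using g(2) by (rule ss_chains_subtopologyD)
    have "qsd_pow k p (\<phi> p x) \<in> ss_chains p XC"
      unfolding x_def by (rule qsd_pow_in[OF \<phi>_C[OF sm]])
    then have f_C: "f ` standard_simplex p \<subseteq> C"
      using f(1) by (rule ss_chains_subtopologyD)
    define y where "y = f (unit_point 0)"
    have u0: "unit_point 0 \<in> set (unit_list p)" by (simp add: unit_list_def del: upt_Suc)
    then have y: "y \<in> C" "y \<in> nbhd X d (\<Union>x\<in>U. F x) \<epsilon>"
      using f_C f_nbhd set_unit_list[of p] unfolding y_def by blast+
    obtain x' e where e: "x' \<in> U" "e \<in> F x'" "d y e < \<epsilon>" using y(2) by (auto simp: nbhd_def)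
    have "point_vertex (near y) \<in> set us" using u0 by (auto simp: f(2) y_def)
    then have c_vs: "point_vertex (near y) \<in> set vs" using us(2) mset_eq_setD by metis
    \<comment> \<open>The realization of a vertex is prescribed as a flag of length one, here the
      constant simplex at the net point, so the point itself lies in \<open>B\<close>.\<close>
    have c_B: "near y \<in> B"
    proof -
      have sK: "{point_vertex (near y)} \<in> K"
        using bspec[OF simplicial_vertex_complex[of X \<V>, unfolded simplicial_complex_def, THEN conjunct2] K] c_vs
        by (elim allE[of _ "{point_vertex (near y)}"]) simp
      have fl: "flag [point_vertex (near y)]" by (simp add: flag_def)
      have nM: "near y \<in> topspace X" using near_net(1)[OF y(1)] S(1) CM by blast
      have "{point_vertex (near y)} \<in> flag_complex X \<V>"
        using sK fl unfolding flag_complex_def by (auto intro!: exI[of _ "[point_vertex (near y)]"])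
      then have "oriented_gen [point_vertex (near y)] \<in> oriented_chains (flag_complex X \<V>) 0"
        by (intro oriented_gen_in_chains) auto
      then have "\<mu> 0 (oriented_gen [point_vertex (near y)]) = gen (geo [point_vertex (near y)])"
        using \<mu>_flag flag_map_oriented_gen[OF fl] by simp
      then have "chain_support 0 (gen (geo [point_vertex (near y)])) \<subseteq> B"
        using suppB[OF sK, of "[point_vertex (near y)]"] c_vs by simp
      then have gB: "geo [point_vertex (near y)] ` standard_simplex 0 \<subseteq> B" by (simp add: chain_support_def)
      have gn: "geo [point_vertex (near y)] ` standard_simplex 0 \<subseteq> {near y}"
        using singular_simplex_geo(2)[OF fl, of X] valid_point_vertex[OF nM] by simp
      obtain u where "u \<in> standard_simplex 0" using nonempty_standard_simplex[of 0] by blast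
      then have "geo [point_vertex (near y)] u \<in> B" "geo [point_vertex (near y)] u = near y"
        using subsetD[OF gB imageI] subsetD[OF gn imageI] by auto
      then show ?thesis by simp
    qed
    have "chain_support p (\<mu> p (oriented_gen vs)) \<subseteq> B"
      using suppB[OF K _ dist] len by simp
    moreover have "\<mu> p (oriented_gen vs) \<in> ss_chains p X"
      by (rule \<mu>_in[OF oriented_gen_K[OF vs len]])
    ultimately have "\<mu> p (oriented_gen vs) \<in> ss_chains p (subtopology X B)"
      by (intro ss_chains_supportI)
    then have "x \<in> ss_chains p (subtopology X B)" unfolding x_def by (rule qsd_pow_in)
    then have gB: "g ` standard_simplex p \<subseteq> B" using g(1)[folded x_def] by (rule ss_chains_subtopologyD)
    \<comment> \<open>The simplex \<open>g\<close> lies in \<open>U\<close> because it is small for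
      \<open>\<O>\<close>, and in \<open>B\<close> because the realization is small; any of its
      points links the two balls.\<close>
    obtain t where t: "t \<in> U" "t \<in> B"
    proof -
      obtain u where u: "u \<in> standard_simplex p" using nonempty_standard_simplex[of p] by blast
      show ?thesis
        by (rule that[of "g u"], rule subsetD[OF U(2) subsetD[OF V(2) imageI[OF u]]], rule subsetD[OF gB imageI[OF u]])
    qed
    have ta: "t \<in> mball a (\<rho> / 8)" "x' \<in> mball a (\<rho> / 8)" using subsetD[OF a(2)] t(1) e(1) by blast+
    have tb: "t \<in> mball b (\<rho> / 8)" "near y \<in> mball b (\<rho> / 8)" using t(2) c_B b(2) by simp_all
    have mem: "t \<in> topspace X" "x' \<in> topspace X" "y \<in> topspace X" "near y \<in> topspace X"
      using ta tb subsetD[OF CM y(1)] by auto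
    have mem_e: "e \<in> topspace X" by (rule subsetD[OF F[OF mem(2)] e(2)])
    \<comment> \<open>The four summands stay below \<open>\<rho> / 4\<close>,
      \<open>\<rho> / 4\<close>, \<open>\<rho> / 8\<close> and \<open>\<rho> / 8\<close>: the
      diameters of two balls, the mesh of the net, and \<open>\<epsilon>\<close>.\<close>
    have "d x' e \<le> d x' t + d t (near y) + d (near y) y + d y e"
      using triangle[of x' t e] triangle[of t "near y" e] triangle[of "near y" y e] mem mem_e by linarith
    moreover have "d x' t < \<rho> / 8 + \<rho> / 8"
      using triangle[of x' a t] a(1) ta by (auto simp: commute)
    moreover have "d t (near y) < \<rho> / 8 + \<rho> / 8"
      using triangle[of t b "near y"] b(1) tb by (auto simp: commute)
    moreover have "d (near y) y < \<rho> / 8" using near_net(2)[OF y(1)] \<delta>(3) by simp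
    ultimately have "d x' e < \<rho>" using e(3) \<epsilon> \<rho>(1) by linarith
    then show False using \<rho>(2)[OF mem(2) e(2)] by simp
  qed
qed

theorem mainTheorem1:
  fixes X :: "'a topology"
    and d :: "'a \<Rightarrow> 'a \<Rightarrow> real"
    and F :: "'a \<Rightarrow> 'a set"
  assumes "compatible_metric X d"
    and "algebraic_ANR TYPE('a vertex) X"
    and "multivalued_map X X F"
    and "compact_multivalued X X F"
    and "upper_semicontinuous X X F"
    and "approximable X X d F"
  shows "(\<forall>\<Lambda>. has_Lefschetz_number X d F \<Lambda> \<and> \<Lambda> \<noteq> {0} \<longrightarrow> (\<exists>x\<in>topspace X. x \<in> F x)) \<and>
         (reduced_homology_zero (singular_complex X) \<longrightarrow> (\<exists>x\<in>topspace X. x \<in> F x))"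
proof (cases "\<exists>x\<in>topspace X. x \<in> F x")
  case False
  have M: "Metric_space (topspace X) d" and top: "Metric_space.mtopology (topspace X) d = X"
    using assms(1) by (auto simp: compatible_metric_def)
  interpret Metric_space "topspace X" d by (rule M)
  have FM: "F x \<subseteq> topspace X" if "x \<in> topspace X" for x
    using assms(3) that closedin_subset unfolding multivalued_map_def by blast
  obtain \<rho> where \<rho>: "\<rho> > 0" "\<And>x y. x \<in> topspace X \<Longrightarrow> y \<in> F x \<Longrightarrow> \<rho> \<le> d x y"
    using uniform_displacement[unfolded top, OF assms(3-5)] False by blast
  let ?balls = "(\<lambda>x. mball x (\<rho> / 8)) ` topspace X"
  have "openin X (mball x r)" for x r using openin_mball[of x r] by (simp only: top)
  then have balls: "open_cover X ?balls" using \<rho>(1) by (auto simp: open_cover_def)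
  have zero: "Lefschetz X \<O> \<phi> = 0"
    if "open_cover X \<U>" "finer \<U> ?balls" "\<epsilon> < \<rho> / 8" "approximation X X d F \<U> \<epsilon> \<O> \<phi>" for \<U> \<epsilon> \<O> \<phi>
    by (rule Lefschetz_approximation_zero[OF M top assms(2) FM \<rho> that])
  have refl: "finer \<U> \<U>" for \<U> :: "'a set set" by (auto simp: finer_def)
  have const: "q = 0" if q: "Lefschetz_constant X d F q" for q
  proof -
    obtain \<U>0 \<epsilon>0 where 0: "open_cover X \<U>0" "\<epsilon>0 > 0"
      "\<And>\<U> \<epsilon> \<O> \<phi>. open_cover X \<U> \<Longrightarrow> finer \<U> \<U>0 \<Longrightarrow> 0 < \<epsilon> \<Longrightarrow> \<epsilon> < \<epsilon>0 \<Longrightarrow>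
        approximation X X d F \<U> \<epsilon> \<O> \<phi> \<Longrightarrow> Lefschetz X \<O> \<phi> = q"
      using q unfolding Lefschetz_constant_def by blast
    \<comment> \<open>A common refinement of the cover belonging to \<open>q\<close> and the cover
      by balls, with \<open>\<epsilon>\<close> below both bounds. Approximability provides an
      approximation at this scale, so the value \<open>q\<close> is really attained.\<close>
    define \<U> where "\<U> = {A \<inter> B | A B. A \<in> \<U>0 \<and> B \<in> ?balls}"
    define \<epsilon> where "\<epsilon> = min (\<epsilon>0 / 2) (\<rho> / 16)"
    have \<epsilon>: "0 < \<epsilon>" "\<epsilon> < \<epsilon>0" "\<epsilon> < \<rho> / 8" using 0(2) \<rho>(1) by (auto simp: \<epsilon>_def)
    have cov: "open_cover X \<U>"
    proof -
      have "\<Union>\<U> = \<Union>\<U>0 \<inter> \<Union>?balls" unfolding \<U>_def by blast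
      moreover have "openin X W" if "W \<in> \<U>" for W
        using that 0(1) balls unfolding \<U>_def open_cover_def by auto
      ultimately show ?thesis using 0(1) balls unfolding open_cover_def by auto
    qed
    have fin: "finer \<U> \<U>0" "finer \<U> ?balls" unfolding finer_def \<U>_def by blast+
    obtain \<O> \<phi> where "approximation X X d F \<U> \<epsilon> \<O> \<phi>"
      using assms(6) cov \<epsilon>(1) unfolding approximable_def by blast
    then show "q = 0" using 0(3)[OF cov fin(1) \<epsilon>(1,2)] zero[OF cov fin(2) \<epsilon>(3)] by metis
  qed
  \<comment> \<open>The exceptional case would provide an approximation with value 1 at a scale
    where only 0 occurs.\<close>
  have "\<not> Lefschetz_all X d F"
  proof
    assume "Lefschetz_all X d F"
    then obtain \<O> \<phi> where "approximation X X d F ?balls (\<rho> / 16) \<O> \<phi>" "Lefschetz X \<O> \<phi> = 1"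
      using balls \<rho>(1) unfolding Lefschetz_all_def by (metis divide_pos_pos zero_less_numeral)
    then show False using zero[OF balls refl, of "\<rho> / 16" \<O> \<phi>] \<rho>(1) by simp
  qed
  moreover have "\<not> reduced_homology_zero (singular_complex X)"
  proof
    assume red: "reduced_homology_zero (singular_complex X)"
    obtain \<O> \<phi> where a: "approximation X X d F ?balls (\<rho> / 16) \<O> \<phi>"
      using assms(6) balls \<rho>(1) unfolding approximable_def by (metis divide_pos_pos zero_less_numeral)
    have "Lefschetz X \<O> \<phi> = 1"
      using a by (intro Lefschetz_reduced_homology_zero[OF _ _ red])
        (auto simp: approximation_def compact_chain_morphism_def)
    then show False using zero[OF balls refl _ a] \<rho>(1) by simp
  qed
  ultimately show ?thesis using const unfolding has_Lefschetz_number_def by blast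
qed blast

end
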